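(* Let $\mathbb X=\mathbb R^d$, let $\pi$ be a Borel probability measure on $\mathbb X$, let $\alpha\in(0,1)$, and let $U$ be a Markov kernel on $\mathbb R^d$ with stationary measure $\pi$. Let $(X_n)_{n\ge 0}$ be the canonical Markov chain with transition kernel $P=\alpha\pi+(1-\alpha)U$, let $\xi:\mathbb X\to[0,+\infty)$ be measurable, and let $S_n=\sum_{k=0}^n\xi(X_k)$. (1) Let $p>1$ and let $\mu$ be a probability distribution on $\mathbb X$ absolutely continuous with respect to $\pi$ with density in $\mathbb L^p(\pi)$. Then $(S_n)_n$ is multiplicatively ergodic on the interval $J_0=\{\gamma>0: r(\gamma)>1-\alpha\}$ with respect to $\mathbb P_\mu$. (2) Assume $\alpha>1/2$ and $$2\alpha\sum_{n\ge0}(2(1-\alpha))^n\,\mathbb P_\pi\Big(\sum_{k=0}^n\xi(Z_k)=0\Big)<1,$$ where $(Z_n)_n$ is a Markov process with transition kernel $U$ (and $Z_0\sim\pi$ under $\mathbb P_\pi$). Then $\nu:=\inf\{\gamma>0: g_Y(\gamma,2)<\infty\}<\infty$ with respect to $\mathbb P_\pi$ and with respect to $\mathbb P_\mu$ for every probability distribution $\mu$ absolutely continuous with respect to $\pi$ with density in $\mathbb L^p(\pi)$ for some $p>1$. (This is the case in particular if $\alpha>1/2$ and $\pi(\xi=0)=0$.) (3) Assume, in addition to the assumptions of (2), that $\pi(\xi^\tau)<\infty$ for some $\tau>1$. Then the limit $C_\nu:=\lim_{\gamma\to\nu+}\frac{\gamma-\nu}{\gamma}g_Y(\gamma,2)$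 exists and is finite with respect to $\mathbb P_\pi$ and with respect to $\mathbb P_\mu$ for every probability distribution $\mu$ admitting a density with respect to $\pi$ which belongs to $\mathbb L^p(\pi)$ for some $p>\frac{\tau}{\tau-1}$.
   Context: $P=\alpha\pi+(1-\alpha)U$ means $P(x,dy)=\alpha\,\pi(dy)+(1-\alpha)U(x,dy)$; $\pi$ is $P$-invariant. The random variables $\xi(X_n)$ are assumed not identically zero. $\mathbb P_\mu$ is the law of the chain with $X_0\sim\mu$, with expectation $\mathbb E_\mu$. For $\gamma\ge0$, $P_\gamma f(x)=\int f(y)e^{-\gamma\xi(y)}P(x,dy)$, and $r(\gamma)$ is the spectral radius of $P_\gamma$ acting on $\mathbb L^a(\pi)$, where $a$ is any fixed real number with $a>\frac{p}{p-1}$. For a given initial law $\mu$, $L_Y^{(n)}(\gamma)=\mathbb E_\mu[e^{-\gamma S_n}]$ and $g_Y(\gamma,\lambda)=\sum_{n\ge0}\lambda^nL_Y^{(n)}(\gamma)\in[0,+\infty]$. $(S_n)_n$ is called multiplicatively ergodic on an interval $J=[0,\gamma_1)$ or $J=(0,\gamma_1)$ (with $0<\gamma_1\le+\infty$) if there exist two continuous maps $A,\rho:J\to(0,+\infty)$ such that for every compact $K\subset(0,\gamma_1)$ there exist $M_K>0$ and $\theta_K\in(0,1)$ with $|L_Y^{(n)}(\gamma)-A(\gamma)\rho(\gamma)^n|\le M_K(\rho(\gamma)\theta_K)^n$ for all $\gamma\in K$, $n\ge1$. *)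

theory Defs
  imports "HOL-Probability.Probability"
begin

section \<open>Markov chains on path space\<close>

text \<open>A Markov kernel on a topological space is an element of
  \<open>borel \<rightarrow>\<^sub>M prob_algebra borel\<close>.\<close>

definition mixture_kernel ::
    "real \<Rightarrow> 'a::topological_space measure \<Rightarrow> ('a \<Rightarrow> 'a measure) \<Rightarrow> 'a \<Rightarrow> 'a measure" where
  "mixture_kernel \<alpha> \<pi> U x =
     measure_of UNIV (sets borel)
       (\<lambda>A. ennreal \<alpha> * emeasure \<pi> A + ennreal (1 - \<alpha>) * emeasure (U x) A)"

text \<open>The law, on \<open>\<Pi>\<^sub>M n\<in>UNIV. borel\<close>, of the coordinate process of the chain with initial
  law \<open>\<mu>\<close> and transition kernel \<open>K\<close>, obtained from the Ionescu-Tulcea theorem.\<close>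

definition chain_step ::
    "'a measure \<Rightarrow> ('a \<Rightarrow> 'a measure) \<Rightarrow> nat \<Rightarrow> (nat \<Rightarrow> 'a) \<Rightarrow> 'a measure" where
  "chain_step \<mu> K n \<omega> = (case n of 0 \<Rightarrow> \<mu> | Suc m \<Rightarrow> K (\<omega> m))"

definition chain_law ::
    "'a::topological_space measure \<Rightarrow> ('a \<Rightarrow> 'a measure) \<Rightarrow> (nat \<Rightarrow> 'a) measure" where
  "chain_law \<mu> K =
     projective_family.lim UNIV (Ionescu_Tulcea.CI (chain_step \<mu> K) (\<lambda>_. borel)) (\<lambda>_. borel)"

definition additive_functional :: "('a \<Rightarrow> real) \<Rightarrow> nat \<Rightarrow> (nat \<Rightarrow> 'a) \<Rightarrow> real" where
  "additive_functional \<xi> n \<omega> = (\<Sum>k\<le>n. \<xi> (\<omega> k))"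


section \<open>Laplace transforms and multiplicative ergodicity\<close>

definition laplace_Y ::
    "'a::topological_space measure \<Rightarrow> ('a \<Rightarrow> 'a measure) \<Rightarrow> ('a \<Rightarrow> real) \<Rightarrow> nat \<Rightarrow> real \<Rightarrow> real" where
  "laplace_Y \<mu> K \<xi> n \<gamma> = (\<integral>\<omega>. exp (- \<gamma> * additive_functional \<xi> n \<omega>) \<partial>chain_law \<mu> K)"

text \<open>Only used for \<open>z \<ge> 0\<close>, where all the terms of the series are nonnegative.\<close>

definition gen_Y ::
    "'a::topological_space measure \<Rightarrow> ('a \<Rightarrow> 'a measure) \<Rightarrow> ('a \<Rightarrow> real) \<Rightarrow> real \<Rightarrow> real \<Rightarrow> ennreal" where
  "gen_Y \<mu> K \<xi> \<gamma> z = (\<Sum>n. ennreal (z ^ n * laplace_Y \<mu> K \<xi> n \<gamma>))"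

text \<open>Extended-real valued, so that the infimum of the empty set is \<open>\<infinity>\<close>.\<close>

definition nu_Y ::
    "'a::topological_space measure \<Rightarrow> ('a \<Rightarrow> 'a measure) \<Rightarrow> ('a \<Rightarrow> real) \<Rightarrow> ereal" where
  "nu_Y \<mu> K \<xi> = Inf (ereal ` {\<gamma>. 0 < \<gamma> \<and> gen_Y \<mu> K \<xi> \<gamma> 2 < \<infinity>})"

text \<open>Being multiplicatively ergodic on \<open>J\<close> includes that \<open>J\<close> is one of the intervals
  \<open>[0, \<gamma>\<^sub>1)\<close>, \<open>(0, \<gamma>\<^sub>1)\<close> with \<open>0 < \<gamma>\<^sub>1 \<le> \<infinity>\<close>.\<close>

definition multiplicatively_ergodic :: "(nat \<Rightarrow> real \<Rightarrow> real) \<Rightarrow> real set \<Rightarrow> bool" where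
  "multiplicatively_ergodic L J \<longleftrightarrow>
     (\<exists>\<gamma>\<^sub>1::ereal. 0 < \<gamma>\<^sub>1 \<and>
        (J = {\<gamma>. 0 \<le> \<gamma> \<and> ereal \<gamma> < \<gamma>\<^sub>1} \<or> J = {\<gamma>. 0 < \<gamma> \<and> ereal \<gamma> < \<gamma>\<^sub>1}) \<and>
        (\<exists>A \<rho> :: real \<Rightarrow> real.
           continuous_on J A \<and> continuous_on J \<rho> \<and> (\<forall>\<gamma>\<in>J. 0 < A \<gamma> \<and> 0 < \<rho> \<gamma>) \<and>
           (\<forall>K. compact K \<and> K \<subseteq> {\<gamma>. 0 < \<gamma> \<and> ereal \<gamma> < \<gamma>\<^sub>1} \<longrightarrow>
              (\<exists>M \<theta> :: real. 0 < M \<and> 0 < \<theta> \<and> \<theta> < 1 \<and>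
                 (\<forall>\<gamma>\<in>K. \<forall>n\<ge>1. \<bar>L n \<gamma> - A \<gamma> * \<rho> \<gamma> ^ n\<bar> \<le> M * (\<rho> \<gamma> * \<theta>) ^ n)))))"


section \<open>Bounded operators on Lp spaces and their spectral radius\<close>

text \<open>Elements of \<open>L\<^sup>p\<close> are represented by functions; equality in \<open>L\<^sup>p\<close> is equality almost
  everywhere.\<close>

definition Lp_functions ::
    "real \<Rightarrow> 'a measure \<Rightarrow> ('a \<Rightarrow> 'b::real_normed_vector) set" where
  "Lp_functions p M = {f \<in> borel_measurable M. integrable M (\<lambda>x. norm (f x) powr p)}"

definition Lp_norm :: "real \<Rightarrow> 'a measure \<Rightarrow> ('a \<Rightarrow> 'b::real_normed_vector) \<Rightarrow> real" where
  "Lp_norm p M f = (\<integral>x. norm (f x) powr p \<partial>M) powr (1 / p)"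

text \<open>\<open>T\<close> induces a bounded linear operator of the complex Banach space \<open>L\<^sup>p(M)\<close>.\<close>

definition Lp_bounded_operator ::
    "real \<Rightarrow> 'a measure \<Rightarrow> (('a \<Rightarrow> complex) \<Rightarrow> ('a \<Rightarrow> complex)) \<Rightarrow> bool" where
  "Lp_bounded_operator p M T \<longleftrightarrow>
     (\<forall>f\<in>Lp_functions p M. T f \<in> Lp_functions p M) \<and>
     (\<forall>f\<in>Lp_functions p M. \<forall>g\<in>Lp_functions p M.
        (AE x in M. f x = g x) \<longrightarrow> (AE x in M. T f x = T g x)) \<and>
     (\<forall>f\<in>Lp_functions p M. \<forall>g\<in>Lp_functions p M.
        AE x in M. T (\<lambda>y. f y + g y) x = T f x + T g x) \<and>
     (\<forall>c. \<forall>f\<in>Lp_functions p M. AE x in M. T (\<lambda>y. c * f y) x = c * T f x) \<and>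
     (\<exists>C. \<forall>f\<in>Lp_functions p M. Lp_norm p M (T f) \<le> C * Lp_norm p M f)"

text \<open>\<open>z\<close> belongs to the spectrum iff \<open>z I - T\<close> has no inverse among the bounded operators
  of \<open>L\<^sup>p(M)\<close>.\<close>

definition Lp_spectrum ::
    "real \<Rightarrow> 'a measure \<Rightarrow> (('a \<Rightarrow> complex) \<Rightarrow> ('a \<Rightarrow> complex)) \<Rightarrow> complex set" where
  "Lp_spectrum p M T =
     {z. \<not> (\<exists>R. Lp_bounded_operator p M R \<and>
              (\<forall>f\<in>Lp_functions p M.
                 (AE x in M. R (\<lambda>y. z * f y - T f y) x = f x) \<and>
                 (AE x in M. z * R f x - T (R f) x = f x)))}"

definition Lp_spectral_radius ::
    "real \<Rightarrow> 'a measure \<Rightarrow> (('a \<Rightarrow> complex) \<Rightarrow> ('a \<Rightarrow> complex)) \<Rightarrow> ennreal" where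
  "Lp_spectral_radius p M T = (SUP z\<in>Lp_spectrum p M T. ennreal (cmod z))"

text \<open>The operator \<open>P\<^sub>\<gamma>\<close>. For \<open>f \<in> L\<^sup>p(\<pi>)\<close>, with \<open>\<pi>\<close> invariant under \<open>K\<close>, the integral exists
  for \<open>\<pi>\<close>-almost every \<open>x\<close>.\<close>

definition laplace_operator ::
    "('a \<Rightarrow> 'a measure) \<Rightarrow> ('a \<Rightarrow> real) \<Rightarrow> real \<Rightarrow> ('a \<Rightarrow> complex) \<Rightarrow> ('a \<Rightarrow> complex)" where
  "laplace_operator K \<xi> \<gamma> f x = (\<integral>y. f y * complex_of_real (exp (- \<gamma> * \<xi> y)) \<partial>K x)"

text \<open>\<open>\<mu>\<close> is a probability measure, absolutely continuous with respect to \<open>M\<close>, with density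
  in \<open>L\<^sup>p(M)\<close>.\<close>

definition prob_with_Lp_density :: "real \<Rightarrow> 'a measure \<Rightarrow> 'a measure \<Rightarrow> bool" where
  "prob_with_Lp_density p M \<mu> \<longleftrightarrow>
     prob_space \<mu> \<and>
     (\<exists>h::'a \<Rightarrow> real. h \<in> Lp_functions p M \<and> (\<forall>x. 0 \<le> h x) \<and>
        \<mu> = density M (\<lambda>x. ennreal (h x)))"


section \<open>Well-definedness of the chain\<close>

lemma sets_mixture_kernel [simp]: "sets (mixture_kernel \<alpha> \<pi> U x) = sets borel"
  unfolding mixture_kernel_def
  by (metis sets.sigma_sets_eq sets_measure_of sets.space_closed space_borel)

lemma space_mixture_kernel [simp]: "space (mixture_kernel \<alpha> \<pi> U x) = UNIV"
  by (metis sets_eq_imp_space_eq sets_mixture_kernel space_borel)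

lemma emeasure_mixture_kernel:
  assumes "sets \<pi> = sets borel" "sets (U x) = sets borel" "A \<in> sets borel"
  shows "emeasure (mixture_kernel \<alpha> \<pi> U x) A =
           ennreal \<alpha> * emeasure \<pi> A + ennreal (1 - \<alpha>) * emeasure (U x) A"
proof (rule emeasure_measure_of[where \<Omega> = UNIV and A = "sets borel"])
  show "countably_additive (sets (mixture_kernel \<alpha> \<pi> U x))
          (\<lambda>A. ennreal \<alpha> * emeasure \<pi> A + ennreal (1 - \<alpha>) * emeasure (U x) A)"
    unfolding countably_additive_def
    using assms(1,2)
    by (auto simp: suminf_add[symmetric] suminf_emeasure intro!: summableI)
qed (use assms in \<open>auto simp: mixture_kernel_def positive_def\<close>)

lemma mixture_kernel_measurable:
  assumes "prob_space \<pi>" "sets \<pi> = sets borel" "0 \<le> \<alpha>" "\<alpha> \<le> 1"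
    and U: "U \<in> borel \<rightarrow>\<^sub>M prob_algebra borel"
  shows "mixture_kernel \<alpha> \<pi> U \<in> borel \<rightarrow>\<^sub>M prob_algebra borel"
proof -
  have sets_U: "sets (U x) = sets borel" and prob_U: "prob_space (U x)" for x
    using measurable_space[OF U, of x] by (auto simp: space_prob_algebra)
  have prob: "prob_space (mixture_kernel \<alpha> \<pi> U x)" for x
  proof
    have "emeasure \<pi> UNIV = 1" "emeasure (U x) UNIV = 1"
      using prob_space.emeasure_space_1[OF assms(1)] prob_space.emeasure_space_1[OF prob_U]
        sets_eq_imp_space_eq[OF assms(2)] sets_eq_imp_space_eq[OF sets_U] by auto
    then show "emeasure (mixture_kernel \<alpha> \<pi> U x) (space (mixture_kernel \<alpha> \<pi> U x)) = 1"
      using assms(3,4)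
      by (simp add: emeasure_mixture_kernel[OF assms(2) sets_U] flip: ennreal_plus)
  qed
  have [measurable]: "U \<in> borel \<rightarrow>\<^sub>M subprob_algebra borel"
    using U by (rule measurable_prob_algebraD)
  show ?thesis
  proof (intro measurable_prob_algebraI measurable_subprob_algebra prob)
    show "subprob_space (mixture_kernel \<alpha> \<pi> U x)" for x
      using prob by (rule prob_space_imp_subprob_space)
    show "(\<lambda>x. emeasure (mixture_kernel \<alpha> \<pi> U x) A) \<in> borel_measurable borel"
      if [measurable]: "A \<in> sets borel" for A
      by (subst emeasure_mixture_kernel[OF assms(2) sets_U that]) measurable
  qed simp
qed

lemma Ionescu_Tulcea_chain_step:
  assumes "prob_space \<mu>" "sets \<mu> = sets borel" and K: "K \<in> borel \<rightarrow>\<^sub>M prob_algebra borel"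
  shows "Ionescu_Tulcea (chain_step \<mu> K) (\<lambda>_. borel)"
proof (rule Ionescu_Tulcea.intro)
  have \<mu>: "\<mu> \<in> space (prob_algebra borel)"
    using assms(1,2) by (simp add: space_prob_algebra)
  have "chain_step \<mu> K i \<in> Pi\<^sub>M {0..<i} (\<lambda>_. borel) \<rightarrow>\<^sub>M prob_algebra borel" for i
  proof (cases i)
    case 0
    then show ?thesis using \<mu> by (simp add: chain_step_def[abs_def])
  next
    case (Suc m)
    have "(\<lambda>\<omega>. \<omega> m) \<in> Pi\<^sub>M {0..<i} (\<lambda>_. borel) \<rightarrow>\<^sub>M borel"
      using Suc by (intro measurable_component_singleton) auto
    from measurable_compose[OF this K] Suc show ?thesis
      by (simp add: chain_step_def[abs_def])
  qed
  note * = this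
  show "chain_step \<mu> K i \<in> Pi\<^sub>M {0..<i} (\<lambda>_. borel) \<rightarrow>\<^sub>M subprob_algebra borel" for i
    using * by (rule measurable_prob_algebraD)
  show "prob_space (chain_step \<mu> K i x)" if "x \<in> space (Pi\<^sub>M {0..<i} (\<lambda>_. borel))" for i x
    using measurable_space[OF * that] by (simp add: space_prob_algebra)
qed

end

theory Submission
  imports Defs "HOL-Complex_Analysis.Complex_Analysis"
begin

text \<open>
  The kernel \<open>P = \<alpha> \<pi> + (1 - \<alpha>) U\<close> moves with \<open>U\<close> until, independently of the past, a coin of bias
  \<open>\<alpha>\<close> comes up; then it restarts from \<open>\<pi>\<close>. Decomposing at the first restart
  (\<open>laplace_Y_renewal\<close>) gives, for \<open>h\<^sub>n = E\<^sub>\<mu> [exp (- \<gamma> S\<^sub>n)]\<close> and \<open>a\<^sub>n = E\<^sub>\<pi> [exp (- \<gamma> S\<^sub>n)]\<close> under the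
  chain with kernel \<open>U\<close>,

  \<open>L\<^sub>n = (1 - \<alpha>)\<^sup>n h\<^sub>n + \<Sum>k<n. \<alpha> (1 - \<alpha>)\<^sup>k h\<^sub>k l\<^sub>n\<^sub>-\<^sub>1\<^sub>-\<^sub>k\<close>,

  where \<open>L\<close> and \<open>l\<close> belong to the chain \<open>P\<close> started from \<open>\<mu>\<close> and from \<open>\<pi>\<close>. All three parts are read
  off from this scalar renewal equation, whose coefficients lie in \<open>[0, 1]\<close> and are continuous,
  decreasing and convex in \<open>\<gamma>\<close>.

  For part (1), the set \<open>J\<^sub>0\<close> is identified with \<open>{\<gamma> > 0. \<alpha> / (1 - \<alpha>) * (\<Sum>n. a\<^sub>n) > 1}\<close>
  (\<open>spectral_radius_gt_iff\<close>), which is an open interval starting at \<open>0\<close>. If the sum is large, the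
  equation \<open>\<alpha> / (1 - \<alpha>) * (\<Sum>n. a\<^sub>n x\<^sup>n\<^sup>+\<^sup>1) = 1\<close> has a root \<open>x < 1\<close> and \<open>\<rho> = (1 - \<alpha>) / x\<close> is an
  eigenvalue with a bounded positive eigenfunction. If it is not, the iterates of \<open>P\<^sub>\<gamma>\<close> grow no
  faster than \<open>q\<^sup>n\<close> for every \<open>q > 1 - \<alpha>\<close>, both on bounded functions and on \<open>L\<^sup>1(\<pi>)\<close>, hence on
  \<open>L\<^sup>p(\<pi>)\<close>, and the Neumann series excludes spectrum outside the disc of radius \<open>1 - \<alpha>\<close>
  (\<open>Lp_spectrum_bound\<close>). On \<open>J\<^sub>0\<close> the weights \<open>\<alpha> / (1 - \<alpha>) * a\<^sub>n x\<^sup>n\<^sup>+\<^sup>1\<close> form a probability distribution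
  with an exponential tail, and \<open>renewal_theorem_uniform\<close> gives \<open>L\<^sub>n \<sim> A \<rho>\<^sup>n\<close> with an exponentially small
  relative error, locally uniformly in \<open>\<gamma>\<close>.

  For parts (2) and (3), with \<open>\<phi> \<gamma> = 2 \<alpha> (\<Sum>n. (2 (1 - \<alpha>))\<^sup>n a\<^sub>n)\<close> and \<open>H \<gamma> = (\<Sum>n. (2 (1 - \<alpha>))\<^sup>n h\<^sub>n)\<close>, the
  equation gives \<open>g\<^sub>Y(\<gamma>, 2) = H \<gamma> / (1 - \<phi> \<gamma>)\<close>, finite exactly when \<open>\<phi> \<gamma> < 1\<close> (\<open>gen_Y_at_2\<close>). The
  hypothesis of (2) says that \<open>\<phi>\<close> has a limit below \<open>1\<close> at infinity, whereas \<open>\<phi> 0 > 1\<close>. Hence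
  \<open>0 < \<nu> < \<infinity>\<close> and \<open>\<phi> \<nu> = 1\<close>, and the limit in (3) is that of a reciprocal slope of the convex
  function \<open>\<phi>\<close> (\<open>gen_Y_pole\<close>).
\<close>


section \<open>Path integrals of Markov chains\<close>

text \<open>
  Multiplication by the weight \<open>w\<close> followed by the kernel. With \<open>w = exp (- \<gamma> * \<xi>)\<close> this is the
  operator \<open>P\<^sub>\<gamma>\<close>; taking values in \<open>ennreal\<close> makes it total, linear and monotone on nonnegative
  functions, so that no integrability has to be tracked through its iterates.
\<close>

definition feynman_kac ::
    "('a \<Rightarrow> 'a measure) \<Rightarrow> ('a \<Rightarrow> ennreal) \<Rightarrow> ('a \<Rightarrow> ennreal) \<Rightarrow> 'a \<Rightarrow> ennreal" where
  "feynman_kac K w f x = (\<integral>\<^sup>+y. w y * f y \<partial>K x)"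

lemma feynman_kac_measurable:
  assumes "K \<in> borel \<rightarrow>\<^sub>M prob_algebra borel"
    and [measurable]: "w \<in> borel_measurable borel" "f \<in> borel_measurable borel"
  shows "feynman_kac K w f \<in> borel_measurable borel"
proof -
  have [measurable]: "K \<in> borel \<rightarrow>\<^sub>M subprob_algebra borel"
    using assms(1) by (rule measurable_prob_algebraD)
  show ?thesis unfolding feynman_kac_def[abs_def] by measurable
qed

lemma feynman_kac_power_measurable:
  assumes "K \<in> borel \<rightarrow>\<^sub>M prob_algebra borel"
    and "w \<in> borel_measurable borel" "f \<in> borel_measurable borel"
  shows "(feynman_kac K w ^^ n) f \<in> borel_measurable borel"
  by (induction n) (use assms in \<open>auto intro: feynman_kac_measurable\<close>)

lemma kernel_prob_space:
  assumes "K \<in> borel \<rightarrow>\<^sub>M prob_algebra borel"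
  shows "prob_space (K x)" "sets (K x) = sets borel"
  using measurable_space[OF assms, of x] by (auto simp: space_prob_algebra)


context
  fixes \<mu> :: "'a::topological_space measure" and K :: "'a \<Rightarrow> 'a measure"
  assumes \<mu>: "prob_space \<mu>" "sets \<mu> = sets borel"
    and K: "K \<in> borel \<rightarrow>\<^sub>M prob_algebra borel"
begin

interpretation IT: Ionescu_Tulcea "chain_step \<mu> K" "\<lambda>_. borel"
  using \<mu> K by (rule Ionescu_Tulcea_chain_step)

lemma sets_chain_law: "sets (chain_law \<mu> K) = sets (Pi\<^sub>M UNIV (\<lambda>_. borel))"
  unfolding chain_law_def by (rule IT.PF.sets_lim)

lemma prob_space_chain_law: "prob_space (chain_law \<mu> K)"
proof -
  have "distr (chain_law \<mu> K) (PiM {} (\<lambda>_. borel)) (\<lambda>x. restrict x {}) = IT.CI {}"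
    unfolding chain_law_def by (rule IT.distr_lim) simp
  then show ?thesis
    using IT.PF.prob_space_P[of "{}"]
    by (intro prob_space_distrD[of "\<lambda>x. restrict x {}" "chain_law \<mu> K" "PiM {} (\<lambda>_. borel)"])
       (auto simp: measurable_cong_sets[OF sets_chain_law refl]
             intro!: measurable_restrict measurable_component_singleton)
qed

text \<open>
  The law of the first \<open>n\<close> coordinates under the projective limit is the \<open>n\<close>-step measure of the
  Ionescu-Tulcea construction, which is defined by recursion.
\<close>

lemma nn_integral_chain_law_restrict:
  assumes f: "f \<in> borel_measurable (Pi\<^sub>M {0..<n} (\<lambda>_. borel))"
  shows "(\<integral>\<^sup>+\<omega>. f (restrict \<omega> {0..<n}) \<partial>chain_law \<mu> K) = (\<integral>\<^sup>+\<omega>. f \<omega> \<partial>IT.C 0 n (\<lambda>_. undefined))"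
proof -
  have up: "IT.up_to {0..<n} = n"
  proof (unfold IT.up_to_def, rule Least_equality)
    show "n \<le> y" if "\<forall>i\<ge>y. i \<notin> {0..<n}" for y
      using that[rule_format, of y] by simp
  qed simp
  have s: "(\<lambda>_. undefined) \<in> space (Pi\<^sub>M {0..<0} (\<lambda>_. borel::'a measure))"
    by (simp add: space_PiM PiE_def extensional_def)
  have m1: "(\<lambda>\<omega>. restrict \<omega> {0..<n}) \<in> measurable (chain_law \<mu> K) (Pi\<^sub>M {0..<n} (\<lambda>_. borel))"
    by (subst measurable_cong_sets[OF sets_chain_law refl])
       (auto intro!: measurable_restrict measurable_component_singleton)
  have m2: "(\<lambda>\<omega>. restrict \<omega> {0..<n}) \<in> measurable (IT.C 0 n (\<lambda>_. undefined)) (Pi\<^sub>M {0..<n} (\<lambda>_. borel))"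
    by (subst measurable_cong_sets[OF IT.sets_C[OF s] refl])
       (auto intro!: measurable_restrict measurable_component_singleton)
  have "(\<integral>\<^sup>+\<omega>. f (restrict \<omega> {0..<n}) \<partial>chain_law \<mu> K)
      = (\<integral>\<^sup>+\<omega>. f \<omega> \<partial>distr (chain_law \<mu> K) (Pi\<^sub>M {0..<n} (\<lambda>_. borel)) (\<lambda>\<omega>. restrict \<omega> {0..<n}))"
    by (rule nn_integral_distr[OF m1, symmetric]) (use f in simp)
  also have "\<dots> = (\<integral>\<^sup>+\<omega>. f \<omega> \<partial>IT.CI {0..<n})"
    unfolding chain_law_def by (subst IT.distr_lim) auto
  also have "\<dots> = (\<integral>\<^sup>+\<omega>. f (restrict \<omega> {0..<n}) \<partial>IT.C 0 n (\<lambda>_. undefined))"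
    unfolding IT.CI_def up by (rule nn_integral_distr[OF m2]) (use f in simp)
  also have "\<dots> = (\<integral>\<^sup>+\<omega>. f \<omega> \<partial>IT.C 0 n (\<lambda>_. undefined))"
    by (intro nn_integral_cong arg_cong[where f=f])
       (use IT.space_C[OF s] in \<open>auto simp: space_PiM PiE_def extensional_def restrict_def\<close>)
  finally show ?thesis .
qed

text \<open>
  Integrating out the last coordinate replaces \<open>f\<close> by \<open>feynman_kac K w f\<close> and shortens the path
  by one step.
\<close>

lemma nn_integral_C_prod:
  assumes w [measurable]: "w \<in> borel_measurable borel"
    and f [measurable]: "f \<in> borel_measurable borel"
  shows "(\<integral>\<^sup>+\<omega>. (\<Prod>k\<le>n. w (\<omega> k)) * f (\<omega> n) \<partial>IT.C 0 (Suc n) (\<lambda>_. undefined))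
       = (\<integral>\<^sup>+x. w x * (feynman_kac K w ^^ n) f x \<partial>\<mu>)"
  using f
proof (induction n arbitrary: f)
  case 0
  note [measurable] = 0
  have s: "(\<lambda>_. undefined) \<in> space (Pi\<^sub>M {0..<0} (\<lambda>_. borel::'a measure))"
    by (simp add: space_PiM PiE_def extensional_def)
  have C: "IT.C 0 (Suc 0) (\<lambda>_. undefined) = IT.eP 0 (\<lambda>_. undefined)"
    using bind_return[OF IT.measurable_eP s] by simp
  have m: "(\<lambda>\<omega>. w (\<omega> 0) * f (\<omega> 0)) \<in> borel_measurable (Pi\<^sub>M {0..<Suc 0} (\<lambda>_. borel))"
    by (intro borel_measurable_times_ennreal measurable_compose[OF _ w] measurable_compose[OF _ 0]
          measurable_component_singleton) auto
  have "(\<integral>\<^sup>+\<omega>. w (\<omega> 0) * f (\<omega> 0) \<partial>IT.C 0 (Suc 0) (\<lambda>_. undefined)) = (\<integral>\<^sup>+x. w x * f x \<partial>\<mu>)"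
    unfolding C IT.nn_integral_eP[OF s m] by (simp add: chain_step_def)
  then show ?case by simp
next
  case (Suc n)
  note [measurable] = Suc.prems
  define g where "g = feynman_kac K w f"
  have [measurable]: "g \<in> borel_measurable borel"
    unfolding g_def by (rule feynman_kac_measurable[OF K]) measurable
  have s: "(\<lambda>_. undefined) \<in> space (Pi\<^sub>M {0..<0} (\<lambda>_. borel::'a measure))"
    by (simp add: space_PiM PiE_def extensional_def)
  let ?u = "\<lambda>_::nat. undefined::'a"
  have m: "(\<lambda>\<omega>. (\<Prod>k\<le>Suc n. w (\<omega> k)) * f (\<omega> (Suc n)))
      \<in> borel_measurable (Pi\<^sub>M {0..<Suc (Suc n)} (\<lambda>_. borel))"
    by (intro borel_measurable_times_ennreal borel_measurable_prod_ennreal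
          measurable_compose[OF _ w] measurable_compose[OF _ Suc.prems]
          measurable_component_singleton) auto
  have "(\<integral>\<^sup>+\<omega>. (\<Prod>k\<le>Suc n. w (\<omega> k)) * f (\<omega> (Suc n)) \<partial>IT.C 0 (Suc (Suc n)) ?u)
     = (\<integral>\<^sup>+\<omega>. (\<integral>\<^sup>+\<omega>'. (\<Prod>k\<le>Suc n. w (\<omega>' k)) * f (\<omega>' (Suc n)) \<partial>IT.eP (Suc n) \<omega>)
            \<partial>IT.C 0 (Suc n) ?u)"
    unfolding IT.C.simps(2)[of 0 "Suc n"] add_0
    by (rule nn_integral_bind[where B="Pi\<^sub>M {0..<Suc (Suc n)} (\<lambda>_. borel)"])
       (use m in \<open>auto simp: measurable_cong_sets[OF IT.sets_C[OF s] refl]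
          simp del: IT.C.simps intro!: IT.measurable_eP\<close>)
  also have "\<dots> = (\<integral>\<^sup>+\<omega>. (\<Prod>k\<le>n. w (\<omega> k)) * g (\<omega> n) \<partial>IT.C 0 (Suc n) ?u)"
  proof (rule nn_integral_cong)
    fix \<omega> assume "\<omega> \<in> space (IT.C 0 (Suc n) ?u)"
    then have \<omega>: "\<omega> \<in> space (Pi\<^sub>M {0..<Suc n} (\<lambda>_. borel))"
      using IT.space_C[OF s, of "Suc n"] by simp
    have "(\<integral>\<^sup>+\<omega>'. (\<Prod>k\<le>Suc n. w (\<omega>' k)) * f (\<omega>' (Suc n)) \<partial>IT.eP (Suc n) \<omega>)
        = (\<integral>\<^sup>+x. (\<Prod>k\<le>n. w (\<omega> k)) * (w x * f x) \<partial>K (\<omega> n))"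
      by (subst IT.nn_integral_eP[OF \<omega> m])
         (auto simp: chain_step_def mult_ac intro!: nn_integral_cong prod.cong)
    also have "\<dots> = (\<Prod>k\<le>n. w (\<omega> k)) * g (\<omega> n)"
      unfolding g_def feynman_kac_def
      by (rule nn_integral_cmult)
         (simp add: measurable_cong_sets[OF kernel_prob_space(2)[OF K] refl])
    finally show "(\<integral>\<^sup>+\<omega>'. (\<Prod>k\<le>Suc n. w (\<omega>' k)) * f (\<omega>' (Suc n)) \<partial>IT.eP (Suc n) \<omega>)
        = (\<Prod>k\<le>n. w (\<omega> k)) * g (\<omega> n)" .
  qed
  also have "\<dots> = (\<integral>\<^sup>+x. w x * (feynman_kac K w ^^ n) g x \<partial>\<mu>)"
    by (rule Suc.IH) measurable
  finally show ?case
    by (simp add: g_def funpow_Suc_right del: funpow.simps)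
qed

lemma nn_integral_chain_law_prod:
  assumes w [measurable]: "w \<in> borel_measurable borel"
  shows "(\<integral>\<^sup>+\<omega>. (\<Prod>k\<le>n. w (\<omega> k)) \<partial>chain_law \<mu> K)
       = (\<integral>\<^sup>+x. w x * (feynman_kac K w ^^ n) (\<lambda>_. 1) x \<partial>\<mu>)"
proof -
  have m: "(\<lambda>\<omega>. \<Prod>k\<le>n. w (\<omega> k)) \<in> borel_measurable (Pi\<^sub>M {0..<Suc n} (\<lambda>_. borel))"
    by (intro borel_measurable_prod_ennreal measurable_compose[OF _ w]
          measurable_component_singleton) auto
  have "(\<integral>\<^sup>+\<omega>. (\<Prod>k\<le>n. w (\<omega> k)) \<partial>chain_law \<mu> K)
      = (\<integral>\<^sup>+\<omega>. (\<Prod>k\<le>n. w (restrict \<omega> {0..<Suc n} k)) \<partial>chain_law \<mu> K)"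
    by (intro nn_integral_cong prod.cong) auto
  also have "\<dots> = (\<integral>\<^sup>+\<omega>. (\<Prod>k\<le>n. w (\<omega> k)) \<partial>IT.C 0 (Suc n) (\<lambda>_. undefined))"
    by (rule nn_integral_chain_law_restrict[OF m])
  also have "\<dots> = (\<integral>\<^sup>+x. w x * (feynman_kac K w ^^ n) (\<lambda>_. 1) x \<partial>\<mu>)"
    using nn_integral_C_prod[OF w, of "\<lambda>_. 1" n] by simp
  finally show ?thesis .
qed

end


section \<open>Regeneration of the mixture chain\<close>

lemma nn_integral_kernel_measurable:
  assumes "K \<in> borel \<rightarrow>\<^sub>M prob_algebra borel" "f \<in> borel_measurable borel"
  shows "f \<in> borel_measurable (K x)"
  using assms(2) by (simp add: measurable_cong_sets[OF kernel_prob_space(2)[OF assms(1)] refl])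

lemma feynman_kac_add:
  assumes K: "K \<in> borel \<rightarrow>\<^sub>M prob_algebra borel"
    and [measurable]: "w \<in> borel_measurable borel" "f \<in> borel_measurable borel" "g \<in> borel_measurable borel"
  shows "feynman_kac K w (\<lambda>x. f x + g x) x = feynman_kac K w f x + feynman_kac K w g x"
  unfolding feynman_kac_def distrib_left
  by (intro nn_integral_add nn_integral_kernel_measurable[OF K]) measurable

lemma feynman_kac_cmult:
  assumes K: "K \<in> borel \<rightarrow>\<^sub>M prob_algebra borel"
    and [measurable]: "w \<in> borel_measurable borel" "f \<in> borel_measurable borel"
  shows "feynman_kac K w (\<lambda>x. c * f x) x = c * feynman_kac K w f x"
proof -
  have "(\<integral>\<^sup>+ y. c * (w y * f y) \<partial>K x) = c * (\<integral>\<^sup>+ y. w y * f y \<partial>K x)"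
    by (intro nn_integral_cmult nn_integral_kernel_measurable[OF K]) measurable
  then show ?thesis by (simp add: feynman_kac_def mult_ac)
qed

lemma feynman_kac_sum:
  assumes K: "K \<in> borel \<rightarrow>\<^sub>M prob_algebra borel" and w: "w \<in> borel_measurable borel"
    and f: "\<And>i. i \<in> I \<Longrightarrow> f i \<in> borel_measurable borel"
  shows "feynman_kac K w (\<lambda>x. \<Sum>i\<in>I. f i x) x = (\<Sum>i\<in>I. feynman_kac K w (f i) x)"
  unfolding feynman_kac_def sum_distrib_left
  by (intro nn_integral_sum nn_integral_kernel_measurable[OF K] borel_measurable_times_ennreal w f)

lemma feynman_kac_mono:
  assumes "\<And>x. f x \<le> g x"
  shows "feynman_kac K w f x \<le> feynman_kac K w g x"
  unfolding feynman_kac_def by (intro nn_integral_mono mult_left_mono assms) simp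

lemma feynman_kac_power_mono:
  assumes "\<And>x. f x \<le> g x"
  shows "(feynman_kac K w ^^ n) f x \<le> (feynman_kac K w ^^ n) g x"
  by (induction n arbitrary: x) (auto intro: feynman_kac_mono assms)

lemma feynman_kac_power_add:
  assumes K: "K \<in> borel \<rightarrow>\<^sub>M prob_algebra borel" and w: "w \<in> borel_measurable borel"
    and f: "f \<in> borel_measurable borel" and g: "g \<in> borel_measurable borel"
  shows "(feynman_kac K w ^^ n) (\<lambda>x. f x + g x) x = (feynman_kac K w ^^ n) f x + (feynman_kac K w ^^ n) g x"
proof (induction n arbitrary: x)
  case (Suc n)
  have "(feynman_kac K w ^^ n) (\<lambda>x. f x + g x) = (\<lambda>x. (feynman_kac K w ^^ n) f x + (feynman_kac K w ^^ n) g x)"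
    using Suc by auto
  then show ?case
    by (simp add: feynman_kac_add[OF K w feynman_kac_power_measurable[OF K w f] feynman_kac_power_measurable[OF K w g]])
qed simp

lemma feynman_kac_power_cmult:
  assumes K: "K \<in> borel \<rightarrow>\<^sub>M prob_algebra borel" and w: "w \<in> borel_measurable borel"
    and f: "f \<in> borel_measurable borel"
  shows "(feynman_kac K w ^^ n) (\<lambda>x. c * f x) x = c * (feynman_kac K w ^^ n) f x"
proof (induction n arbitrary: x)
  case (Suc n)
  have "(feynman_kac K w ^^ n) (\<lambda>x. c * f x) = (\<lambda>x. c * (feynman_kac K w ^^ n) f x)"
    using Suc by auto
  then show ?case
    by (simp add: feynman_kac_cmult[OF K w feynman_kac_power_measurable[OF K w f]])
qed simp

lemma feynman_kac_power_le_1: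
  assumes K: "K \<in> borel \<rightarrow>\<^sub>M prob_algebra borel" and w: "\<And>x. w x \<le> 1"
  shows "(feynman_kac K w ^^ n) (\<lambda>_. 1) x \<le> 1"
proof (induction n arbitrary: x)
  case (Suc n)
  have "(feynman_kac K w ^^ Suc n) (\<lambda>_. 1) x \<le> (\<integral>\<^sup>+y. 1 \<partial>K x)"
    unfolding feynman_kac_def[of K w] funpow.simps comp_def
    by (intro nn_integral_mono) (use mult_mono[OF w Suc.IH] in \<open>auto simp: feynman_kac_def[abs_def]\<close>)
  also have "\<dots> = 1"
    using prob_space.emeasure_space_1[OF kernel_prob_space(1)[OF K]] by simp
  finally show ?case .
qed simp

text \<open>
  The kernel is defined by its values on sets; this transfers the mixture identity to
  integrals by the usual approximation by simple functions.
\<close>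

lemma nn_integral_mixture_kernel:
  assumes \<pi>: "sets \<pi> = sets borel" and U: "sets (U x) = sets borel"
    and f: "f \<in> borel_measurable borel"
  shows "(\<integral>\<^sup>+y. f y \<partial>mixture_kernel \<alpha> \<pi> U x)
       = ennreal \<alpha> * (\<integral>\<^sup>+y. f y \<partial>\<pi>) + ennreal (1 - \<alpha>) * (\<integral>\<^sup>+y. f y \<partial>U x)"
proof -
  note cs = measurable_cong_sets[OF \<pi> refl] measurable_cong_sets[OF U refl]
     measurable_cong_sets[OF sets_mixture_kernel refl]
  have sp: "space \<pi> = UNIV" "space (U x) = UNIV"
    using sets_eq_imp_space_eq[OF \<pi>] sets_eq_imp_space_eq[OF U] by auto
  show ?thesis
    using f
  proof (induction rule: borel_measurable_induct)
    case (cong f g)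
    then show ?case by simp
  next
    case (set A)
    then show ?case by (simp add: \<pi> U emeasure_mixture_kernel)
  next
    case (mult u c)
    then show ?case by (simp add: nn_integral_cmult cs distrib_left mult_ac)
  next
    case (add u v)
    then show ?case by (simp add: nn_integral_add cs distrib_left add_ac)
  next
    case (seq F)
    have inc: "incseq (\<lambda>i. \<integral>\<^sup>+y. F i y \<partial>M)" for M
      using seq(3) by (auto simp: incseq_def le_fun_def intro!: nn_integral_mono)
    have *: "(\<integral>\<^sup>+y. Sup (range F) y \<partial>M) = (SUP i. \<integral>\<^sup>+y. F i y \<partial>M)"
      if "sets M = sets borel" for M
      unfolding SUP_apply
      by (rule nn_integral_monotone_convergence_SUP)
         (use seq in \<open>auto simp: measurable_cong_sets[OF that refl]\<close>)
    have inc2: "incseq (\<lambda>i. c * (\<integral>\<^sup>+y. F i y \<partial>M))" for c M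
      using inc[of M] by (auto simp: incseq_def intro!: mult_left_mono)
    show ?case
      unfolding *[OF \<pi>] *[OF U] *[OF sets_mixture_kernel] seq.IH
      by (simp add: SUP_mult_left_ennreal ennreal_SUP_add[OF inc2 inc2])
  qed
qed

text \<open>
  By \<open>nn_integral_C_prod\<close> this is the expectation of
  \<open>w (X 0) * \<dots> * w (X n) * f (X n)\<close> for the chain started from \<open>\<mu>\<close>.
\<close>

definition path_moment ::
    "'a measure \<Rightarrow> ('a \<Rightarrow> 'a measure) \<Rightarrow> ('a \<Rightarrow> ennreal) \<Rightarrow> nat \<Rightarrow> ('a \<Rightarrow> ennreal) \<Rightarrow> ennreal" where
  "path_moment \<mu> K w n f = (\<integral>\<^sup>+x. w x * (feynman_kac K w ^^ n) f x \<partial>\<mu>)"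

locale mixture_chain =
  fixes \<pi> :: "'a::topological_space measure" and U :: "'a \<Rightarrow> 'a measure" and \<alpha> :: real
  assumes prob_pi: "prob_space \<pi>" and sets_pi: "sets \<pi> = sets borel"
    and alpha: "0 < \<alpha>" "\<alpha> < 1"
    and U: "U \<in> borel \<rightarrow>\<^sub>M prob_algebra borel"
begin

abbreviation "P \<equiv> mixture_kernel \<alpha> \<pi> U"

lemma P: "P \<in> borel \<rightarrow>\<^sub>M prob_algebra borel"
  using mixture_kernel_measurable[OF prob_pi sets_pi _ _ U] alpha by simp

lemma feynman_kac_mixture:
  assumes [measurable]: "w \<in> borel_measurable borel" "f \<in> borel_measurable borel"
  shows "feynman_kac P w f x =
           ennreal \<alpha> * (\<integral>\<^sup>+y. w y * f y \<partial>\<pi>) + ennreal (1 - \<alpha>) * feynman_kac U w f x"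
  unfolding feynman_kac_def
  by (rule nn_integral_mixture_kernel[OF sets_pi kernel_prob_space(2)[OF U]]) measurable

text \<open>
  Decomposition at the first regeneration, that is the first step at which the chain draws its
  new state from \<open>\<pi>\<close> instead of moving with \<open>U\<close>: after \<open>k\<close> steps with \<open>U\<close> the future is a
  fresh copy of the chain started from \<open>\<pi>\<close>. The first summand is the event that no regeneration
  occurs up to time \<open>n\<close>.
\<close>

lemma feynman_kac_mixture_power:
  assumes w: "w \<in> borel_measurable borel" and f: "f \<in> borel_measurable borel"
  shows "(feynman_kac P w ^^ n) f x =
     ennreal (1 - \<alpha>) ^ n * (feynman_kac U w ^^ n) f x +
     (\<Sum>k<n. ennreal \<alpha> * ennreal (1 - \<alpha>) ^ k * path_moment \<pi> P w (n - 1 - k) f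
             * (feynman_kac U w ^^ k) (\<lambda>_. 1) x)"
proof (induction n arbitrary: x)
  case (Suc n)
  let ?b = "ennreal (1 - \<alpha>)" and ?F = "feynman_kac U w" and ?m = "\<lambda>n. path_moment \<pi> P w n f"
  have mU: "(?F ^^ k) g \<in> borel_measurable borel" if "g \<in> borel_measurable borel" for k g
    by (rule feynman_kac_power_measurable[OF U w that])
  have IH: "(feynman_kac P w ^^ n) f = (\<lambda>x. ?b ^ n * (?F ^^ n) f x +
     (\<Sum>k<n. ennreal \<alpha> * ?b ^ k * ?m (n - 1 - k) * (?F ^^ k) (\<lambda>_. 1) x))"
    using Suc.IH by auto
  have "?F ((feynman_kac P w ^^ n) f) x = ?b ^ n * (?F ^^ Suc n) f x +
     (\<Sum>k<n. ennreal \<alpha> * ?b ^ k * ?m (n - 1 - k) * (?F ^^ Suc k) (\<lambda>_. 1) x)"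
    unfolding IH
    using mU f
    by (subst feynman_kac_add[OF U w])
       (auto simp: feynman_kac_sum[OF U w, where f = "\<lambda>k x. ennreal \<alpha> * ?b ^ k * ?m (n - Suc k) * (?F ^^ k) (\<lambda>_. 1) x"]
          feynman_kac_cmult[OF U w])
  then have "(feynman_kac P w ^^ Suc n) f x = ennreal \<alpha> * ?m n
      + ?b * (?b ^ n * (?F ^^ Suc n) f x +
     (\<Sum>k<n. ennreal \<alpha> * ?b ^ k * ?m (n - 1 - k) * (?F ^^ Suc k) (\<lambda>_. 1) x))"
    using feynman_kac_mixture[OF w feynman_kac_power_measurable[OF P w f], of n x]
    by (simp add: path_moment_def)
  also have "\<dots> = ?b ^ Suc n * (?F ^^ Suc n) f x +
     (\<Sum>k<Suc n. ennreal \<alpha> * ?b ^ k * ?m (Suc n - 1 - k) * (?F ^^ k) (\<lambda>_. 1) x)"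
    by (subst sum.lessThan_Suc_shift)
       (simp add: distrib_left sum_distrib_left mult_ac add_ac del: funpow.simps)
  finally show ?case .
qed simp

lemma path_moment_mixture:
  assumes \<mu>: "sets \<mu> = sets borel"
    and w: "w \<in> borel_measurable borel" and f: "f \<in> borel_measurable borel"
  shows "path_moment \<mu> P w n f =
     ennreal (1 - \<alpha>) ^ n * path_moment \<mu> U w n f +
     (\<Sum>k<n. ennreal \<alpha> * ennreal (1 - \<alpha>) ^ k * path_moment \<mu> U w k (\<lambda>_. 1)
             * path_moment \<pi> P w (n - 1 - k) f)"
proof -
  let ?F = "feynman_kac U w"
  have [measurable]: "(\<lambda>x. w x * (?F ^^ k) g x) \<in> borel_measurable \<mu>" if "g \<in> borel_measurable borel" for k g
    using feynman_kac_power_measurable[OF U w that] w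
    by (simp add: measurable_cong_sets[OF \<mu> refl])
  have "path_moment \<mu> P w n f = (\<integral>\<^sup>+x. ennreal (1 - \<alpha>) ^ n * (w x * (?F ^^ n) f x) +
     (\<Sum>k<n. ennreal \<alpha> * ennreal (1 - \<alpha>) ^ k * path_moment \<pi> P w (n - 1 - k) f
             * (w x * (?F ^^ k) (\<lambda>_. 1) x)) \<partial>\<mu>)"
    unfolding path_moment_def[of \<mu> P]
    by (simp add: feynman_kac_mixture_power[OF w f] distrib_left sum_distrib_left mult_ac)
  also have "\<dots> = ennreal (1 - \<alpha>) ^ n * path_moment \<mu> U w n f +
     (\<Sum>k<n. ennreal \<alpha> * ennreal (1 - \<alpha>) ^ k * path_moment \<pi> P w (n - 1 - k) f
             * path_moment \<mu> U w k (\<lambda>_. 1))"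
    using f
    by (simp add: nn_integral_add nn_integral_sum nn_integral_cmult path_moment_def[of \<mu> U])
  finally show ?thesis by (simp add: mult_ac)
qed

end


section \<open>Laplace transforms\<close>

context
  fixes \<mu> :: "'a::topological_space measure" and K :: "'a \<Rightarrow> 'a measure" and \<xi> :: "'a \<Rightarrow> real"
  assumes \<mu>: "prob_space \<mu>" "sets \<mu> = sets borel"
    and K: "K \<in> borel \<rightarrow>\<^sub>M prob_algebra borel"
    and \<xi> [measurable]: "\<xi> \<in> borel_measurable borel"
    and \<xi>_nonneg: "\<And>x. 0 \<le> \<xi> x"
begin

interpretation chain: prob_space "chain_law \<mu> K"
  using \<mu> K by (rule prob_space_chain_law)

lemma additive_functional_measurable:
  "additive_functional \<xi> n \<in> borel_measurable (chain_law \<mu> K)"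
  unfolding additive_functional_def[abs_def] measurable_cong_sets[OF sets_chain_law[OF \<mu> K] refl]
  by (intro borel_measurable_sum measurable_compose[OF _ \<xi>] measurable_component_singleton) auto

lemma additive_functional_nonneg: "0 \<le> additive_functional \<xi> n \<omega>"
  unfolding additive_functional_def using \<xi>_nonneg by (intro sum_nonneg) auto

lemma laplace_Y_integrable:
  assumes "0 \<le> \<gamma>"
  shows "integrable (chain_law \<mu> K) (\<lambda>\<omega>. exp (- \<gamma> * additive_functional \<xi> n \<omega>))"
  by (rule chain.integrable_const_bound[where B=1])
     (use additive_functional_nonneg assms additive_functional_measurable in auto)

lemma laplace_Y_eq_path_moment:
  assumes "0 \<le> \<gamma>"
  shows "ennreal (laplace_Y \<mu> K \<xi> n \<gamma>) = path_moment \<mu> K (\<lambda>x. ennreal (exp (- \<gamma> * \<xi> x))) n (\<lambda>_. 1)"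
proof -
  have "ennreal (laplace_Y \<mu> K \<xi> n \<gamma>)
      = (\<integral>\<^sup>+\<omega>. ennreal (exp (- \<gamma> * additive_functional \<xi> n \<omega>)) \<partial>chain_law \<mu> K)"
    unfolding laplace_Y_def by (rule nn_integral_eq_integral[symmetric, OF laplace_Y_integrable[OF assms]]) simp
  also have "\<dots> = (\<integral>\<^sup>+\<omega>. (\<Prod>k\<le>n. ennreal (exp (- \<gamma> * \<xi> (\<omega> k)))) \<partial>chain_law \<mu> K)"
    by (simp add: prod_ennreal exp_sum[symmetric] additive_functional_def sum_distrib_left sum_negf)
  also have "\<dots> = path_moment \<mu> K (\<lambda>x. ennreal (exp (- \<gamma> * \<xi> x))) n (\<lambda>_. 1)"
    unfolding path_moment_def by (rule nn_integral_chain_law_prod[OF \<mu> K]) simp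
  finally show ?thesis .
qed

lemma laplace_Y_pos:
  assumes "0 \<le> \<gamma>"
  shows "0 < laplace_Y \<mu> K \<xi> n \<gamma>"
proof -
  have "0 \<le> laplace_Y \<mu> K \<xi> n \<gamma>"
    unfolding laplace_Y_def by (rule Bochner_Integration.integral_nonneg) simp
  moreover have "laplace_Y \<mu> K \<xi> n \<gamma> \<noteq> 0"
  proof
    assume "laplace_Y \<mu> K \<xi> n \<gamma> = 0"
    then have "AE \<omega> in chain_law \<mu> K. exp (- \<gamma> * additive_functional \<xi> n \<omega>) = 0"
      using integral_nonneg_eq_0_iff_AE[OF laplace_Y_integrable[OF assms, of n]]
      by (simp add: laplace_Y_def)
    then show False by simp
  qed
  ultimately show ?thesis by simp
qed

lemma laplace_Y_antimono:
  assumes "0 \<le> \<gamma>" "\<gamma> \<le> \<delta>"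
  shows "laplace_Y \<mu> K \<xi> n \<delta> \<le> laplace_Y \<mu> K \<xi> n \<gamma>"
  unfolding laplace_Y_def
  using assms additive_functional_nonneg
  by (intro integral_mono laplace_Y_integrable) (auto intro: mult_right_mono)

lemma laplace_Y_0: "laplace_Y \<mu> K \<xi> n 0 = 1"
  unfolding laplace_Y_def by (simp add: chain.prob_space)

lemma laplace_Y_le_1:
  assumes "0 \<le> \<gamma>"
  shows "laplace_Y \<mu> K \<xi> n \<gamma> \<le> 1"
  using laplace_Y_antimono[of 0 \<gamma> n] laplace_Y_0 assms by simp

lemma laplace_Y_continuous_on: "continuous_on {0..} (laplace_Y \<mu> K \<xi> n)"
  unfolding continuous_on_def
proof
  fix \<gamma> :: real assume "\<gamma> \<in> {0..}"
  show "(laplace_Y \<mu> K \<xi> n \<longlongrightarrow> laplace_Y \<mu> K \<xi> n \<gamma>) (at \<gamma> within {0..})"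
  proof (rule tendsto_at_iff_sequentially[THEN iffD2], intro allI impI)
    fix X :: "nat \<Rightarrow> real" assume X: "\<forall>i. X i \<in> {0..} - {\<gamma>}" "X \<longlonglongrightarrow> \<gamma>"
    show "(laplace_Y \<mu> K \<xi> n \<circ> X) \<longlonglongrightarrow> laplace_Y \<mu> K \<xi> n \<gamma>"
      unfolding comp_def laplace_Y_def
    proof (rule integral_dominated_convergence[where w = "\<lambda>_. 1"])
      show "AE \<omega> in chain_law \<mu> K. (\<lambda>i. exp (- X i * additive_functional \<xi> n \<omega>))
          \<longlonglongrightarrow> exp (- \<gamma> * additive_functional \<xi> n \<omega>)"
        using X(2) by (intro always_eventually allI tendsto_intros)
      show "AE \<omega> in chain_law \<mu> K. norm (exp (- X i * additive_functional \<xi> n \<omega>)) \<le> 1" for i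
        using X(1) additive_functional_nonneg by auto
    qed (use additive_functional_measurable in auto)
  qed
qed

lemma laplace_Y_convex_on: "convex_on {0..} (laplace_Y \<mu> K \<xi> n)"
proof (rule convex_onI)
  fix t x y :: real assume t: "0 < t" "t < 1" and xy: "x \<in> {0..}" "y \<in> {0..}"
  have nn: "0 \<le> (1 - t) * x + t * y" using t xy by simp
  have int: "integrable (chain_law \<mu> K) (\<lambda>\<omega>. exp (- x * additive_functional \<xi> n \<omega>))"
    "integrable (chain_law \<mu> K) (\<lambda>\<omega>. exp (- y * additive_functional \<xi> n \<omega>))"
    using xy by (simp_all only: atLeast_iff laplace_Y_integrable)
  have "laplace_Y \<mu> K \<xi> n ((1 - t) * x + t * y)
      \<le> (\<integral>\<omega>. (1 - t) * exp (- x * additive_functional \<xi> n \<omega>) + t * exp (- y * additive_functional \<xi> n \<omega>) \<partial>chain_law \<mu> K)"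
    unfolding laplace_Y_def
  proof (rule integral_mono)
    fix \<omega>
    let ?S = "additive_functional \<xi> n \<omega>"
    have "exp (- ((1 - t) * x + t * y) * ?S) = exp ((1 - t) * (- x * ?S) + t * (- y * ?S))"
      by (simp add: algebra_simps)
    also have "\<dots> \<le> (1 - t) * exp (- x * ?S) + t * exp (- y * ?S)"
      using convex_onD[OF exp_convex, of t "- x * ?S" "- y * ?S"] t by simp
    finally show "exp (- ((1 - t) * x + t * y) * ?S) \<le> (1 - t) * exp (- x * ?S) + t * exp (- y * ?S)" .
  qed (intro laplace_Y_integrable[OF nn] Bochner_Integration.integrable_add integrable_mult_right int)+
  moreover have "(\<integral>\<omega>. (1 - t) * exp (- x * additive_functional \<xi> n \<omega>) + t * exp (- y * additive_functional \<xi> n \<omega>) \<partial>chain_law \<mu> K)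
      = (1 - t) * laplace_Y \<mu> K \<xi> n x + t * laplace_Y \<mu> K \<xi> n y"
    using int by (simp add: laplace_Y_def del: mult_minus_left)
  ultimately show "laplace_Y \<mu> K \<xi> n ((1 - t) *\<^sub>R x + t *\<^sub>R y)
      \<le> (1 - t) * laplace_Y \<mu> K \<xi> n x + t * laplace_Y \<mu> K \<xi> n y" by simp
qed simp

text \<open>
  As \<open>\<gamma>\<close> tends to infinity, \<open>exp (- \<gamma> * S)\<close> decreases to the indicator of \<open>S = 0\<close>.
\<close>

lemma laplace_Y_tendsto_at_top:
  "(laplace_Y \<mu> K \<xi> n \<longlongrightarrow>
     measure (chain_law \<mu> K) {\<omega> \<in> space (chain_law \<mu> K). additive_functional \<xi> n \<omega> = 0}) at_top"
proof (rule tendsto_at_topI_sequentially)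
  fix X :: "nat \<Rightarrow> real" assume X: "filterlim X at_top sequentially"
  let ?A = "{\<omega> \<in> space (chain_law \<mu> K). additive_functional \<xi> n \<omega> = 0}"
  note [measurable] = additive_functional_measurable[of n]
  have A: "?A \<in> sets (chain_law \<mu> K)" by measurable
  define Y where "Y i = max 0 (X i)" for i
  have ev: "eventually (\<lambda>i. X i = Y i) sequentially"
    using filterlim_at_top[THEN iffD1, OF X, rule_format, of 0] by (simp add: Y_def max_def)
  then have Y: "filterlim Y at_top sequentially"
    using X by (rule filterlim_cong[OF refl refl, THEN iffD1])
  have "(\<lambda>i. laplace_Y \<mu> K \<xi> n (Y i)) \<longlonglongrightarrow> (\<integral>\<omega>. indicator ?A \<omega> \<partial>chain_law \<mu> K)"
    unfolding laplace_Y_def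
  proof (rule integral_dominated_convergence[where w = "\<lambda>_. 1"])
    show "AE \<omega> in chain_law \<mu> K. (\<lambda>i. exp (- Y i * additive_functional \<xi> n \<omega>)) \<longlonglongrightarrow> indicator ?A \<omega>"
    proof (rule AE_I2)
      fix \<omega> assume \<omega>: "\<omega> \<in> space (chain_law \<mu> K)"
      show "(\<lambda>i. exp (- Y i * additive_functional \<xi> n \<omega>)) \<longlonglongrightarrow> indicator ?A \<omega>"
      proof (cases "additive_functional \<xi> n \<omega> = 0")
        case False
        then have "0 < additive_functional \<xi> n \<omega>"
          using additive_functional_nonneg[of n \<omega>] by simp
        then have "filterlim (\<lambda>i. - (Y i * additive_functional \<xi> n \<omega>)) at_bot sequentially"
          by (intro filterlim_uminus_at_bot_at_top[THEN filterlim_compose]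
              filterlim_at_top_mult_tendsto_pos[OF tendsto_const _ Y, THEN filterlim_mono] )
             (auto)
        then have "(\<lambda>i. exp (- (Y i * additive_functional \<xi> n \<omega>))) \<longlonglongrightarrow> 0"
          by (rule filterlim_compose[OF exp_at_bot])
        then show ?thesis using False by simp
      qed (use \<omega> in simp)
    qed
    show "AE \<omega> in chain_law \<mu> K. norm (exp (- Y i * additive_functional \<xi> n \<omega>)) \<le> 1" for i
      using additive_functional_nonneg by (auto simp: Y_def)
  qed (use A in auto)
  also have "(\<integral>\<omega>. indicator ?A \<omega> \<partial>chain_law \<mu> K) = measure (chain_law \<mu> K) ?A"
    using A by simp
  finally show "(\<lambda>i. laplace_Y \<mu> K \<xi> n (X i)) \<longlonglongrightarrow> measure (chain_law \<mu> K) ?A"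
    by (rule Lim_transform_eventually) (use ev in \<open>auto elim: eventually_mono\<close>)
qed

lemma measure_additive_functional_eq_0:
  assumes "measure \<mu> {x. \<xi> x = 0} = 0"
  shows "measure (chain_law \<mu> K) {\<omega> \<in> space (chain_law \<mu> K). additive_functional \<xi> n \<omega> = 0} = 0"
proof -
  interpret \<mu>: prob_space \<mu> by (rule \<mu>)
  let ?A = "{\<omega> \<in> space (chain_law \<mu> K). additive_functional \<xi> n \<omega> = 0}"
  let ?w = "indicator {x. \<xi> x = 0} :: 'a \<Rightarrow> ennreal"
  note [measurable] = additive_functional_measurable[of n]
  have Z: "{x. \<xi> x = 0} \<in> sets borel" by measurable
  then have w: "?w \<in> borel_measurable borel" by simp
  have "emeasure (chain_law \<mu> K) ?A = (\<integral>\<^sup>+\<omega>. indicator ?A \<omega> \<partial>chain_law \<mu> K)"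
    by (rule nn_integral_indicator[symmetric]) measurable
  also have "\<dots> \<le> (\<integral>\<^sup>+\<omega>. (\<Prod>k\<le>n. ?w (\<omega> k)) \<partial>chain_law \<mu> K)"
    by (intro nn_integral_mono)
       (auto simp: additive_functional_def sum_nonneg_eq_0_iff \<xi>_nonneg split: split_indicator)
  also have "\<dots> = (\<integral>\<^sup>+x. ?w x * (feynman_kac K ?w ^^ n) (\<lambda>_. 1) x \<partial>\<mu>)"
    by (rule nn_integral_chain_law_prod[OF \<mu> K w])
  also have "\<dots> = (\<integral>\<^sup>+x. 0 \<partial>\<mu>)"
  proof (rule nn_integral_cong_AE)
    have "{x. \<xi> x = 0} \<in> null_sets \<mu>"
      using assms Z \<mu>(2) by (simp add: null_sets_def \<mu>.emeasure_eq_measure)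
    then have "AE x in \<mu>. x \<notin> {x. \<xi> x = 0}" by (rule AE_not_in)
    then show "AE x in \<mu>. ?w x * (feynman_kac K ?w ^^ n) (\<lambda>_. 1) x = 0"
      by eventually_elim simp
  qed
  finally show ?thesis by (simp add: chain.emeasure_eq_measure)
qed

end

text \<open>
  The renewal equation on which everything rests: it expresses the Laplace transforms of the
  chain \<open>P\<close> through those of the chain \<open>U\<close>.
\<close>

lemma (in mixture_chain) laplace_Y_renewal:
  assumes \<mu>: "prob_space \<mu>" "sets \<mu> = sets borel"
    and \<xi>: "\<xi> \<in> borel_measurable borel" "\<And>x. 0 \<le> \<xi> x" and \<gamma>: "0 \<le> \<gamma>"
  shows "laplace_Y \<mu> P \<xi> n \<gamma> = (1 - \<alpha>) ^ n * laplace_Y \<mu> U \<xi> n \<gamma> +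
     (\<Sum>k<n. \<alpha> * (1 - \<alpha>) ^ k * laplace_Y \<mu> U \<xi> k \<gamma> * laplace_Y \<pi> P \<xi> (n - 1 - k) \<gamma>)"
proof -
  have nn: "0 \<le> laplace_Y \<nu> K \<xi> n \<gamma>"
    if "prob_space \<nu>" "sets \<nu> = sets borel" "K \<in> borel \<rightarrow>\<^sub>M prob_algebra borel" for \<nu> K n
    using laplace_Y_pos[OF that \<xi> \<gamma>] by (rule less_imp_le)
  note nns = nn[OF \<mu> U] nn[OF \<mu> P] nn[OF prob_pi sets_pi P]
  have "ennreal (laplace_Y \<mu> P \<xi> n \<gamma>) = ennreal (1 - \<alpha>) ^ n * ennreal (laplace_Y \<mu> U \<xi> n \<gamma>) +
     (\<Sum>k<n. ennreal \<alpha> * ennreal (1 - \<alpha>) ^ k * ennreal (laplace_Y \<mu> U \<xi> k \<gamma>)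
        * ennreal (laplace_Y \<pi> P \<xi> (n - 1 - k) \<gamma>))"
    unfolding laplace_Y_eq_path_moment[OF \<mu> P \<xi> \<gamma>] laplace_Y_eq_path_moment[OF \<mu> U \<xi> \<gamma>]
      laplace_Y_eq_path_moment[OF prob_pi sets_pi P \<xi> \<gamma>]
    by (rule path_moment_mixture[OF \<mu>(2)]) (use \<xi>(1) in measurable)
  also have "\<dots> = ennreal ((1 - \<alpha>) ^ n * laplace_Y \<mu> U \<xi> n \<gamma> +
     (\<Sum>k<n. \<alpha> * (1 - \<alpha>) ^ k * laplace_Y \<mu> U \<xi> k \<gamma> * laplace_Y \<pi> P \<xi> (n - 1 - k) \<gamma>))"
    using alpha nns
    by (simp add: ennreal_mult ennreal_plus ennreal_power[symmetric] sum_nonneg sum_ennreal[symmetric]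
        del: sum_ennreal)
  finally show ?thesis
    using alpha nns by (subst (asm) ennreal_inj) (auto intro!: add_nonneg_nonneg sum_nonneg mult_nonneg_nonneg)
qed


section \<open>Neumann series on \<open>L\<^sup>p\<close>\<close>

text \<open>
  Young's inequality, read as a family of affine upper bounds for \<open>y\<close> in the variable \<open>y powr p\<close>.
  A positive linear operator can be applied to both sides, and optimizing over \<open>t\<close> afterwards
  (\<open>Young_tangent_optimize\<close>) yields Hoelder's inequality for that operator.
\<close>

lemma Young_tangent:
  fixes y t p :: real
  assumes p: "1 < p" and t: "0 < t" and y: "0 \<le> y"
  shows "y \<le> (p - 1) / p * t + t powr (1 - p) / p * y powr p"
proof (cases "y = 0")
  case False
  have "y = t powr ((p - 1) / p + (1 - p) * (1 / p)) * y powr (p * (1 / p))"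
    using p t y by (simp add: field_simps)
  also have "\<dots> = t powr ((p - 1) / p) * (t powr (1 - p) * y powr p) powr (1 / p)"
    using t y by (simp add: powr_add powr_mult powr_powr)
  also have "\<dots> \<le> (p - 1) / p * t + 1 / p * (t powr (1 - p) * y powr p)"
    using p t y False by (intro Youngs_inequality_0) (auto simp: field_simps)
  finally show ?thesis by simp
qed (use p t in simp)

lemma Young_tangent_optimize:
  fixes A B C p :: real
  assumes p: "1 < p" and A: "0 \<le> A" and B: "0 \<le> B" and C: "0 < C"
    and le: "\<And>t. 0 < t \<Longrightarrow> A \<le> (p - 1) / p * t * C + t powr (1 - p) / p * B"
  shows "A powr p \<le> C powr (p - 1) * B"
proof (cases "B = 0")
  case True
  have "A \<le> 0"
  proof (rule field_le_epsilon)
    fix e :: real assume e: "0 < e"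
    have "A \<le> (p - 1) / p * (e / C) * C"
      using le[of "e / C"] True e C by simp
    also have "\<dots> \<le> 1 * e"
      using p e C by (intro order.trans[OF _ mult_right_mono[of "(p-1)/p" 1 e]]) (auto simp: field_simps)
    finally show "A \<le> 0 + e" by simp
  qed
  then show ?thesis using A B C by simp
next
  case False
  with B have B: "0 < B" by simp
  define s where "s = (B / C) powr (1 / p)"
  have s: "0 < s" using B C by (simp add: s_def)
  have sp: "s powr p = B / C" using p B C by (simp add: s_def powr_powr)
  have "s powr (1 - p) * B = s * C"
    using s sp B C by (simp add: powr_diff field_simps)
  then have "A \<le> (p - 1) / p * s * C + s * C / p"
    using le[OF s] by (simp add: field_simps)
  also have "\<dots> = s * C" using p by (simp add: field_simps)
  finally have "A powr p \<le> (s * C) powr p"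
    using A p by (intro powr_mono2) auto
  also have "\<dots> = B / C * C powr p" using s C sp by (simp add: powr_mult)
  also have "\<dots> = C powr (p - 1) * B" using C by (simp add: powr_diff)
  finally show ?thesis .
qed

lemma norm_add_powr_le:
  fixes a b :: "'b::real_normed_vector" and p :: real
  assumes "0 \<le> p"
  shows "norm (a + b) powr p \<le> 2 powr p * (norm a powr p + norm b powr p)"
proof -
  have "norm (a + b) powr p \<le> (2 * max (norm a) (norm b)) powr p"
    using norm_triangle_ineq[of a b] assms by (intro powr_mono2) auto
  also have "\<dots> = 2 powr p * max (norm a) (norm b) powr p"
    by (simp add: powr_mult)
  also have "\<dots> \<le> 2 powr p * (norm a powr p + norm b powr p)"
    by (intro mult_left_mono) (auto simp: max_def)
  finally show ?thesis .
qed

text \<open>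
  The \<open>p\<close>-th power of the norm; estimates in this form need no roots.
\<close>

abbreviation Lp_energy :: "real \<Rightarrow> 'a measure \<Rightarrow> ('a \<Rightarrow> 'b::real_normed_vector) \<Rightarrow> real" where
  "Lp_energy p M f \<equiv> (\<integral>x. norm (f x) powr p \<partial>M)"

lemma Lp_energy_nonneg: "0 \<le> Lp_energy p M f"
  by (rule Bochner_Integration.integral_nonneg) simp

lemma Lp_norm_le_iff_energy:
  assumes p: "0 < p" and C: "0 \<le> C"
  shows "Lp_norm p M f \<le> C * Lp_norm p M g \<longleftrightarrow> Lp_energy p M f \<le> C powr p * Lp_energy p M g"
proof -
  have nn: "0 \<le> C powr p * Lp_energy p M g" using Lp_energy_nonneg by (simp add: mult_nonneg_nonneg)
  have "C * Lp_norm p M g = (C powr p * Lp_energy p M g) powr (1 / p)"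
    using p C by (simp add: Lp_norm_def powr_mult powr_powr Lp_energy_nonneg)
  then have "Lp_norm p M f \<le> C * Lp_norm p M g \<longleftrightarrow>
      (Lp_energy p M f) powr (1 / p) \<le> (C powr p * Lp_energy p M g) powr (1 / p)"
    by (simp add: Lp_norm_def)
  also have "\<dots> \<longleftrightarrow> Lp_energy p M f \<le> C powr p * Lp_energy p M g"
  proof
    assume "(Lp_energy p M f) powr (1 / p) \<le> (C powr p * Lp_energy p M g) powr (1 / p)"
    from powr_mono2[OF less_imp_le[OF p] powr_ge_zero this]
    have "((Lp_energy p M f) powr (1 / p)) powr p \<le> ((C powr p * Lp_energy p M g) powr (1 / p)) powr p" .
    moreover have "(x powr (1 / p)) powr p = x" if "0 \<le> x" for x :: real
      using p that by (simp add: powr_powr)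
    ultimately show "Lp_energy p M f \<le> C powr p * Lp_energy p M g"
      using nn Lp_energy_nonneg by metis
  qed (use p in \<open>auto simp: Lp_energy_nonneg intro!: powr_mono2\<close>)
  finally show ?thesis .
qed

lemma Lp_functions_add:
  fixes f g :: "'a \<Rightarrow> 'b::{real_normed_vector, second_countable_topology}"
  assumes p: "0 \<le> p" and f: "f \<in> Lp_functions p M" and g: "g \<in> Lp_functions p M"
  shows "(\<lambda>x. f x + g x) \<in> Lp_functions p M"
proof -
  have [measurable]: "f \<in> borel_measurable M" "g \<in> borel_measurable M"
    using f g by (auto simp: Lp_functions_def)
  have "integrable M (\<lambda>x. 2 powr p * (norm (f x) powr p + norm (g x) powr p))"
    using f g by (auto simp: Lp_functions_def)
  then have "integrable M (\<lambda>x. norm (f x + g x) powr p)"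
    by (rule Bochner_Integration.integrable_bound)
       (auto intro!: norm_add_powr_le[THEN order_trans] p)
  then show ?thesis by (simp add: Lp_functions_def)
qed

lemma Lp_functions_cmult:
  fixes f :: "'a \<Rightarrow> complex"
  assumes "f \<in> Lp_functions p M"
  shows "(\<lambda>x. c * f x) \<in> Lp_functions p M"
  using assms by (auto simp: Lp_functions_def norm_mult powr_mult)

lemma Lp_energy_cmult:
  fixes f :: "'a \<Rightarrow> complex"
  shows "Lp_energy p M (\<lambda>x. c * f x) = norm c powr p * Lp_energy p M f"
  by (simp add: norm_mult powr_mult)

lemma Lp_energy_eq_0_iff:
  assumes "f \<in> Lp_functions p M"
  shows "Lp_energy p M f = 0 \<longleftrightarrow> (AE x in M. f x = 0)"
proof -
  have "Lp_energy p M f = 0 \<longleftrightarrow> (AE x in M. norm (f x) powr p = 0)"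
    by (rule integral_nonneg_eq_0_iff_AE) (use assms in \<open>auto simp: Lp_functions_def\<close>)
  then show ?thesis by simp
qed

text \<open>
  A series whose norms are dominated by a geometric sequence converges almost everywhere and in
  \<open>L\<^sup>p\<close>. Hoelder's inequality for the sum with weights \<open>r ^ n\<close>, in the form of the two Young lemmas,
  replaces the triangle inequality for infinite sums.
\<close>

lemma Lp_geometric_series:
  fixes g :: "nat \<Rightarrow> 'a \<Rightarrow> complex"
  assumes p: "1 < p" and r: "0 < r" "r < 1"
    and g: "\<And>n. g n \<in> Lp_functions p M"
    and E: "\<And>n. Lp_energy p M (g n) \<le> (r ^ n) powr p * E"
  shows "AE x in M. summable (\<lambda>n. norm (g n x))"
    and "(\<lambda>x. \<Sum>n. g n x) \<in> Lp_functions p M"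
    and "Lp_energy p M (\<lambda>x. \<Sum>n. g n x) \<le> (1 / (1 - r)) powr p * E"
proof -
  have E0: "0 \<le> E"
    using order.trans[OF Lp_energy_nonneg E[of 0]] by simp
  have [measurable]: "g n \<in> borel_measurable M" and int: "integrable M (\<lambda>x. norm (g n x) powr p)" for n
    using g[of n] by (auto simp: Lp_functions_def)
  define h where "h n x = (r ^ n) powr (1 - p) * norm (g n x) powr p" for n x
  have [measurable]: "h n \<in> borel_measurable M" for n
    unfolding h_def by measurable
  have h_nonneg: "0 \<le> h n x" for n x by (simp add: h_def)
  have "(\<integral>\<^sup>+x. ennreal (h n x) \<partial>M) \<le> ennreal (r ^ n * E)" for n
  proof -
    have "(\<integral>\<^sup>+x. ennreal (h n x) \<partial>M) = ennreal ((r ^ n) powr (1 - p) * Lp_energy p M (g n))"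
      unfolding h_def using int[of n] by (subst nn_integral_eq_integral) auto
    also have "(r ^ n) powr (1 - p) * Lp_energy p M (g n) \<le> (r ^ n) powr (1 - p) * ((r ^ n) powr p * E)"
      by (intro mult_left_mono E) simp
    also have "\<dots> = r ^ n * E"
      using r by (simp add: powr_add[symmetric] flip: mult.assoc)
    finally show ?thesis by (simp add: ennreal_leI)
  qed
  then have "(\<Sum>n. \<integral>\<^sup>+x. ennreal (h n x) \<partial>M) \<le> (\<Sum>n. ennreal (r ^ n * E))"
    by (intro suminf_le) auto
  also have "\<dots> = ennreal (E / (1 - r))"
  proof (rule suminf_ennreal_eq)
    show "(\<lambda>n. r ^ n * E) sums (E / (1 - r))"
      using sums_mult2[OF geometric_sums[of r], of E] r by simp
  qed (use r E0 in auto)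
  finally have H: "(\<integral>\<^sup>+x. (\<Sum>n. ennreal (h n x)) \<partial>M) \<le> ennreal (E / (1 - r))"
    by (simp add: nn_integral_suminf)
  then have "AE x in M. (\<Sum>n. ennreal (h n x)) \<noteq> \<infinity>"
    by (intro nn_integral_PInf_AE) (auto simp: top_unique)
  then have sum_h: "AE x in M. summable (\<lambda>n. h n x)"
    by eventually_elim (auto intro: summable_suminf_not_top h_nonneg)
  have bound: "norm (g n x) \<le> (p - 1) / p * t * r ^ n + t powr (1 - p) / p * h n x"
    if "0 < t" for t n x
  proof -
    have "norm (g n x) / r ^ n \<le> (p - 1) / p * t + t powr (1 - p) / p * (norm (g n x) / r ^ n) powr p"
      using p that r by (intro Young_tangent) auto
    then have "norm (g n x) \<le> r ^ n * ((p - 1) / p * t + t powr (1 - p) / p * (norm (g n x) / r ^ n) powr p)"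
      using r by (simp add: field_simps)
    also have "r ^ n * (norm (g n x) / r ^ n) powr p = h n x"
      using r by (simp add: h_def powr_divide powr_diff)
    then have "r ^ n * ((p - 1) / p * t + t powr (1 - p) / p * (norm (g n x) / r ^ n) powr p)
        = (p - 1) / p * t * r ^ n + t powr (1 - p) / p * h n x"
      by (simp add: algebra_simps)
    finally show ?thesis .
  qed
  have rs: "summable (\<lambda>n. r ^ n)" "(\<Sum>n. r ^ n) = 1 / (1 - r)"
    using r suminf_geometric[of r] by (auto simp: summable_geometric)
  show summ: "AE x in M. summable (\<lambda>n. norm (g n x))"
    using sum_h
  proof eventually_elim
    case (elim x)
    have "summable (\<lambda>n. (p - 1) / p * 1 * r ^ n + 1 powr (1 - p) / p * h n x)"
      by (intro summable_add summable_mult rs elim)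
    then show ?case
      by (rule summable_comparison_test[rotated]) (use bound[of 1 _ x] in auto)
  qed
  have key: "AE x in M. norm (\<Sum>n. g n x) powr p \<le> (1 / (1 - r)) powr (p - 1) * (\<Sum>n. h n x)"
    using sum_h summ
  proof eventually_elim
    case (elim x)
    have "norm (\<Sum>n. g n x) powr p \<le> (\<Sum>n. norm (g n x)) powr p"
      using p by (intro powr_mono2 summable_norm elim) auto
    also have "\<dots> \<le> (1 / (1 - r)) powr (p - 1) * (\<Sum>n. h n x)"
    proof (rule Young_tangent_optimize[OF p])
      show "(\<Sum>n. norm (g n x)) \<le> (p - 1) / p * t * (1 / (1 - r)) + t powr (1 - p) / p * (\<Sum>n. h n x)"
        if t: "0 < t" for t
      proof -
        have "(\<Sum>n. norm (g n x)) \<le> (\<Sum>n. (p - 1) / p * t * r ^ n + t powr (1 - p) / p * h n x)"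
          by (intro suminf_le bound t elim summable_add summable_mult rs)
        also have "\<dots> = (p - 1) / p * t * (1 / (1 - r)) + t powr (1 - p) / p * (\<Sum>n. h n x)"
          using r
          by (intro sums_unique[symmetric] sums_add sums_mult summable_sums elim geometric_sums) auto
        finally show ?thesis .
      qed
    qed (use r elim h_nonneg in \<open>auto intro!: suminf_nonneg\<close>)
    finally show ?case .
  qed
  have int_h: "integrable M (\<lambda>x. \<Sum>n. h n x)" and int_h_le: "(\<integral>x. (\<Sum>n. h n x) \<partial>M) \<le> E / (1 - r)"
  proof -
    have eq: "(\<integral>\<^sup>+x. ennreal (\<Sum>n. h n x) \<partial>M) = (\<integral>\<^sup>+x. (\<Sum>n. ennreal (h n x)) \<partial>M)"
      using sum_h by (intro nn_integral_cong_AE) (auto elim!: eventually_mono simp: suminf_ennreal2 h_nonneg)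
    have nn: "AE x in M. 0 \<le> (\<Sum>n. h n x)"
      using sum_h by eventually_elim (auto intro: suminf_nonneg h_nonneg)
    show int: "integrable M (\<lambda>x. \<Sum>n. h n x)"
      by (rule integrableI_nonneg) (use H nn eq in \<open>auto simp: top.not_eq_extremum[symmetric] top_unique\<close>)
    have "ennreal (\<integral>x. (\<Sum>n. h n x) \<partial>M) \<le> ennreal (E / (1 - r))"
      using H unfolding eq[symmetric] by (subst (asm) nn_integral_eq_integral[OF int nn])
    then show "(\<integral>x. (\<Sum>n. h n x) \<partial>M) \<le> E / (1 - r)"
      using E0 r by (subst (asm) ennreal_le_iff) auto
  qed
  have int_G: "integrable M (\<lambda>x. norm (\<Sum>n. g n x) powr p)"
  proof (rule Bochner_Integration.integrable_bound[OF integrable_mult_right[OF int_h]])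
    show "AE x in M. norm (norm (\<Sum>n. g n x) powr p) \<le> norm ((1 / (1 - r)) powr (p - 1) * (\<Sum>n. h n x))"
      using key by eventually_elim (auto intro: order.trans[OF _ abs_ge_self])
  qed measurable
  then show "(\<lambda>x. \<Sum>n. g n x) \<in> Lp_functions p M"
    by (simp add: Lp_functions_def)
  have "Lp_energy p M (\<lambda>x. \<Sum>n. g n x) \<le> (\<integral>x. (1 / (1 - r)) powr (p - 1) * (\<Sum>n. h n x) \<partial>M)"
    by (rule integral_mono_AE[OF int_G integrable_mult_right[OF int_h] key])
  also have "\<dots> \<le> (1 / (1 - r)) powr (p - 1) * (E / (1 - r))"
    by (simp only: integral_mult_right_zero) (intro mult_left_mono int_h_le powr_ge_zero)
  also have "\<dots> = (1 / (1 - r)) powr p * E"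
    using r by (simp add: powr_diff)
  finally show "Lp_energy p M (\<lambda>x. \<Sum>n. g n x) \<le> (1 / (1 - r)) powr p * E" .
qed


lemma Lp_bounded_operator_power:
  assumes T: "Lp_bounded_operator p M T"
  shows "f \<in> Lp_functions p M \<Longrightarrow> (T ^^ n) f \<in> Lp_functions p M"
    and "f \<in> Lp_functions p M \<Longrightarrow> g \<in> Lp_functions p M \<Longrightarrow> AE x in M. f x = g x \<Longrightarrow>
      AE x in M. (T ^^ n) f x = (T ^^ n) g x"
    and "0 \<le> p \<Longrightarrow> f \<in> Lp_functions p M \<Longrightarrow> g \<in> Lp_functions p M \<Longrightarrow>
      AE x in M. (T ^^ n) (\<lambda>y. f y + g y) x = (T ^^ n) f x + (T ^^ n) g x"
    and "f \<in> Lp_functions p M \<Longrightarrow> AE x in M. (T ^^ n) (\<lambda>y. c * f y) x = c * (T ^^ n) f x"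
proof -
  have T1: "T f \<in> Lp_functions p M" if "f \<in> Lp_functions p M" for f
    using T that by (auto simp: Lp_bounded_operator_def)
  have T2: "AE x in M. T f x = T g x"
    if "f \<in> Lp_functions p M" "g \<in> Lp_functions p M" "AE x in M. f x = g x" for f g
    using T that by (auto simp: Lp_bounded_operator_def)
  have T3: "AE x in M. T (\<lambda>y. f y + g y) x = T f x + T g x"
    if "f \<in> Lp_functions p M" "g \<in> Lp_functions p M" for f g
    using T that by (auto simp: Lp_bounded_operator_def)
  have T4: "AE x in M. T (\<lambda>y. c * f y) x = c * T f x"
    if "f \<in> Lp_functions p M" for f c
    using T that by (auto simp: Lp_bounded_operator_def)
  show 1: "f \<in> Lp_functions p M \<Longrightarrow> (T ^^ n) f \<in> Lp_functions p M" for f n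
    by (induction n) (auto intro: T1)
  show "AE x in M. (T ^^ n) f x = (T ^^ n) g x"
    if fg: "f \<in> Lp_functions p M" "g \<in> Lp_functions p M" "AE x in M. f x = g x"
  proof (induction n)
    case (Suc n)
    have "AE x in M. T ((T ^^ n) f) x = T ((T ^^ n) g) x"
      by (intro T2 1 fg Suc)
    then show ?case by simp
  qed (use fg in simp)
  show "AE x in M. (T ^^ n) (\<lambda>y. f y + g y) x = (T ^^ n) f x + (T ^^ n) g x"
    if fg: "0 \<le> p" "f \<in> Lp_functions p M" "g \<in> Lp_functions p M"
  proof (induction n)
    case (Suc n)
    have "AE x in M. T ((T ^^ n) (\<lambda>y. f y + g y)) x = T (\<lambda>y. (T ^^ n) f y + (T ^^ n) g y) x"
      by (intro T2 1 Lp_functions_add fg Suc)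
    moreover have "AE x in M. T (\<lambda>y. (T ^^ n) f y + (T ^^ n) g y) x = T ((T ^^ n) f) x + T ((T ^^ n) g) x"
      by (intro T3 1 fg)
    ultimately show ?case by eventually_elim simp
  qed simp
  show "AE x in M. (T ^^ n) (\<lambda>y. c * f y) x = c * (T ^^ n) f x"
    if f: "f \<in> Lp_functions p M"
  proof (induction n)
    case (Suc n)
    have "AE x in M. T ((T ^^ n) (\<lambda>y. c * f y)) x = T (\<lambda>y. c * (T ^^ n) f y) x"
      by (intro T2 1 Lp_functions_cmult f Suc)
    moreover have "AE x in M. T (\<lambda>y. c * (T ^^ n) f y) x = c * T ((T ^^ n) f) x"
      by (intro T4 1 f)
    ultimately show ?case by eventually_elim simp
  qed simp
qed

text \<open>
  If \<open>T ^^ n\<close> grows at most like \<open>q ^ n\<close>, the Neumann series \<open>R f = \<Sum>n. T\<^sup>n f / z\<^sup>n\<^sup>+\<^sup>1\<close> inverts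
  \<open>z I - T\<close> whenever \<open>q < \<bar>z\<bar>\<close>. That \<open>R\<close> is a left inverse follows termwise. For the right inverse
  one needs \<open>T (R f) = R (T f)\<close>, an exchange of \<open>T\<close> with an infinite sum; instead of passing to
  the limit in partial sums, the difference of both sides is shown to be reproduced, up to the factor \<open>1 / z\<close>, by
  replacing \<open>f\<close> with \<open>T f\<close>, so that iterating drives its norm to \<open>0\<close>.
\<close>

lemma Lp_spectrum_bound:
  assumes p: "1 < p" and T: "Lp_bounded_operator p M T"
    and q: "0 < q" and D: "0 \<le> D"
    and bound: "\<And>n f. f \<in> Lp_functions p M \<Longrightarrow>
      Lp_energy p M ((T ^^ n) f) \<le> (D * q ^ n) powr p * Lp_energy p M f"
    and z: "q < cmod z"
  shows "z \<notin> Lp_spectrum p M T"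
proof -
  have z0: "z \<noteq> 0" "0 < cmod z" using z q by auto
  define r where "r = q / cmod z"
  have r: "0 < r" "r < 1" using q z z0 by (auto simp: r_def)
  define trm where "trm f n x = (1 / z) ^ Suc n * (T ^^ n) f x" for f n x
  define R where "R f x = (\<Sum>n. trm f n x)" for f x
  note Tn = Lp_bounded_operator_power[OF T]
  note T1 = Tn(1)[of _ 1, simplified] and T2 = Tn(2)[of _ _ 1, simplified]
    and T3 = Tn(3)[of _ _ 1, simplified] and T4 = Tn(4)[of _ 1, simplified]
  have p0: "0 \<le> p" using p by simp
  define E where "E f = (D / cmod z) powr p * Lp_energy p M f" for f :: "'a \<Rightarrow> complex"
  have term_Lp: "trm f n \<in> Lp_functions p M" if "f \<in> Lp_functions p M" for f n
    unfolding trm_def[abs_def] by (intro Lp_functions_cmult Tn that)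
  have term_E: "Lp_energy p M (trm f n) \<le> (r ^ n) powr p * E f" if f: "f \<in> Lp_functions p M" for f n
  proof -
    have "Lp_energy p M (trm f n) = norm ((1 / z) ^ Suc n) powr p * Lp_energy p M ((T ^^ n) f)"
      unfolding trm_def by (rule Lp_energy_cmult)
    also have "\<dots> \<le> norm ((1 / z) ^ Suc n) powr p * ((D * q ^ n) powr p * Lp_energy p M f)"
      by (intro mult_left_mono bound f) simp
    also have "\<dots> = (norm ((1 / z) ^ Suc n) * (D * q ^ n)) powr p * Lp_energy p M f"
      using D q by (simp add: powr_mult)
    also have "norm ((1 / z) ^ Suc n) * (D * q ^ n) = r ^ n * (D / cmod z)"
      by (simp add: r_def norm_mult norm_power norm_divide power_divide mult_ac)
    also have "(r ^ n * (D / cmod z)) powr p = (r ^ n) powr p * (D / cmod z) powr p"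
      using r D z0 by (intro powr_mult)
    finally show ?thesis by (simp add: E_def)
  qed
  note series = Lp_geometric_series[where g = "trm f" and E = "E f" for f, OF p r term_Lp term_E]
  have summ: "AE x in M. summable (\<lambda>n. trm f n x)" if "f \<in> Lp_functions p M" for f
    using series(1)[OF that that] by eventually_elim (rule summable_norm_cancel)
  have R_Lp: "R f \<in> Lp_functions p M" if "f \<in> Lp_functions p M" for f
    using series(2)[OF that that] by (simp add: R_def[abs_def])
  define C where "C = 1 / (1 - r) * (D / cmod z)"
  have C0: "0 \<le> C" using r D by (simp add: C_def)
  have R_E: "Lp_energy p M (R f) \<le> C powr p * Lp_energy p M f" if "f \<in> Lp_functions p M" for f
    using series(3)[OF that that] r D z0 unfolding R_def E_def C_def
    by (subst powr_mult) (auto simp: mult_ac)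
  have R2: "AE x in M. R f x = R g x"
    if fg: "f \<in> Lp_functions p M" "g \<in> Lp_functions p M" "AE x in M. f x = g x" for f g
  proof -
    have "AE x in M. \<forall>n. (T ^^ n) f x = (T ^^ n) g x"
      unfolding AE_all_countable by (intro allI Tn(2) fg)
    then show ?thesis by eventually_elim (simp add: R_def trm_def)
  qed
  have R3: "AE x in M. R (\<lambda>y. f y + g y) x = R f x + R g x"
    if fg: "f \<in> Lp_functions p M" "g \<in> Lp_functions p M" for f g
  proof -
    have "AE x in M. \<forall>n. (T ^^ n) (\<lambda>y. f y + g y) x = (T ^^ n) f x + (T ^^ n) g x"
      unfolding AE_all_countable by (intro allI Tn(3) fg p0)
    then show ?thesis
      using summ[OF fg(1)] summ[OF fg(2)]
      by eventually_elim (simp add: R_def trm_def distrib_left suminf_add)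
  qed
  have R4: "AE x in M. R (\<lambda>y. c * f y) x = c * R f x"
    if f: "f \<in> Lp_functions p M" for f c
  proof -
    have "AE x in M. \<forall>n. (T ^^ n) (\<lambda>y. c * f y) x = c * (T ^^ n) f x"
      unfolding AE_all_countable by (intro allI Tn(4) f)
    then show ?thesis
      using summ[OF f]
    proof eventually_elim
      case (elim x)
      have "R (\<lambda>y. c * f y) x = (\<Sum>n. c * trm f n x)"
        using elim(1) by (simp add: R_def trm_def mult_ac)
      then show ?case using elim(2) by (simp add: R_def suminf_mult)
    qed
  qed
  have R: "Lp_bounded_operator p M R"
    unfolding Lp_bounded_operator_def
  proof (intro conjI ballI allI impI R_Lp R2 R3 R4)
    show "\<exists>C. \<forall>f\<in>Lp_functions p M. Lp_norm p M (R f) \<le> C * Lp_norm p M f"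
      using R_E C0 p by (intro exI[of _ C] ballI) (subst Lp_norm_le_iff_energy; simp)
  qed
  \<comment> \<open>Splitting off the first term of the series\<close>
  have R_shift: "AE x in M. R f x = 1 / z * f x + 1 / z * R (T f) x" if f: "f \<in> Lp_functions p M" for f
    using summ[OF f]
  proof eventually_elim
    case (elim x)
    have 1: "trm f (Suc n) x = 1 / z * trm (T f) n x" for n
      by (simp add: trm_def funpow_Suc_right del: funpow.simps)
    then have "summable (\<lambda>n. 1 / z * trm (T f) n x)"
      using summable_Suc_iff[of "\<lambda>n. trm f n x"] elim by simp
    then have 2: "summable (\<lambda>n. trm (T f) n x)"
      using z0 by (subst (asm) summable_cmult_iff) simp
    have "R f x = trm f 0 x + (\<Sum>n. trm f (Suc n) x)"
      using suminf_split_head[OF elim] by (simp add: R_def)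
    then show ?case
      using suminf_mult[OF 2, of "1 / z"] by (simp add: 1 R_def) (simp add: trm_def)
  qed
  have left: "AE x in M. R (\<lambda>y. z * f y - T f y) x = f x" if f: "f \<in> Lp_functions p M" for f
  proof -
    have zf: "(\<lambda>y. z * f y) \<in> Lp_functions p M" and Tf: "(\<lambda>y. (-1) * T f y) \<in> Lp_functions p M"
      by (intro Lp_functions_cmult T1 f)+
    show ?thesis
      using R3[OF zf Tf] R4[OF f, of z] R4[OF T1[OF f], of "-1"] R_shift[OF f]
      by eventually_elim (use z0 in \<open>simp add: field_simps\<close>)
  qed
  \<comment> \<open>The commutator is reproduced by the shift, with a factor that contracts\<close>
  define \<Delta> where "\<Delta> f x = T (R f) x + (-1) * R (T f) x" for f x
  have \<Delta>_Lp: "\<Delta> f \<in> Lp_functions p M" if "f \<in> Lp_functions p M" for f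
    unfolding \<Delta>_def[abs_def] by (intro Lp_functions_add Lp_functions_cmult R_Lp T1 that p0)
  have \<Delta>_shift: "AE x in M. \<Delta> f x = 1 / z * \<Delta> (T f) x" if f: "f \<in> Lp_functions p M" for f
  proof -
    have f': "(\<lambda>x. 1 / z * f x) \<in> Lp_functions p M" and g': "(\<lambda>x. 1 / z * R (T f) x) \<in> Lp_functions p M"
      by (intro Lp_functions_cmult R_Lp T1 f)+
    have "AE x in M. T (R f) x = T (\<lambda>x. 1 / z * f x + 1 / z * R (T f) x) x"
      by (intro T2 R_Lp f Lp_functions_add f' g' p0 R_shift)
    then show ?thesis
      using T3[OF p0 f' g'] T4[OF f, of "1 / z"] T4[OF R_Lp[OF T1[OF f]], of "1 / z"] R_shift[OF T1[OF f]]
      by eventually_elim (simp add: \<Delta>_def algebra_simps)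
  qed
  have \<Delta>_pow: "AE x in M. \<Delta> f x = (1 / z) ^ n * \<Delta> ((T ^^ n) f) x" if f: "f \<in> Lp_functions p M" for f n
  proof (induction n)
    case (Suc n)
    then show ?case
      using \<Delta>_shift[OF Tn(1)[OF f, of n]] by eventually_elim simp
  qed simp
  obtain B where B: "0 \<le> B" "\<And>f. f \<in> Lp_functions p M \<Longrightarrow> Lp_energy p M (\<Delta> f) \<le> B * Lp_energy p M f"
  proof -
    define B where "B = 2 powr p * ((D * q) powr p * C powr p + C powr p * (D * q) powr p)"
    have "Lp_energy p M (\<Delta> f) \<le> B * Lp_energy p M f" if f: "f \<in> Lp_functions p M" for f
    proof -
      have i: "integrable M (\<lambda>x. norm (g x) powr p)" if "g \<in> Lp_functions p M" for g :: "'a \<Rightarrow> complex"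
        using that by (simp add: Lp_functions_def)
      have TE: "Lp_energy p M (T g) \<le> (D * q) powr p * Lp_energy p M g" if "g \<in> Lp_functions p M" for g
        using bound[OF that, of 1] by simp
      have "Lp_energy p M (\<Delta> f)
          \<le> (\<integral>x. 2 powr p * (norm (T (R f) x) powr p + norm (R (T f) x) powr p) \<partial>M)"
      proof (rule integral_mono)
        show "norm (\<Delta> f x) powr p \<le> 2 powr p * (norm (T (R f) x) powr p + norm (R (T f) x) powr p)" for x
          using norm_add_powr_le[OF p0, of "T (R f) x" "- R (T f) x"] by (simp add: \<Delta>_def)
      qed (intro i \<Delta>_Lp f integrable_mult_right Bochner_Integration.integrable_add R_Lp T1)+
      also have "\<dots> = 2 powr p * (Lp_energy p M (T (R f)) + Lp_energy p M (R (T f)))"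
        by (simp add: i R_Lp T1 f)
      also have "\<dots> \<le> 2 powr p * ((D * q) powr p * (C powr p * Lp_energy p M f)
          + C powr p * ((D * q) powr p * Lp_energy p M f))"
        by (intro mult_left_mono add_mono order.trans[OF TE] order.trans[OF R_E] R_Lp T1 f R_E TE) auto
      finally show ?thesis by (simp add: B_def algebra_simps)
    qed
    moreover have "0 \<le> B" by (simp add: B_def)
    ultimately show ?thesis using that by blast
  qed
  have \<Delta>_0: "AE x in M. \<Delta> f x = 0" if f: "f \<in> Lp_functions p M" for f
  proof -
    let ?K = "B * D powr p * Lp_energy p M f"
    have le: "Lp_energy p M (\<Delta> f) \<le> ?K * (r powr p) ^ n" for n
    proof -
      have "Lp_energy p M (\<Delta> f) = Lp_energy p M (\<lambda>x. (1 / z) ^ n * \<Delta> ((T ^^ n) f) x)"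
        using \<Delta>_pow[OF f, of n] \<Delta>_Lp[OF f] \<Delta>_Lp[OF Tn(1)[OF f, of n]]
        by (intro integral_cong_AE) (auto simp: Lp_functions_def elim!: eventually_mono)
      also have "\<dots> = norm ((1 / z) ^ n) powr p * Lp_energy p M (\<Delta> ((T ^^ n) f))"
        by (rule Lp_energy_cmult)
      also have "\<dots> \<le> norm ((1 / z) ^ n) powr p * (B * ((D * q ^ n) powr p * Lp_energy p M f))"
        by (intro mult_left_mono order.trans[OF B(2)] Tn f bound B) auto
      also have "\<dots> = (norm ((1 / z) ^ n) * q ^ n) powr p * ?K"
        using D q by (simp add: powr_mult)
      also have "norm ((1 / z) ^ n) * q ^ n = r ^ n"
        by (simp add: r_def norm_power norm_divide power_divide)
      also have "(r ^ n) powr p = (r powr p) ^ n"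
        using r by (simp add: powr_power powr_realpow[symmetric] powr_powr mult_ac)
      finally show ?thesis by (simp add: mult_ac)
    qed
    have "r powr p < 1" using r p powr_less_mono2[of p r 1] by simp
    then have "(\<lambda>n. ?K * (r powr p) ^ n) \<longlonglongrightarrow> ?K * 0"
      by (intro tendsto_intros LIMSEQ_power_zero) simp
    then have "Lp_energy p M (\<Delta> f) \<le> ?K * 0"
      by (rule LIMSEQ_le_const) (use le in auto)
    then have "Lp_energy p M (\<Delta> f) = 0"
      using Lp_energy_nonneg[of M "\<Delta> f" p] by simp
    then show ?thesis using Lp_energy_eq_0_iff[OF \<Delta>_Lp[OF f]] by simp
  qed
  have right: "AE x in M. z * R f x - T (R f) x = f x" if f: "f \<in> Lp_functions p M" for f
    using \<Delta>_0[OF f] R_shift[OF f]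
    by eventually_elim (use z0 in \<open>simp add: \<Delta>_def field_simps\<close>)
  show ?thesis
    unfolding Lp_spectrum_def using R left right by auto
qed


section \<open>The root of the renewal equation\<close>

context
  fixes A :: "nat \<Rightarrow> real"
  assumes A: "\<And>n. 0 \<le> A n" "\<And>n. A n \<le> 1" and A0: "0 < A 0"
begin

lemma bounded_powser_summable:
  fixes x :: real
  assumes "\<bar>x\<bar> < 1"
  shows "summable (\<lambda>n. A n * x ^ n)"
proof (rule summable_comparison_test[of _ "\<lambda>n. \<bar>x\<bar> ^ n"])
  show "\<exists>N. \<forall>n\<ge>N. norm (A n * x ^ n) \<le> \<bar>x\<bar> ^ n"
    using A by (auto simp: abs_mult power_abs mult_left_le_one_le)
qed (use assms in simp)

lemma bounded_powser_isCont:
  fixes x :: real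
  assumes "\<bar>x\<bar> < 1"
  shows "isCont (\<lambda>x. \<Sum>n. A n * x ^ n) x"
proof -
  obtain K where K: "\<bar>x\<bar> < K" "K < 1" using dense[OF assms] by auto
  show ?thesis
    by (rule isCont_powser[of A K]) (use K in \<open>auto intro: bounded_powser_summable\<close>)
qed

lemma bounded_powser_less:
  fixes x y :: real
  assumes "0 \<le> x" "x < y" "y < 1"
  shows "x * (\<Sum>n. A n * x ^ n) < y * (\<Sum>n. A n * y ^ n)"
proof -
  have s: "summable (\<lambda>n. A n * x ^ n)" "summable (\<lambda>n. A n * y ^ n)"
    using assms by (auto intro: bounded_powser_summable)
  have "(\<Sum>n. A n * x ^ n) \<le> (\<Sum>n. A n * y ^ n)"
    by (intro suminf_le mult_left_mono power_mono s A) (use assms in auto)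
  then have "x * (\<Sum>n. A n * x ^ n) \<le> x * (\<Sum>n. A n * y ^ n)"
    using assms by (intro mult_left_mono) auto
  also have "\<dots> < y * (\<Sum>n. A n * y ^ n)"
  proof (intro mult_strict_right_mono assms(2))
    have "A 0 * y ^ 0 \<le> (\<Sum>n. A n * y ^ n)"
      using sum_le_suminf[OF s(2), of "{0}"] A assms by auto
    then show "0 < (\<Sum>n. A n * y ^ n)" using A0 by simp
  qed
  finally show ?thesis .
qed

text \<open>
  The left-hand side exceeds \<open>1\<close> close to \<open>x = 1\<close> because a partial sum does, and it vanishes at
  \<open>x = 0\<close>. Formulating supercriticality through partial sums avoids a case distinction on the
  convergence of \<open>\<Sum>n. A n\<close>.
\<close>

lemma renewal_root_exists:
  assumes \<kappa>: "0 < \<kappa>" and N: "1 < \<kappa> * (\<Sum>n<N. A n)"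
  shows "\<exists>x. 0 < x \<and> x < 1 \<and> \<kappa> * (x * (\<Sum>n. A n * x ^ n)) = 1"
proof -
  let ?F = "\<lambda>x. \<kappa> * (x * (\<Sum>n. A n * x ^ n))"
  have "((\<lambda>x. \<kappa> * (x * (\<Sum>n<N. A n * x ^ n))) \<longlongrightarrow> \<kappa> * (1 * (\<Sum>n<N. A n * 1 ^ n))) (at_left 1)"
    by (intro tendsto_intros)
  then have "eventually (\<lambda>x. 1 < \<kappa> * (x * (\<Sum>n<N. A n * x ^ n))) (at_left (1::real))"
    using N by (intro order_tendstoD(1)) auto
  moreover have "eventually (\<lambda>x::real. x \<in> {0<..<1}) (at_left 1)"
    by (rule eventually_at_left_real) simp
  ultimately have "eventually (\<lambda>x. 1 < \<kappa> * (x * (\<Sum>n<N. A n * x ^ n)) \<and> x \<in> {0<..<1}) (at_left (1::real))"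
    by eventually_elim simp
  then obtain y where y: "0 < y" "y < 1" "1 < \<kappa> * (y * (\<Sum>n<N. A n * y ^ n))"
    using eventually_happens[of _ "at_left (1::real)"] by auto
  have "(\<Sum>n<N. A n * y ^ n) \<le> (\<Sum>n. A n * y ^ n)"
    using y A by (intro sum_le_suminf bounded_powser_summable) auto
  then have "\<kappa> * (y * (\<Sum>n<N. A n * y ^ n)) \<le> ?F y"
    using y \<kappa> by (intro mult_left_mono) auto
  with y have Fy: "1 \<le> ?F y" by simp
  have "\<exists>x. 0 \<le> x \<and> x \<le> y \<and> ?F x = 1"
  proof (rule IVT)
    show "\<forall>x. 0 \<le> x \<and> x \<le> y \<longrightarrow> isCont ?F x"
      using y by (auto intro!: continuous_intros bounded_powser_isCont)
  qed (use y Fy in auto)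
  then obtain x where x: "0 \<le> x" "x \<le> y" "?F x = 1" by auto
  then have "x \<noteq> 0" by auto
  with x y show ?thesis by (intro exI[of _ x]) auto
qed

end


section \<open>Iterates of the Laplace operator on \<open>L\<^sup>p\<close>\<close>

text \<open>
  Where the Bochner integral does not exist, it is \<open>0\<close> by convention, so the bound holds at every
  point.
\<close>

lemma norm_laplace_operator_power_le:
  assumes "0 \<le> \<gamma>" "\<And>x. 0 \<le> \<xi> x"
  shows "ennreal (norm ((laplace_operator K \<xi> \<gamma> ^^ n) f x))
    \<le> (feynman_kac K (\<lambda>x. ennreal (exp (- \<gamma> * \<xi> x))) ^^ n) (\<lambda>x. ennreal (norm (f x))) x"
proof (induction n arbitrary: x)
  case (Suc n)
  let ?w = "\<lambda>x. exp (- \<gamma> * \<xi> x)"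
  let ?g = "(laplace_operator K \<xi> \<gamma> ^^ n) f"
  let ?h = "\<lambda>y. ?g y * complex_of_real (?w y)"
  have "ennreal (norm (\<integral>y. ?h y \<partial>K x)) \<le> (\<integral>\<^sup>+y. ennreal (norm (?h y)) \<partial>K x)"
  proof (cases "integrable (K x) ?h")
    case True
    then show ?thesis by (rule integral_norm_bound_ennreal)
  qed (simp add: not_integrable_integral_eq)
  also have "\<dots> = (\<integral>\<^sup>+y. ennreal (?w y) * ennreal (norm (?g y)) \<partial>K x)"
    by (simp add: norm_mult ennreal_mult mult.commute)
  also have "\<dots> \<le> feynman_kac K (\<lambda>x. ennreal (?w x)) ((feynman_kac K (\<lambda>x. ennreal (?w x)) ^^ n) (\<lambda>x. ennreal (norm (f x)))) x"
    unfolding feynman_kac_def[of K "\<lambda>x. ennreal (?w x)" "(feynman_kac K (\<lambda>x. ennreal (?w x)) ^^ n) (\<lambda>x. ennreal (norm (f x)))"]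
    by (intro nn_integral_mono mult_left_mono Suc.IH) simp
  finally show ?case by (simp add: laplace_operator_def[of K \<xi> \<gamma> ?g])
qed simp

lemma laplace_operator_measurable:
  assumes K: "K \<in> borel \<rightarrow>\<^sub>M prob_algebra borel"
    and [measurable]: "\<xi> \<in> borel_measurable borel" "f \<in> borel_measurable borel"
  shows "laplace_operator K \<xi> \<gamma> f \<in> borel_measurable borel"
proof -
  have [measurable]: "K \<in> borel \<rightarrow>\<^sub>M subprob_algebra borel"
    using K by (rule measurable_prob_algebraD)
  show ?thesis
    unfolding laplace_operator_def[abs_def]
    by (rule measurable_compose[OF _ integral_measurable_subprob_algebra[where N = borel]]) measurable
qed

lemma laplace_operator_power_measurable:
  assumes "K \<in> borel \<rightarrow>\<^sub>M prob_algebra borel" "\<xi> \<in> borel_measurable borel" "f \<in> borel_measurable borel"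
  shows "(laplace_operator K \<xi> \<gamma> ^^ n) f \<in> borel_measurable borel"
  by (induction n) (use assms laplace_operator_measurable in auto)

text \<open>
  Interpolation between the sup norm and the \<open>L\<^sup>1\<close> norm: a bound by \<open>d\<close> for the iterate acting on
  the constant \<open>1\<close> and the same bound on \<open>L\<^sup>1(\<pi>)\<close> give the bound \<open>d\<close> on \<open>L\<^sup>p(\<pi>)\<close>.
\<close>

lemma Lp_energy_laplace_operator_power:
  assumes \<pi>: "prob_space \<pi>" "sets \<pi> = sets borel"
    and K: "K \<in> borel \<rightarrow>\<^sub>M prob_algebra borel"
    and \<xi>: "\<xi> \<in> borel_measurable borel" "\<And>x. 0 \<le> \<xi> x" and \<gamma>: "0 \<le> \<gamma>"
    and p: "1 < p" and d: "0 < d"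
    and sup: "\<And>x. (feynman_kac K (\<lambda>x. ennreal (exp (- \<gamma> * \<xi> x))) ^^ n) (\<lambda>_. 1) x \<le> ennreal d"
    and int: "\<And>g. g \<in> borel_measurable borel \<Longrightarrow>
      (\<integral>\<^sup>+x. (feynman_kac K (\<lambda>x. ennreal (exp (- \<gamma> * \<xi> x))) ^^ n) g x \<partial>\<pi>) \<le> ennreal d * (\<integral>\<^sup>+x. g x \<partial>\<pi>)"
    and f: "f \<in> Lp_functions p \<pi>"
  shows "(laplace_operator K \<xi> \<gamma> ^^ n) f \<in> Lp_functions p \<pi>"
    and "Lp_energy p \<pi> ((laplace_operator K \<xi> \<gamma> ^^ n) f) \<le> d powr p * Lp_energy p \<pi> f"
proof -
  let ?w = "\<lambda>x. ennreal (exp (- \<gamma> * \<xi> x))"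
  let ?F = "feynman_kac K ?w ^^ n" and ?T = "(laplace_operator K \<xi> \<gamma> ^^ n) f"
  note cs = measurable_cong_sets[OF \<pi>(2) refl]
  have w: "?w \<in> borel_measurable borel" using \<xi>(1) by measurable
  have f_meas [measurable]: "f \<in> borel_measurable borel"
    using f by (simp add: Lp_functions_def cs)
  have int_f: "integrable \<pi> (\<lambda>x. norm (f x) powr p)"
    using f by (simp add: Lp_functions_def)
  let ?fp = "\<lambda>x. ennreal (norm (f x) powr p)"
  have fp: "?fp \<in> borel_measurable borel" and fn: "(\<lambda>x. ennreal (norm (f x))) \<in> borel_measurable borel"
    by measurable
  have Fm [measurable]: "?F ?fp \<in> borel_measurable \<pi>"
    using feynman_kac_power_measurable[OF K w fp] by (simp add: cs)
  have [measurable]: "?T \<in> borel_measurable \<pi>"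
    using laplace_operator_power_measurable[OF K \<xi>(1) f_meas] by (simp add: cs)
  have B: "(\<integral>\<^sup>+x. ?F ?fp x \<partial>\<pi>) \<le> ennreal (d * Lp_energy p \<pi> f)"
    using int[OF fp] nn_integral_eq_integral[OF int_f] d
    by (simp add: ennreal_mult Lp_energy_nonneg)
  then have fin: "AE x in \<pi>. ?F ?fp x \<noteq> \<infinity>"
    by (intro nn_integral_PInf_AE Fm) (auto simp: top_unique)
  define B' where "B' x = enn2real (?F ?fp x)" for x
  have B'_nonneg: "0 \<le> B' x" for x by (simp add: B'_def)
  have [measurable]: "B' \<in> borel_measurable \<pi>" unfolding B'_def by measurable
  have key: "AE x in \<pi>. norm (?T x) powr p \<le> d powr (p - 1) * B' x"
    using fin
  proof eventually_elim
    case (elim x)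
    then have B': "?F ?fp x = ennreal (B' x)" by (simp add: B'_def less_top)
    show ?case
    proof (rule Young_tangent_optimize[OF p])
      fix t :: real assume t: "0 < t"
      define c e where "c = (p - 1) / p * t" and "e = t powr (1 - p) / p"
      have ce: "0 \<le> c" "0 \<le> e" using p t by (auto simp: c_def e_def)
      have tan: "norm (f x) \<le> c + e * norm (f x) powr p" for x
        using Young_tangent[OF p t norm_ge_zero, of "f x"] by (simp add: c_def e_def)
      have "ennreal (norm (?T x)) \<le> ?F (\<lambda>x. ennreal (norm (f x))) x"
        by (rule norm_laplace_operator_power_le[OF \<gamma> \<xi>(2)])
      also have "\<dots> \<le> ?F (\<lambda>x. ennreal c * 1 + ennreal e * ?fp x) x"
        using tan ce
        by (intro feynman_kac_power_mono)
           (simp flip: ennreal_mult ennreal_plus add: ennreal_leI del: ennreal_plus)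
      also have "\<dots> = ?F (\<lambda>x. ennreal c * 1) x + ?F (\<lambda>x. ennreal e * ?fp x) x"
        by (rule feynman_kac_power_add[OF K w]) measurable
      also have "\<dots> = ennreal c * ?F (\<lambda>_. 1) x + ennreal e * ?F ?fp x"
        by (intro arg_cong2[where f = "(+)"] feynman_kac_power_cmult[OF K w]) measurable
      also have "\<dots> \<le> ennreal c * ennreal d + ennreal e * ennreal (B' x)"
        unfolding B' by (intro add_mono mult_left_mono sup) auto
      also have "\<dots> = ennreal (c * d + e * B' x)"
        using ce d B'_nonneg by (simp add: ennreal_mult ennreal_plus)
      finally have "norm (?T x) \<le> c * d + e * B' x"
        using ce d B'_nonneg by (subst (asm) ennreal_le_iff) auto
      then show "norm (?T x) \<le> (p - 1) / p * t * d + t powr (1 - p) / p * B' x"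
        by (simp add: c_def e_def)
    qed (use d in \<open>auto simp: B'_def\<close>)
  qed
  have B'_eq: "(\<integral>\<^sup>+x. ennreal (B' x) \<partial>\<pi>) = (\<integral>\<^sup>+x. ?F ?fp x \<partial>\<pi>)"
    using fin by (intro nn_integral_cong_AE) (auto simp: B'_def less_top elim!: eventually_mono)
  have int_B': "integrable \<pi> B'"
    by (rule integrableI_nonneg) (use B B'_eq in \<open>auto simp: B'_def top.not_eq_extremum[symmetric] top_unique\<close>)
  have "ennreal (\<integral>x. B' x \<partial>\<pi>) \<le> ennreal (d * Lp_energy p \<pi> f)"
    using B unfolding B'_eq[symmetric]
    by (subst (asm) nn_integral_eq_integral[OF int_B']) (auto simp: B'_nonneg)
  then have le_B': "(\<integral>x. B' x \<partial>\<pi>) \<le> d * Lp_energy p \<pi> f"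
    using d Lp_energy_nonneg by (subst (asm) ennreal_le_iff) (auto intro: mult_nonneg_nonneg)
  have int_T: "integrable \<pi> (\<lambda>x. norm (?T x) powr p)"
  proof (rule Bochner_Integration.integrable_bound[OF integrable_mult_right[OF int_B']])
    show "AE x in \<pi>. norm (norm (?T x) powr p) \<le> norm (d powr (p - 1) * B' x)"
      using key by eventually_elim (auto intro: order.trans[OF _ abs_ge_self])
  qed measurable
  then show "?T \<in> Lp_functions p \<pi>" by (simp add: Lp_functions_def)
  have "Lp_energy p \<pi> ?T \<le> (\<integral>x. d powr (p - 1) * B' x \<partial>\<pi>)"
    by (rule integral_mono_AE[OF int_T integrable_mult_right[OF int_B'] key])
  also have "\<dots> \<le> d powr (p - 1) * (d * Lp_energy p \<pi> f)"
    by (simp only: integral_mult_right_zero) (intro mult_left_mono le_B' powr_ge_zero)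
  also have "\<dots> = d powr p * Lp_energy p \<pi> f"
    using d by (simp add: powr_diff)
  finally show "Lp_energy p \<pi> ?T \<le> d powr p * Lp_energy p \<pi> f" .
qed


section \<open>Growth below the critical value\<close>

locale stationary_mixture = mixture_chain +
  fixes \<xi> :: "'a \<Rightarrow> real"
  assumes stationary: "\<pi> \<bind> U = \<pi>"
    and \<xi>: "\<xi> \<in> borel_measurable borel" and \<xi>_nonneg: "\<And>x. 0 \<le> \<xi> x"
begin

definition w :: "real \<Rightarrow> 'a \<Rightarrow> ennreal" where
  "w \<gamma> = (\<lambda>x. ennreal (exp (- \<gamma> * \<xi> x)))"

text \<open>
  The coefficients of the renewal equation for the chain started from \<open>\<pi>\<close>.
\<close>

abbreviation "A \<gamma> n \<equiv> laplace_Y \<pi> U \<xi> n \<gamma>"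

lemma w: "w \<gamma> \<in> borel_measurable borel"
  unfolding w_def using \<xi> by measurable

lemma w_le_1: "0 \<le> \<gamma> \<Longrightarrow> w \<gamma> x \<le> 1"
  using \<xi>_nonneg by (simp add: w_def)

lemma A_bounds: "0 \<le> \<gamma> \<Longrightarrow> 0 < A \<gamma> n" "0 \<le> \<gamma> \<Longrightarrow> A \<gamma> n \<le> 1"
  using laplace_Y_pos[OF prob_pi sets_pi U \<xi> \<xi>_nonneg] laplace_Y_le_1[OF prob_pi sets_pi U \<xi> \<xi>_nonneg]
  by auto

lemma A_eq: "0 \<le> \<gamma> \<Longrightarrow> ennreal (A \<gamma> n) = path_moment \<pi> U (w \<gamma>) n (\<lambda>_. 1)"
  using laplace_Y_eq_path_moment[OF prob_pi sets_pi U \<xi> \<xi>_nonneg, folded w_def] .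

lemma nn_integral_U:
  assumes "g \<in> borel_measurable borel"
  shows "(\<integral>\<^sup>+x. (\<integral>\<^sup>+y. g y \<partial>U x) \<partial>\<pi>) = (\<integral>\<^sup>+x. g x \<partial>\<pi>)"
proof -
  have "U \<in> \<pi> \<rightarrow>\<^sub>M subprob_algebra borel"
    using measurable_prob_algebraD[OF U] by (simp add: measurable_cong_sets[OF sets_pi refl])
  from nn_integral_bind[OF assms this] show ?thesis
    by (simp add: stationary)
qed

lemma nn_integral_P:
  assumes "g \<in> borel_measurable borel"
  shows "(\<integral>\<^sup>+x. (\<integral>\<^sup>+y. g y \<partial>P x) \<partial>\<pi>) = (\<integral>\<^sup>+x. g x \<partial>\<pi>)"
proof -
  interpret prob_space \<pi> by (rule prob_pi)
  have [measurable]: "(\<lambda>x. \<integral>\<^sup>+y. g y \<partial>U x) \<in> borel_measurable \<pi>"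
    using feynman_kac_measurable[OF U _ assms, of "\<lambda>_. 1"]
    by (simp add: feynman_kac_def[abs_def] measurable_cong_sets[OF sets_pi refl])
  have "(\<integral>\<^sup>+x. (\<integral>\<^sup>+y. g y \<partial>P x) \<partial>\<pi>)
      = (\<integral>\<^sup>+x. ennreal \<alpha> * (\<integral>\<^sup>+y. g y \<partial>\<pi>) + ennreal (1 - \<alpha>) * (\<integral>\<^sup>+y. g y \<partial>U x) \<partial>\<pi>)"
    by (simp add: nn_integral_mixture_kernel[OF sets_pi kernel_prob_space(2)[OF U] assms])
  also have "\<dots> = ennreal \<alpha> * (\<integral>\<^sup>+y. g y \<partial>\<pi>) + ennreal (1 - \<alpha>) * (\<integral>\<^sup>+x. g x \<partial>\<pi>)"
    by (simp add: nn_integral_add nn_integral_cmult nn_integral_U[OF assms] emeasure_space_1)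
  also have "\<dots> = (\<integral>\<^sup>+x. g x \<partial>\<pi>)"
    using alpha by (simp flip: distrib_right ennreal_plus)
  finally show ?thesis .
qed

lemma nn_integral_feynman_kac_power_le:
  assumes K: "K \<in> borel \<rightarrow>\<^sub>M prob_algebra borel"
    and inv: "\<And>g. g \<in> borel_measurable borel \<Longrightarrow> (\<integral>\<^sup>+x. (\<integral>\<^sup>+y. g y \<partial>K x) \<partial>\<pi>) = (\<integral>\<^sup>+x. g x \<partial>\<pi>)"
    and \<gamma>: "0 \<le> \<gamma>" and g: "g \<in> borel_measurable borel"
  shows "(\<integral>\<^sup>+x. (feynman_kac K (w \<gamma>) ^^ n) g x \<partial>\<pi>) \<le> (\<integral>\<^sup>+x. g x \<partial>\<pi>)"
proof (induction n)
  case (Suc n)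
  let ?h = "(feynman_kac K (w \<gamma>) ^^ n) g"
  have "(\<integral>\<^sup>+x. feynman_kac K (w \<gamma>) ?h x \<partial>\<pi>) \<le> (\<integral>\<^sup>+x. (\<integral>\<^sup>+y. ?h y \<partial>K x) \<partial>\<pi>)"
    unfolding feynman_kac_def[of K "w \<gamma>" ?h]
    using mult_right_mono[OF w_le_1[OF \<gamma>]] by (intro nn_integral_mono) simp
  also have "\<dots> = (\<integral>\<^sup>+x. ?h x \<partial>\<pi>)"
    by (intro inv feynman_kac_power_measurable K w g)
  finally show ?case using Suc by simp
qed simp

lemma path_moment_U_le:
  assumes "0 \<le> \<gamma>" "g \<in> borel_measurable borel"
  shows "path_moment \<pi> U (w \<gamma>) n g \<le> (\<integral>\<^sup>+x. g x \<partial>\<pi>)"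
proof -
  have "path_moment \<pi> U (w \<gamma>) n g \<le> (\<integral>\<^sup>+x. (feynman_kac U (w \<gamma>) ^^ n) g x \<partial>\<pi>)"
    unfolding path_moment_def
    using mult_right_mono[OF w_le_1[OF assms(1)]] by (intro nn_integral_mono) simp
  also have "\<dots> \<le> (\<integral>\<^sup>+x. g x \<partial>\<pi>)"
    by (intro nn_integral_feynman_kac_power_le U nn_integral_U assms)
  finally show ?thesis .
qed

text \<open>
  Invariance of \<open>\<pi>\<close> enters twice: it makes the operator a contraction, and it shows that
  \<open>\<pi>\<close>-null sets are null for \<open>P x\<close> for almost every \<open>x\<close>, so that the operator acts on classes of
  functions.
\<close>

lemma laplace_operator_P_bounded:
  assumes p: "1 < p" and \<gamma>: "0 \<le> \<gamma>"
  shows "Lp_bounded_operator p \<pi> (laplace_operator P \<xi> \<gamma>)"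
proof -
  interpret prob_space \<pi> by (rule prob_pi)
  let ?T = "laplace_operator P \<xi> \<gamma>"
  note cs = measurable_cong_sets[OF sets_pi refl]
  have w1: "w \<gamma> x \<le> 1" for x by (rule w_le_1[OF \<gamma>])
  have energy: "?T f \<in> Lp_functions p \<pi> \<and> Lp_energy p \<pi> (?T f) \<le> Lp_energy p \<pi> f"
    if f: "f \<in> Lp_functions p \<pi>" for f
    using Lp_energy_laplace_operator_power[OF prob_pi sets_pi P \<xi> \<xi>_nonneg \<gamma> p, of 1 1 f, folded w_def]
      feynman_kac_power_le_1[OF P w1, of 1]
      nn_integral_feynman_kac_power_le[OF P nn_integral_P \<gamma>, of _ 1] f
    by simp
  have null: "AE x in \<pi>. AE y in P x. f y = g y"
    if fg: "f \<in> borel_measurable borel" "g \<in> borel_measurable borel" "AE x in \<pi>. f x = g x"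
    for f g :: "'a \<Rightarrow> complex"
  proof -
    let ?N = "{y. f y \<noteq> g y}"
    have N: "?N \<in> sets borel" using fg by measurable
    have [measurable]: "(\<lambda>x. emeasure (P x) ?N) \<in> borel_measurable \<pi>"
      using measurable_compose[OF measurable_prob_algebraD[OF P] measurable_emeasure_subprob_algebra[OF N]]
      by (simp add: cs)
    have "(\<integral>\<^sup>+x. emeasure (P x) ?N \<partial>\<pi>) = emeasure \<pi> ?N"
      using nn_integral_P[of "indicator ?N"] N by (simp add: sets_pi)
    also have "\<dots> = 0"
      using fg(3) N AE_iff_measurable[of ?N \<pi> "\<lambda>x. f x = g x"] sets_eq_imp_space_eq[OF sets_pi]
      by (simp add: sets_pi)
    finally have "AE x in \<pi>. emeasure (P x) ?N = 0"
      by (subst (asm) nn_integral_0_iff_AE) auto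
    then show ?thesis
      using N by (auto intro!: AE_I[where N = ?N] elim!: eventually_mono)
  qed
  have int: "AE x in \<pi>. integrable (P x) (\<lambda>y. f y * complex_of_real (exp (- \<gamma> * \<xi> y)))"
    if f: "f \<in> Lp_functions p \<pi>" for f
  proof -
    have [measurable]: "f \<in> borel_measurable borel" using f by (simp add: Lp_functions_def cs)
    note [measurable] = \<xi>
    have "integrable \<pi> (\<lambda>x. 1 + norm (f x) powr p)"
      using f by (simp add: Lp_functions_def)
    then have "integrable \<pi> f"
    proof (rule Bochner_Integration.integrable_bound)
      have "a \<le> 1 + a powr p" if "0 \<le> a" for a :: real
      proof (cases "a \<le> 1")
        case False
        then show ?thesis using p powr_mono[of 1 p a] by simp
      qed (simp add: add_increasing2)
      then show "AE x in \<pi>. norm (f x) \<le> norm (1 + norm (f x) powr p)" by simp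
    qed (simp add: cs)
    then have "(\<integral>\<^sup>+x. (\<integral>\<^sup>+y. norm (f y) \<partial>P x) \<partial>\<pi>) \<noteq> \<infinity>"
      by (subst nn_integral_P) (auto simp: integrable_iff_bounded)
    then have "AE x in \<pi>. (\<integral>\<^sup>+y. norm (f y) \<partial>P x) \<noteq> \<infinity>"
      by (rule nn_integral_PInf_AE[rotated])
         (use feynman_kac_measurable[OF P, of "\<lambda>_. 1" "\<lambda>y. ennreal (norm (f y))"] in
           \<open>simp add: feynman_kac_def[abs_def] cs\<close>)
    then show ?thesis
    proof eventually_elim
      case (elim x)
      note cP = measurable_cong_sets[OF sets_mixture_kernel refl]
      have "integrable (P x) f"
        by (rule integrableI_bounded) (use elim in \<open>auto simp: cP less_top\<close>)
      then show ?case
        by (rule Bochner_Integration.integrable_bound)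
           (use \<xi>_nonneg \<gamma> in \<open>auto simp: cP norm_mult mult_left_le\<close>)
    qed
  qed
  have meas: "f \<in> borel_measurable borel" if "f \<in> Lp_functions p \<pi>" for f :: "'a \<Rightarrow> complex"
    using that by (simp add: Lp_functions_def cs)
  show ?thesis
    unfolding Lp_bounded_operator_def
  proof (intro conjI ballI allI impI)
    show "?T f \<in> Lp_functions p \<pi>" if "f \<in> Lp_functions p \<pi>" for f
      using energy[OF that] by simp
    show "AE x in \<pi>. ?T f x = ?T g x"
      if fg: "f \<in> Lp_functions p \<pi>" "g \<in> Lp_functions p \<pi>" "AE x in \<pi>. f x = g x" for f g
      using null[OF meas[OF fg(1)] meas[OF fg(2)] fg(3)]
    proof eventually_elim
      case (elim x)
      note cP = measurable_cong_sets[OF sets_mixture_kernel refl]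
      note [measurable] = \<xi> meas[OF fg(1)] meas[OF fg(2)]
      show ?case
        unfolding laplace_operator_def
        by (rule integral_cong_AE) (use elim in \<open>auto simp: cP elim!: eventually_mono\<close>)
    qed
    show "AE x in \<pi>. ?T (\<lambda>y. f y + g y) x = ?T f x + ?T g x"
      if fg: "f \<in> Lp_functions p \<pi>" "g \<in> Lp_functions p \<pi>" for f g
      using int[OF fg(1)] int[OF fg(2)]
      by eventually_elim (simp add: laplace_operator_def distrib_right)
    show "AE x in \<pi>. ?T (\<lambda>y. c * f y) x = c * ?T f x" if "f \<in> Lp_functions p \<pi>" for c f
      by (simp add: laplace_operator_def mult.assoc)
    show "\<exists>C. \<forall>f\<in>Lp_functions p \<pi>. Lp_norm p \<pi> (?T f) \<le> C * Lp_norm p \<pi> f"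
    proof (intro exI[of _ 1] ballI)
      fix f :: "'a \<Rightarrow> complex" assume "f \<in> Lp_functions p \<pi>"
      then show "Lp_norm p \<pi> (?T f) \<le> 1 * Lp_norm p \<pi> f"
        using p energy by (subst Lp_norm_le_iff_energy) auto
    qed
  qed
qed

text \<open>
  Induction along the renewal equation. By hypothesis the weights \<open>\<alpha> * (1 - \<alpha>) ^ k * A \<gamma> k\<close>, divided
  by \<open>(1 - \<alpha>) ^ (k + 1)\<close>, have total mass at most \<open>1\<close>. Dividing by \<open>q ^ (k + 1)\<close> instead gains the factor
  \<open>(1 - \<alpha>) / q < 1\<close>, and \<open>q / (q - (1 - \<alpha>))\<close> is the sum of the resulting geometric series.
\<close>

lemma path_moment_P_growth:
  assumes \<gamma>: "0 \<le> \<gamma>" and q: "1 - \<alpha> < q"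
    and crit: "\<And>N. \<alpha> / (1 - \<alpha>) * (\<Sum>n<N. A \<gamma> n) \<le> 1"
    and g: "g \<in> borel_measurable borel"
  shows "path_moment \<pi> P (w \<gamma>) n g \<le> ennreal (q / (q - (1 - \<alpha>)) * q ^ n) * (\<integral>\<^sup>+x. g x \<partial>\<pi>)"
proof (induction n rule: less_induct)
  case (less n)
  define b where "b = 1 - \<alpha>"
  define D where "D = q / (q - b)"
  have b: "0 < b" "b < q" and q0: "0 < q" using alpha q by (auto simp: b_def)
  have D: "0 < D" using b q0 by (simp add: D_def)
  let ?G = "\<integral>\<^sup>+x. g x \<partial>\<pi>"
  have real_ineq: "b ^ n + (\<Sum>k<n. \<alpha> * b ^ k * A \<gamma> k * (D * q ^ (n - 1 - k))) \<le> D * q ^ n"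
  proof -
    have "(\<Sum>k<n. \<alpha> * b ^ k * A \<gamma> k * (D * q ^ (n - 1 - k)))
        \<le> (\<Sum>k<n. D * q ^ n * (b / q) * (\<alpha> / b * A \<gamma> k))"
    proof (rule sum_mono)
      fix k assume "k \<in> {..<n}"
      then have n: "q ^ n = q ^ (n - 1 - k) * q ^ Suc k"
        by (simp add: power_add[symmetric] del: power_Suc)
      have "b ^ k * q ^ (n - 1 - k) = q ^ n * (b / q) ^ Suc k / b"
        unfolding n using q0 b by (simp add: power_divide)
      also have "\<dots> \<le> q ^ n * (b / q) / b"
        using q0 b power_decreasing[of 1 "Suc k" "b / q"]
        by (intro divide_right_mono mult_left_mono) auto
      finally have "(\<alpha> * A \<gamma> k * D) * (b ^ k * q ^ (n - 1 - k)) \<le> (\<alpha> * A \<gamma> k * D) * (q ^ n * (b / q) / b)"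
        using alpha D A_bounds(1)[OF \<gamma>, of k] by (intro mult_left_mono) auto
      then show "\<alpha> * b ^ k * A \<gamma> k * (D * q ^ (n - 1 - k)) \<le> D * q ^ n * (b / q) * (\<alpha> / b * A \<gamma> k)"
        using b by (simp add: mult_ac)
    qed
    also have "\<dots> = D * q ^ n * (b / q) * (\<alpha> / b * (\<Sum>k<n. A \<gamma> k))"
      by (simp add: sum_distrib_left)
    also have "\<dots> \<le> D * q ^ n * (b / q) * 1"
      using crit[of n] D q0 b by (intro mult_left_mono) (auto simp: b_def)
    finally have "b ^ n + (\<Sum>k<n. \<alpha> * b ^ k * A \<gamma> k * (D * q ^ (n - 1 - k)))
        \<le> q ^ n + D * q ^ n * (b / q)"
      using b by (simp add: add_mono power_mono)
    also have "\<dots> = D * q ^ n"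
      using b q0 by (simp add: D_def field_simps)
    finally show ?thesis .
  qed
  have "path_moment \<pi> P (w \<gamma>) n g
      = ennreal b ^ n * path_moment \<pi> U (w \<gamma>) n g +
        (\<Sum>k<n. ennreal \<alpha> * ennreal b ^ k * ennreal (A \<gamma> k) * path_moment \<pi> P (w \<gamma>) (n - 1 - k) g)"
    by (subst path_moment_mixture[OF sets_pi w g]) (simp add: A_eq[OF \<gamma>] b_def)
  also have "\<dots> \<le> ennreal b ^ n * ?G +
        (\<Sum>k<n. ennreal \<alpha> * ennreal b ^ k * ennreal (A \<gamma> k) * (ennreal (D * q ^ (n - 1 - k)) * ?G))"
    using less unfolding D_def b_def
    by (intro add_mono mult_left_mono sum_mono path_moment_U_le \<gamma> g) auto
  also have "\<dots> = ennreal (b ^ n + (\<Sum>k<n. \<alpha> * b ^ k * A \<gamma> k * (D * q ^ (n - 1 - k)))) * ?G"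
    using b alpha D q0 A_bounds(1)[OF \<gamma>, THEN less_imp_le]
    by (simp add: ennreal_plus ennreal_mult ennreal_power[symmetric] sum_nonneg distrib_right
        sum_distrib_right mult.assoc flip: sum_ennreal)
  also have "\<dots> \<le> ennreal (D * q ^ n) * ?G"
    by (intro mult_right_mono ennreal_leI real_ineq) simp
  finally show ?case by (simp add: D_def b_def)
qed

lemma feynman_kac_P_growth:
  assumes \<gamma>: "0 \<le> \<gamma>" and q: "1 - \<alpha> < q"
    and crit: "\<And>N. \<alpha> / (1 - \<alpha>) * (\<Sum>n<N. A \<gamma> n) \<le> 1"
  obtains D where "0 < D"
    and "\<And>n x. (feynman_kac P (w \<gamma>) ^^ n) (\<lambda>_. 1) x \<le> ennreal (D * q ^ n)"
    and "\<And>n g. g \<in> borel_measurable borel \<Longrightarrow>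
      (\<integral>\<^sup>+x. (feynman_kac P (w \<gamma>) ^^ n) g x \<partial>\<pi>) \<le> ennreal (D * q ^ n) * (\<integral>\<^sup>+x. g x \<partial>\<pi>)"
proof -
  interpret prob_space \<pi> by (rule prob_pi)
  define b where "b = 1 - \<alpha>"
  define E where "E = q / (q - b)"
  define D where "D = 1 + \<alpha> * E / (q - b)"
  have b: "0 < b" "b < q" and q0: "0 < q" using alpha q by (auto simp: b_def)
  have E: "0 < E" using b q0 by (simp add: E_def)
  then have D: "0 < D" using b alpha by (simp add: D_def add_pos_nonneg)
  have w1: "w \<gamma> x \<le> 1" for x by (rule w_le_1[OF \<gamma>])
  \<comment> \<open>\<open>E\<close> bounds the moments by \<open>path_moment_P_growth\<close>; \<open>D\<close> also pays for the sum over regenerations\<close>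
  have real_ineq: "b ^ n + (\<Sum>k<n. \<alpha> * b ^ k * (E * q ^ (n - 1 - k))) \<le> D * q ^ n" for n
  proof -
    have "(q - b) * (\<Sum>k<n. b ^ k * q ^ (n - 1 - k)) = q ^ n - b ^ n"
      using power_diff_sumr2[of b n q] by (simp add: algebra_simps)
    then have "(\<Sum>k<n. b ^ k * q ^ (n - 1 - k)) \<le> q ^ n / (q - b)"
      using b by (subst pos_le_divide_eq) (auto simp: mult.commute)
    then have "\<alpha> * E * (\<Sum>k<n. b ^ k * q ^ (n - 1 - k)) \<le> \<alpha> * E * (q ^ n / (q - b))"
      using alpha E by (intro mult_left_mono) auto
    moreover have "b ^ n \<le> q ^ n" using b by (intro power_mono) auto
    ultimately show ?thesis by (simp add: D_def sum_distrib_left algebra_simps)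
  qed
  have enn: "ennreal b ^ n * G + (\<Sum>k<n. ennreal \<alpha> * ennreal b ^ k * (ennreal (E * q ^ (n - 1 - k)) * G))
      \<le> ennreal (D * q ^ n) * G" for n G
  proof -
    have "ennreal b ^ n * G + (\<Sum>k<n. ennreal \<alpha> * ennreal b ^ k * (ennreal (E * q ^ (n - 1 - k)) * G))
       = ennreal (b ^ n + (\<Sum>k<n. \<alpha> * b ^ k * (E * q ^ (n - 1 - k)))) * G"
      using b alpha E q0
      by (simp add: ennreal_plus ennreal_mult ennreal_power[symmetric] sum_nonneg distrib_right
        sum_distrib_right mult.assoc flip: sum_ennreal)
    also have "\<dots> \<le> ennreal (D * q ^ n) * G"
      by (intro mult_right_mono ennreal_leI real_ineq) simp
    finally show ?thesis .
  qed
  note growth = path_moment_P_growth[OF \<gamma> q crit, folded b_def, folded E_def]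
  show ?thesis
  proof (rule that[OF D])
    fix n x
    have "(feynman_kac P (w \<gamma>) ^^ n) (\<lambda>_. 1) x
        = ennreal b ^ n * (feynman_kac U (w \<gamma>) ^^ n) (\<lambda>_. 1) x + (\<Sum>k<n. ennreal \<alpha> * ennreal b ^ k
           * path_moment \<pi> P (w \<gamma>) (n - 1 - k) (\<lambda>_. 1) * (feynman_kac U (w \<gamma>) ^^ k) (\<lambda>_. 1) x)"
      by (simp add: feynman_kac_mixture_power[OF w] b_def)
    also have "\<dots> \<le> ennreal b ^ n * 1 + (\<Sum>k<n. ennreal \<alpha> * ennreal b ^ k
           * (ennreal (E * q ^ (n - 1 - k)) * (\<integral>\<^sup>+x. 1 \<partial>\<pi>)) * 1)"
      by (intro add_mono mult_mono sum_mono growth feynman_kac_power_le_1[OF U w1]) auto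
    also have "\<dots> \<le> ennreal (D * q ^ n)"
      using enn[of n 1] by (simp add: emeasure_space_1)
    finally show "(feynman_kac P (w \<gamma>) ^^ n) (\<lambda>_. 1) x \<le> ennreal (D * q ^ n)" .
  next
    fix n and g :: "'a \<Rightarrow> ennreal" assume g: "g \<in> borel_measurable borel"
    let ?G = "\<integral>\<^sup>+x. g x \<partial>\<pi>"
    have [measurable]: "(feynman_kac U (w \<gamma>) ^^ k) h \<in> borel_measurable \<pi>"
      if "h \<in> borel_measurable borel" for h k
      using feynman_kac_power_measurable[OF U w that] by (simp add: measurable_cong_sets[OF sets_pi refl])
    have "(\<integral>\<^sup>+x. (feynman_kac P (w \<gamma>) ^^ n) g x \<partial>\<pi>)
       = ennreal b ^ n * (\<integral>\<^sup>+x. (feynman_kac U (w \<gamma>) ^^ n) g x \<partial>\<pi>) + (\<Sum>k<n. ennreal \<alpha> * ennreal b ^ k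
           * path_moment \<pi> P (w \<gamma>) (n - 1 - k) g * (\<integral>\<^sup>+x. (feynman_kac U (w \<gamma>) ^^ k) (\<lambda>_. 1) x \<partial>\<pi>))"
      using g
      by (simp add: feynman_kac_mixture_power[OF w g] b_def nn_integral_add nn_integral_cmult nn_integral_sum)
    also have "\<dots> \<le> ennreal b ^ n * ?G + (\<Sum>k<n. ennreal \<alpha> * ennreal b ^ k
           * (ennreal (E * q ^ (n - 1 - k)) * ?G) * (\<integral>\<^sup>+x. 1 \<partial>\<pi>))"
      by (intro add_mono mult_mono sum_mono growth g
          nn_integral_feynman_kac_power_le[OF U nn_integral_U \<gamma>]) auto
    also have "\<dots> \<le> ennreal (D * q ^ n) * ?G"
      using enn[of n ?G] by (simp add: emeasure_space_1)
    finally show "(\<integral>\<^sup>+x. (feynman_kac P (w \<gamma>) ^^ n) g x \<partial>\<pi>) \<le> ennreal (D * q ^ n) * ?G" .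
  qed
qed

lemma spectral_radius_le:
  assumes p: "1 < p" and \<gamma>: "0 \<le> \<gamma>"
    and crit: "\<And>N. \<alpha> / (1 - \<alpha>) * (\<Sum>n<N. A \<gamma> n) \<le> 1"
  shows "Lp_spectral_radius p \<pi> (laplace_operator P \<xi> \<gamma>) \<le> ennreal (1 - \<alpha>)"
  unfolding Lp_spectral_radius_def
proof (rule SUP_least, rule ccontr)
  fix z assume z: "z \<in> Lp_spectrum p \<pi> (laplace_operator P \<xi> \<gamma>)" "\<not> ennreal (cmod z) \<le> ennreal (1 - \<alpha>)"
  then have "1 - \<alpha> < cmod z" by (meson ennreal_leI not_le)
  then obtain q where q: "1 - \<alpha> < q" "q < cmod z" using dense by blast
  obtain D where D: "0 < D"
    "\<And>n x. (feynman_kac P (w \<gamma>) ^^ n) (\<lambda>_. 1) x \<le> ennreal (D * q ^ n)"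
    "\<And>n g. g \<in> borel_measurable borel \<Longrightarrow>
      (\<integral>\<^sup>+x. (feynman_kac P (w \<gamma>) ^^ n) g x \<partial>\<pi>) \<le> ennreal (D * q ^ n) * (\<integral>\<^sup>+x. g x \<partial>\<pi>)"
    using feynman_kac_P_growth[OF \<gamma> q(1) crit] by blast
  have q0: "0 < q" using q alpha by simp
  have "z \<notin> Lp_spectrum p \<pi> (laplace_operator P \<xi> \<gamma>)"
    using D q0 Lp_energy_laplace_operator_power(2)[OF prob_pi sets_pi P \<xi> \<xi>_nonneg \<gamma> p _ D(2,3)[unfolded w_def]]
    by (intro Lp_spectrum_bound[OF p laplace_operator_P_bounded[OF p \<gamma>] q0 _ _ q(2), of D]) auto
  with z show False by simp
qed

end


section \<open>The spectral radius\<close>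

context stationary_mixture
begin

text \<open>
  For the root \<open>x\<close> of the renewal equation, \<open>\<Phi> = \<Sum>n. x ^ n * U\<^sub>\<gamma>\<^sup>n 1\<close> is a bounded eigenfunction of
  \<open>P\<^sub>\<gamma>\<close> for the eigenvalue \<open>\<rho> = (1 - \<alpha>) / x\<close>, and it is bounded below by \<open>1\<close>.
\<close>

lemma spectral_radius_gt:
  assumes p: "1 < p" and \<gamma>: "0 \<le> \<gamma>"
    and crit: "1 < \<alpha> / (1 - \<alpha>) * (\<Sum>n<N. A \<gamma> n)"
  shows "ennreal (1 - \<alpha>) < Lp_spectral_radius p \<pi> (laplace_operator P \<xi> \<gamma>)"
proof -
  interpret prob_space \<pi> by (rule prob_pi)
  define b where "b = 1 - \<alpha>"
  have b: "0 < b" using alpha by (simp add: b_def)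
  note cs = measurable_cong_sets[OF sets_pi refl]
  have w1: "w \<gamma> x \<le> 1" for x by (rule w_le_1[OF \<gamma>])
  note A_nonneg = A_bounds(1)[OF \<gamma>, THEN less_imp_le]
  have "\<exists>x. 0 < x \<and> x < 1 \<and> \<alpha> / b * (x * (\<Sum>n. A \<gamma> n * x ^ n)) = 1"
    by (rule renewal_root_exists[OF A_nonneg A_bounds(2)[OF \<gamma>] A_bounds(1)[OF \<gamma>]])
       (use crit alpha b in \<open>auto simp: b_def\<close>)
  then obtain x where x: "0 < x" "x < 1" "\<alpha> / b * (x * (\<Sum>n. A \<gamma> n * x ^ n)) = 1"
    by blast
  define \<rho> where "\<rho> = b / x"
  have \<rho>: "0 < \<rho>" "b < \<rho>" "\<rho> * x = b"
    using x(1,2) b by (auto simp: \<rho>_def less_divide_eq)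
  let ?F = "\<lambda>n. (feynman_kac U (w \<gamma>) ^^ n) (\<lambda>_. 1)"
  have F_le: "?F n y \<le> 1" for n y by (rule feynman_kac_power_le_1[OF U w1])
  have Fm [measurable]: "?F n \<in> borel_measurable borel" for n
    by (rule feynman_kac_power_measurable[OF U w]) simp
  note [measurable] = w[of \<gamma>]
  define \<Phi> where "\<Phi> y = (\<Sum>n. ennreal (x ^ n) * ?F n y)" for y
  have \<Phi>_meas [measurable]: "\<Phi> \<in> borel_measurable borel"
    unfolding \<Phi>_def by measurable
  have \<Phi>_le: "\<Phi> y \<le> ennreal (1 / (1 - x))" for y
  proof -
    have "\<Phi> y \<le> (\<Sum>n. ennreal (x ^ n))"
      unfolding \<Phi>_def using mult_left_mono[OF F_le] by (intro suminf_le) auto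
    also have "\<dots> = ennreal (1 / (1 - x))"
      using x geometric_sums[of x] by (intro suminf_ennreal_eq) auto
    finally show ?thesis .
  qed
  have \<Phi>_split: "\<Phi> y = 1 + (\<Sum>n. ennreal (x ^ Suc n) * ?F (Suc n) y)" for y
    unfolding \<Phi>_def
    using sums_unique[OF sums_Suc[OF summable_sums[OF summableI]], of "\<lambda>n. ennreal (x ^ n) * ?F n y"]
    by (simp add: add.commute del: power_Suc)
  have \<Phi>_ge: "1 \<le> \<Phi> y" for y
    unfolding \<Phi>_split by simp
  have eig: "feynman_kac P (w \<gamma>) \<Phi> y = ennreal \<rho> * \<Phi> y" for y
  proof -
    have "(\<integral>\<^sup>+y. w \<gamma> y * \<Phi> y \<partial>\<pi>) = (\<integral>\<^sup>+y. (\<Sum>n. ennreal (x ^ n) * (w \<gamma> y * ?F n y)) \<partial>\<pi>)"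
      unfolding \<Phi>_def by (simp add: ennreal_suminf_cmult[symmetric] mult_ac)
    also have "\<dots> = (\<Sum>n. ennreal (x ^ n) * path_moment \<pi> U (w \<gamma>) n (\<lambda>_. 1))"
      unfolding path_moment_def
      by (subst nn_integral_suminf) (simp_all add: nn_integral_cmult cs)
    also have "\<dots> = (\<Sum>n. ennreal (A \<gamma> n * x ^ n))"
      using x(1) A_nonneg by (simp add: A_eq[OF \<gamma>, symmetric] ennreal_mult mult.commute)
    also have "\<dots> = ennreal (\<Sum>n. A \<gamma> n * x ^ n)"
      using x(1,2) A_nonneg A_bounds[OF \<gamma>]
      by (intro suminf_ennreal2 bounded_powser_summable) auto
    also have "(\<Sum>n. A \<gamma> n * x ^ n) = \<rho> / \<alpha>"
      using x b alpha by (simp add: \<rho>_def field_simps)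
    finally have 1: "ennreal \<alpha> * (\<integral>\<^sup>+y. w \<gamma> y * \<Phi> y \<partial>\<pi>) = ennreal \<rho>"
      using alpha \<rho> by (simp flip: ennreal_mult)
    have "feynman_kac U (w \<gamma>) \<Phi> y = (\<integral>\<^sup>+z. (\<Sum>n. ennreal (x ^ n) * (w \<gamma> z * ?F n z)) \<partial>U y)"
      unfolding \<Phi>_def feynman_kac_def[of U "w \<gamma>" "\<lambda>y. (\<Sum>n. ennreal (x ^ n) * ?F n y)"]
      by (simp add: ennreal_suminf_cmult[symmetric] mult_ac)
    also have "\<dots> = (\<Sum>n. ennreal (x ^ n) * ?F (Suc n) y)"
      by (subst nn_integral_suminf)
         (simp_all add: nn_integral_cmult measurable_cong_sets[OF kernel_prob_space(2)[OF U] refl] feynman_kac_def)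
    finally have 2: "ennreal b * feynman_kac U (w \<gamma>) \<Phi> y = (\<Sum>n. ennreal b * (ennreal (x ^ n) * ?F (Suc n) y))"
      by simp
    have "ennreal \<rho> * ennreal (x ^ Suc n) = ennreal b * ennreal (x ^ n)" for n
      using \<rho> x b by (simp add: mult.assoc[symmetric] flip: ennreal_mult)
    then have "ennreal \<rho> * \<Phi> y = ennreal \<rho> + (\<Sum>n. ennreal b * (ennreal (x ^ n) * ?F (Suc n) y))"
      unfolding \<Phi>_split distrib_left ennreal_suminf_cmult[symmetric]
      by (simp add: mult.assoc[symmetric] del: funpow.simps power_Suc)
    then show ?thesis
      using feynman_kac_mixture[OF w \<Phi>_meas] 1 2 by (simp add: b_def)
  qed
  define \<phi> where "\<phi> y = complex_of_real (enn2real (\<Phi> y))" for y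
  have \<Phi>_real: "\<Phi> y = ennreal (enn2real (\<Phi> y))" for y
    using order.strict_trans1[OF \<Phi>_le[of y]] by simp
  have \<phi>_bounds: "1 \<le> enn2real (\<Phi> y)" "enn2real (\<Phi> y) \<le> 1 / (1 - x)" for y
  proof -
    have "ennreal 1 \<le> ennreal (enn2real (\<Phi> y))" "ennreal (enn2real (\<Phi> y)) \<le> ennreal (1 / (1 - x))"
      using \<Phi>_ge[of y] \<Phi>_le[of y] unfolding \<Phi>_real[symmetric] by auto
    then show "1 \<le> enn2real (\<Phi> y)" "enn2real (\<Phi> y) \<le> 1 / (1 - x)"
      using x by (subst (asm) (1 2) ennreal_le_iff; simp)+
  qed
  have T: "laplace_operator P \<xi> \<gamma> \<phi> y = complex_of_real \<rho> * \<phi> y" for y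
  proof -
    have "laplace_operator P \<xi> \<gamma> \<phi> y = complex_of_real (\<integral>z. enn2real (\<Phi> z) * exp (- \<gamma> * \<xi> z) \<partial>P y)"
      unfolding laplace_operator_def \<phi>_def
      by (simp only: of_real_mult[symmetric] integral_complex_of_real)
    also have "(\<integral>z. enn2real (\<Phi> z) * exp (- \<gamma> * \<xi> z) \<partial>P y)
        = enn2real (\<integral>\<^sup>+z. ennreal (enn2real (\<Phi> z) * exp (- \<gamma> * \<xi> z)) \<partial>P y)"
      using \<xi> by (intro integral_eq_nn_integral) (auto simp: measurable_cong_sets[OF sets_mixture_kernel refl])
    also have "(\<integral>\<^sup>+z. ennreal (enn2real (\<Phi> z) * exp (- \<gamma> * \<xi> z)) \<partial>P y) = feynman_kac P (w \<gamma>) \<Phi> y"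
      unfolding feynman_kac_def w_def
      by (intro nn_integral_cong) (simp add: ennreal_mult \<Phi>_real[symmetric] mult.commute)
    finally show ?thesis
      using \<rho> by (simp add: eig enn2real_mult) (simp add: \<phi>_def)
  qed
  have \<phi>_Lp: "\<phi> \<in> Lp_functions p \<pi>"
  proof -
    have m: "\<phi> \<in> borel_measurable \<pi>" unfolding \<phi>_def by (simp add: cs)
    have "norm (\<phi> y) powr p \<le> (1 / (1 - x)) powr p" for y
      using \<phi>_bounds[of y] p by (intro powr_mono2) (auto simp: \<phi>_def)
    then have "integrable \<pi> (\<lambda>y. norm (\<phi> y) powr p)"
      using m by (intro integrable_const_bound[where B="(1 / (1 - x)) powr p"]) auto
    then show ?thesis using m by (simp add: Lp_functions_def)
  qed
  have "complex_of_real \<rho> \<in> Lp_spectrum p \<pi> (laplace_operator P \<xi> \<gamma>)"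
    unfolding Lp_spectrum_def
  proof (safe)
    fix R assume R: "Lp_bounded_operator p \<pi> R"
      and inv: "\<forall>f\<in>Lp_functions p \<pi>.
         (AE x in \<pi>. R (\<lambda>y. complex_of_real \<rho> * f y - laplace_operator P \<xi> \<gamma> f y) x = f x) \<and>
         (AE x in \<pi>. complex_of_real \<rho> * R f x - laplace_operator P \<xi> \<gamma> (R f) x = f x)"
    \<comment> \<open>a left inverse would map \<open>0 = \<rho> \<phi> - T \<phi>\<close> to \<open>\<phi>\<close>, but linearity maps it to \<open>0\<close>\<close>
    have "AE x in \<pi>. R (\<lambda>y. 0 * \<phi> y) x = 0 * R \<phi> x"
      using R \<phi>_Lp unfolding Lp_bounded_operator_def by blast
    moreover have "AE x in \<pi>. R (\<lambda>_. 0) x = \<phi> x"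
      using inv \<phi>_Lp by (auto simp: T)
    ultimately have "AE y in \<pi>. \<phi> y = 0" by eventually_elim simp
    then have "AE y in \<pi>. False"
    proof eventually_elim
      case (elim y)
      then show ?case using \<phi>_bounds(1)[of y] by (simp add: \<phi>_def)
    qed
    then show False by simp
  qed
  then have "ennreal (cmod (complex_of_real \<rho>)) \<le> Lp_spectral_radius p \<pi> (laplace_operator P \<xi> \<gamma>)"
    unfolding Lp_spectral_radius_def by (rule SUP_upper)
  moreover have "ennreal (1 - \<alpha>) < ennreal (cmod (complex_of_real \<rho>))"
    using \<rho> b by (subst ennreal_less_iff) (auto simp: b_def)
  ultimately show ?thesis by simp
qed

text \<open>
  This turns a condition on an operator into a scalar one, which is visibly open and inherited by
  smaller values of \<open>\<gamma>\<close>.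
\<close>

lemma spectral_radius_gt_iff:
  assumes p: "1 < p" and \<gamma>: "0 \<le> \<gamma>"
  shows "ennreal (1 - \<alpha>) < Lp_spectral_radius p \<pi> (laplace_operator P \<xi> \<gamma>) \<longleftrightarrow>
     (\<exists>N. 1 < \<alpha> / (1 - \<alpha>) * (\<Sum>n<N. A \<gamma> n))"
  using spectral_radius_gt[OF assms] spectral_radius_le[OF assms] by (meson not_le)

end


section \<open>A renewal theorem with parameters\<close>

abbreviation cfps :: "(nat \<Rightarrow> real) \<Rightarrow> complex fps" where
  "cfps c \<equiv> Abs_fps (\<lambda>n. complex_of_real (c n))"

lemma cfps_conv_radius:
  assumes c: "\<And>n. \<bar>c n\<bar> \<le> C * r ^ n" and r: "0 < r" "r * R < 1" and R: "0 \<le> R"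
  shows "ereal R < fps_conv_radius (cfps c)"
proof -
  have "R < 1 / r" using r by (simp add: field_simps)
  then obtain S where S: "R < S" "S < 1 / r" using dense by blast
  have "summable (\<lambda>n. fps_nth (cfps c) n * complex_of_real S ^ n)"
  proof (rule summable_comparison_test)
    show "\<exists>N. \<forall>n\<ge>N. norm (fps_nth (cfps c) n * complex_of_real S ^ n) \<le> C * (r * S) ^ n"
      using mult_right_mono[OF c, of "S ^ n" n for n] S R
      by (auto simp: norm_mult norm_power power_mult_distrib mult_ac)
    show "summable (\<lambda>n. C * (r * S) ^ n)"
      using S R r by (intro summable_mult summable_geometric) (auto simp: field_simps)
  qed
  then have "norm (complex_of_real S) \<le> fps_conv_radius (cfps c)"
    unfolding fps_conv_radius_def by (intro conv_radius_geI)
  moreover have "ereal R < norm (complex_of_real S)" using S R by simp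
  ultimately show ?thesis by (rule order.strict_trans2[rotated])
qed

text \<open>
  The generating function of \<open>l\<close> is \<open>Q z / (1 - z)\<close> with \<open>Q = v / t\<close> holomorphic beyond the closed
  unit disc. Hence \<open>l n\<close> is the sum of the Taylor coefficients of \<open>Q\<close> up to \<open>n\<close>; it tends to
  \<open>Q 1\<close>, and Cauchy's inequality controls the remainder with explicit constants, which is what makes
  the estimate uniform in a parameter later on.
\<close>

lemma fps_quotient_asymptotics:
  fixes v t l :: "nat \<Rightarrow> real"
  assumes v: "\<And>n. \<bar>v n\<bar> \<le> C * r ^ n" and t: "\<And>n. \<bar>t n\<bar> \<le> D * r ^ n"
    and r: "0 < r" "r * R < 1" and R: "1 < R"
    and c: "0 < c" "\<And>z. cmod z \<le> R \<Longrightarrow> c \<le> cmod (eval_fps (cfps t) z)"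
    and B: "\<And>z. cmod z \<le> R \<Longrightarrow> cmod (eval_fps (cfps v) z) \<le> B"
    and l: "cfps l * (1 - fps_X) * cfps t = cfps v"
  shows "cmod (complex_of_real (l n) - eval_fps (cfps v) 1 / eval_fps (cfps t) 1)
    \<le> B / c / (R - 1) * (1 / R) ^ n"
proof -
  let ?V = "eval_fps (cfps v)" and ?T = "eval_fps (cfps t)"
  define Q where "Q z = ?V z / ?T z" for z
  define q where "q n = (deriv ^^ n) Q 0 / fact n" for n
  have R0: "0 \<le> R" using R by simp
  note cv = cfps_conv_radius[OF v r R0] and ct = cfps_conv_radius[OF t r R0]
  have nz: "?T z \<noteq> 0" if "cmod z \<le> R" for z using c(2)[OF that] c(1) by auto
  have conv: "ereal (cmod z) < fps_conv_radius (cfps v)" "ereal (cmod z) < fps_conv_radius (cfps t)"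
    if "cmod z \<le> R" for z
    using order.strict_trans1[of "ereal (cmod z)" "ereal R"] cv ct that by auto
  have hol: "Q holomorphic_on cball 0 R"
    unfolding Q_def
    by (intro holomorphic_intros nz)
       (auto simp: in_eball_iff conv)
  have Q_le: "cmod (Q z) \<le> B / c" if "cmod z \<le> R" for z
    unfolding Q_def norm_divide using c(1) c(2)[OF that] B[OF that]
      order.trans[OF norm_ge_zero B[OF that]]
    by (intro frac_le) auto
  have q_le: "cmod (q n) \<le> B / c * (1 / R) ^ n" for n
  proof -
    have "cmod ((deriv ^^ n) Q 0) \<le> fact n * (B / c) / R ^ n"
      by (rule Cauchy_inequality)
         (use R Q_le in \<open>auto intro!: holomorphic_on_subset[OF hol] holomorphic_on_imp_continuous_on\<close>)
    then show ?thesis by (simp add: q_def norm_divide field_simps power_divide)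
  qed
  have "0 < fps_conv_radius (cfps v)" "0 < fps_conv_radius (cfps t)"
    using order.strict_trans1[OF _ cv, of 0] order.strict_trans1[OF _ ct, of 0] R by auto
  then have "?V has_fps_expansion cfps v" "?T has_fps_expansion cfps t"
    by (auto intro: eval_fps_has_fps_expansion)
  moreover have t0: "fps_nth (cfps t) 0 \<noteq> 0"
    using nz[of 0] R by (simp add: eval_fps_at_0)
  ultimately have "Q has_fps_expansion cfps v / cfps t"
    unfolding Q_def by (rule has_fps_expansion_divide')
  moreover have "cfps v / cfps t = cfps l * (1 - fps_X)"
    unfolding l[symmetric] using t0 by (intro nonzero_mult_div_cancel_right) (metis fps_zero_nth)
  ultimately have exp: "Q has_fps_expansion cfps l * (1 - fps_X)" by simp
  have q_nth: "q n = fps_nth (cfps l * (1 - fps_X)) n" for n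
    using fps_nth_fps_expansion[OF exp] by (simp add: q_def)
  have l_sum: "complex_of_real (l n) = (\<Sum>k\<le>n. q k)" for n
  proof (induction n)
    case (Suc n)
    have "q (Suc n) = complex_of_real (l (Suc n)) - complex_of_real (l n)"
      by (simp add: q_nth right_diff_distrib)
    then show ?case using Suc by simp
  qed (simp add: q_nth right_diff_distrib)
  have "(\<lambda>n. (deriv ^^ n) Q 0 / fact n * (1 - 0) ^ n) sums Q 1"
    by (rule holomorphic_power_series[of Q 0 R])
       (use R in \<open>auto intro!: holomorphic_on_subset[OF hol]\<close>)
  then have sums: "q sums Q 1" by (simp add: q_def[abs_def])
  have geo: "summable (\<lambda>k. B / c * (1 / R) ^ (k + Suc n))"
    unfolding power_add mult.assoc[symmetric]
    using R by (intro summable_mult2 summable_mult summable_geometric) auto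
  have "Q 1 - complex_of_real (l n) = (\<Sum>k. q (k + Suc n))"
    using suminf_minus_initial_segment[OF sums_summable[OF sums], of "Suc n"] sums_unique[OF sums]
    by (simp add: l_sum lessThan_Suc_atMost)
  then have "cmod (complex_of_real (l n) - Q 1) = cmod (\<Sum>k. q (k + Suc n))"
    by (simp add: norm_minus_commute)
  also have "\<dots> \<le> (\<Sum>k. B / c * (1 / R) ^ (k + Suc n))"
  proof -
    have "summable (\<lambda>k. cmod (q (k + Suc n)))"
      by (rule summable_comparison_test[OF _ geo]) (intro exI[of _ 0] allI impI, subst real_norm_def, subst abs_norm_cancel, rule q_le)
    then show ?thesis
      by (intro order.trans[OF summable_norm suminf_le] q_le geo)
  qed
  also have "(\<Sum>k. B / c * (1 / R) ^ (k + Suc n)) = B / c / (R - 1) * (1 / R) ^ n"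
  proof -
    have S: "(\<lambda>k. B / c * (1 / R) ^ Suc n * (1 / R) ^ k) sums (B / c * (1 / R) ^ Suc n * (1 / (1 - 1 / R)))"
      using R by (intro sums_mult geometric_sums) auto
    have "1 / R * (1 / (1 - 1 / R)) = 1 / (R - 1)"
      using R by (simp add: divide_simps)
    then have E1: "B / c * (1 / R) ^ Suc n * (1 / (1 - 1 / R)) = B / c / (R - 1) * (1 / R) ^ n"
      by (simp add: mult_ac)
    have E2: "B / c * (1 / R) ^ Suc n * (1 / R) ^ k = B / c * (1 / R) ^ (k + Suc n)" for k
      by (simp add: power_add)
    show ?thesis
      using S unfolding E1 E2 by (rule sums_unique[symmetric])
  qed
  finally show ?thesis by (simp add: Q_def)
qed

lemma continuous_on_powser_family:
  fixes c :: "real \<Rightarrow> nat \<Rightarrow> real"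
  assumes cont: "\<And>n. continuous_on K (\<lambda>\<gamma>. c \<gamma> n)"
    and bound: "\<And>\<gamma> n. \<gamma> \<in> K \<Longrightarrow> \<bar>c \<gamma> n\<bar> \<le> C * r ^ n"
    and r: "0 < r" "r * R < 1" and R: "0 \<le> R" and C: "0 \<le> C"
  shows "continuous_on (K \<times> cball 0 R) (\<lambda>x. eval_fps (cfps (c (fst x))) (snd x))"
proof -
  let ?f = "\<lambda>n (x :: real \<times> complex). complex_of_real (c (fst x) n) * snd x ^ n"
  have "uniform_limit (K \<times> cball 0 R) (\<lambda>n x. \<Sum>i<n. ?f i x) (\<lambda>x. suminf (\<lambda>i. ?f i x)) sequentially"
  proof (rule Weierstrass_m_test)
    fix n and x :: "real \<times> complex" assume x: "x \<in> K \<times> cball 0 R"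
    then have "\<bar>c (fst x) n\<bar> * cmod (snd x) ^ n \<le> (C * r ^ n) * R ^ n"
      using r C by (intro mult_mono power_mono bound) auto
    then show "norm (?f n x) \<le> C * (r * R) ^ n"
      by (simp add: norm_mult norm_power power_mult_distrib)
  next
    show "summable (\<lambda>n. C * (r * R) ^ n)"
      using r R by (intro summable_mult summable_geometric) auto
  qed
  moreover have "\<forall>\<^sub>F n in sequentially. continuous_on (K \<times> cball 0 R) (\<lambda>x. \<Sum>i<n. ?f i x)"
  proof (rule always_eventually, rule allI)
    have [continuous_intros]: "continuous_on (K \<times> cball 0 R) (\<lambda>x. c (fst x) i)" for i
      by (rule continuous_on_compose2[OF cont]) (auto intro: continuous_intros)
    show "continuous_on (K \<times> cball 0 R) (\<lambda>x. \<Sum>i<n. ?f i x)" for n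
      by (intro continuous_intros)
  qed
  ultimately have "continuous_on (K \<times> cball 0 R) (\<lambda>x. suminf (\<lambda>i. ?f i x))"
    by (intro uniform_limit_theorem[where F = sequentially]) auto
  then show ?thesis by (simp add: eval_fps_def)
qed

lemma renewal_equation_fps:
  fixes L v l :: "nat \<Rightarrow> real"
  assumes "\<And>n. L n = v n + s * (\<Sum>k<n. v k * l (n - 1 - k))"
  shows "cfps L = cfps v * (1 + fps_const (complex_of_real s) * (fps_X * cfps l))"
proof (rule fps_ext)
  fix n
  have "fps_nth (cfps v * (fps_X * cfps l)) n = complex_of_real (\<Sum>k<n. v k * l (n - 1 - k))"
  proof (cases n)
    case (Suc m)
    have "fps_nth (cfps v * (fps_X * cfps l)) n = fps_nth (fps_X * (cfps v * cfps l)) n"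
      by (simp add: mult_ac)
    also have "\<dots> = fps_nth (cfps v * cfps l) m"
      by (simp add: Suc)
    also have "\<dots> = (\<Sum>k=0..m. complex_of_real (v k) * complex_of_real (l (m - k)))"
      by (simp add: fps_mult_nth)
    finally show ?thesis
      by (simp add: Suc atLeast0AtMost lessThan_Suc_atMost)
  qed simp
  then show "fps_nth (cfps L) n = fps_nth (cfps v * (1 + fps_const (complex_of_real s) * (fps_X * cfps l))) n"
    using assms[of n] by (simp add: distrib_left mult.left_commute[of "cfps v"])
qed


text \<open>
  At the root \<open>x\<close> the numbers \<open>weight n\<close> form a probability distribution of waiting times \<open>n + 1\<close>, and
  \<open>tail n\<close> is the probability that the waiting time exceeds \<open>n\<close>.
\<close>

locale renewal_weights =
  fixes \<kappa> x :: real and a :: "nat \<Rightarrow> real"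
  assumes \<kappa>: "0 < \<kappa>" and x: "0 < x" "x < 1"
    and a: "\<And>n. 0 \<le> a n" "\<And>n. a n \<le> 1" and a0: "0 < a 0"
    and root: "\<kappa> * (x * (\<Sum>n. a n * x ^ n)) = 1"
begin

definition weight :: "nat \<Rightarrow> real" where
  "weight n = \<kappa> * x ^ Suc n * a n"

definition tail :: "nat \<Rightarrow> real" where
  "tail n = 1 - (\<Sum>k<n. weight k)"

lemma weight_nonneg: "0 \<le> weight n"
  using \<kappa> x a by (simp add: weight_def)

lemma weight_sums: "weight sums 1"
proof -
  have "(\<lambda>n. \<kappa> * (x * (a n * x ^ n))) sums (\<kappa> * (x * (\<Sum>n. a n * x ^ n)))"
    using x by (intro sums_mult summable_sums bounded_powser_summable a a0) auto
  then show ?thesis unfolding root by (simp add: weight_def[abs_def] mult_ac)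
qed

lemma tail_eq: "tail n = (\<Sum>k. weight (k + n))"
  using suminf_minus_initial_segment[OF sums_summable[OF weight_sums], of n] sums_unique[OF weight_sums]
  by (simp add: tail_def)

lemma tail_nonneg: "0 \<le> tail n"
  unfolding tail_eq
  by (intro suminf_nonneg weight_nonneg summable_ignore_initial_segment sums_summable[OF weight_sums])

lemma tail_le: "tail n \<le> \<kappa> / (1 - x) * x ^ n"
proof -
  have "(\<Sum>k. weight (k + n)) \<le> (\<Sum>k. \<kappa> * x ^ n * x ^ k)"
  proof (intro suminf_le summable_ignore_initial_segment sums_summable[OF weight_sums])
    show "weight (k + n) \<le> \<kappa> * x ^ n * x ^ k" for k
    proof -
      have "weight (k + n) \<le> \<kappa> * x ^ Suc (k + n) * 1"
        unfolding weight_def using \<kappa> x a by (intro mult_left_mono) auto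
      also have "\<dots> \<le> \<kappa> * x ^ (k + n) * 1"
        using \<kappa> x power_decreasing[of "k + n" "Suc (k + n)" x] by (intro mult_right_mono mult_left_mono) auto
      finally show ?thesis by (simp add: power_add mult_ac)
    qed
  qed (use x in \<open>intro summable_mult summable_geometric, auto\<close>)
  also have "\<dots> = \<kappa> / (1 - x) * x ^ n"
  proof -
    have "(\<lambda>k. \<kappa> * x ^ n * x ^ k) sums (\<kappa> * x ^ n * (1 / (1 - x)))"
      using x by (intro sums_mult geometric_sums) auto
    then show ?thesis by (intro sums_unique[symmetric]) (simp add: mult_ac)
  qed
  finally show ?thesis by (simp add: tail_eq)
qed

lemma tail_fps: "(1 - fps_X) * cfps tail = 1 - fps_X * cfps weight"
proof (rule fps_ext)
  fix n show "fps_nth ((1 - fps_X) * cfps tail) n = fps_nth (1 - fps_X * cfps weight) n"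
    by (cases n) (auto simp: left_diff_distrib tail_def)
qed

text \<open>
  The renewal theorem for aperiodic weights in analytic form. At \<open>z \<noteq> 1\<close> a zero would force
  \<open>\<Sum>n. weight n * z ^ (n + 1) = 1\<close>, hence \<open>Re z = 1\<close> since the weights sum to \<open>1\<close> and \<open>weight 0 > 0\<close>;
  at \<open>z = 1\<close> the value is the mean waiting time, which is positive.
\<close>

lemma tail_powser_nonzero:
  assumes z: "cmod z \<le> 1"
  shows "eval_fps (cfps tail) z \<noteq> 0"
proof
  assume zero: "eval_fps (cfps tail) z = 0"
  have C: "ereal 1 < fps_conv_radius (cfps tail)"
    by (rule cfps_conv_radius[of _ "\<kappa> / (1 - x)" x]) (use tail_le tail_nonneg x in auto)
  have tail_summable: "summable (\<lambda>n. complex_of_real (tail n) * y ^ n)" if "cmod y \<le> 1" for y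
    using summable_fps[of y "cfps tail"] order.strict_trans1[OF _ C, of "ereal (cmod y)"] that by simp
  show False
  proof (cases "z = 1")
    case True
    have "(\<lambda>n. complex_of_real (tail n)) sums 0"
      using summable_sums[OF tail_summable[of 1]] zero True by (simp add: eval_fps_def)
    then have s: "tail sums 0" using sums_of_real_iff[of tail 0, where 'a=complex] by simp
    have "tail 0 \<le> suminf tail"
      using sum_le_suminf[OF sums_summable[OF s], of "{0}"] tail_nonneg by auto
    then show False using sums_unique[OF s] by (simp add: tail_def)
  next
    case False
    have "eval_fps ((1 - fps_X) * cfps tail) z = 0"
      using zero order.strict_trans1[OF _ C, of "ereal (cmod z)"] z
        fps_conv_radius_diff[of 1 "fps_X :: complex fps"]
      by (subst eval_fps_mult) auto
    moreover have ws: "summable (\<lambda>n. complex_of_real (weight n) * z ^ Suc n)"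
    proof (rule summable_comparison_test[OF _ sums_summable[OF weight_sums]])
      show "\<exists>N. \<forall>n\<ge>N. norm (complex_of_real (weight n) * z ^ Suc n) \<le> weight n"
        using z weight_nonneg power_le_one[of "cmod z"]
        by (auto simp: norm_mult norm_power abs_of_nonneg simp del: power_Suc intro!: mult_left_le)
    qed
    moreover have "(\<lambda>n. fps_nth (1 - fps_X * cfps weight) n * z ^ n)
        sums (- (\<Sum>n. complex_of_real (weight n) * z ^ Suc n) + 1)"
      using sums_Suc[of "\<lambda>n. fps_nth (1 - fps_X * cfps weight) n * z ^ n"
          "- (\<Sum>n. complex_of_real (weight n) * z ^ Suc n)"]
        sums_minus[OF summable_sums[OF ws]]
      by (simp del: power_Suc)
    ultimately have eq: "(\<Sum>n. complex_of_real (weight n) * z ^ Suc n) = 1"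
      unfolding tail_fps eval_fps_def using sums_unique by force
    have "(\<lambda>n. Re (complex_of_real (weight n) * z ^ Suc n)) sums Re 1"
      using summable_sums[OF ws] unfolding eq by (rule sums_Re)
    then have "(\<lambda>n. weight n - Re (complex_of_real (weight n) * z ^ Suc n)) sums (1 - 1)"
      using weight_sums by (intro sums_diff) auto
    then have s: "(\<lambda>n. weight n * (1 - Re (z ^ Suc n))) sums 0"
      by (simp add: right_diff_distrib del: power_Suc)
    have nn: "0 \<le> weight n * (1 - Re (z ^ Suc n))" for n
    proof -
      have "Re (z ^ Suc n) \<le> cmod (z ^ Suc n)" by (rule complex_Re_le_cmod)
      also have "\<dots> \<le> 1" using z by (simp add: norm_power power_le_one del: power_Suc)
      finally show ?thesis using weight_nonneg by simp
    qed
    have "weight 0 * (1 - Re (z ^ Suc 0)) \<le> (\<Sum>n. weight n * (1 - Re (z ^ Suc n)))"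
      using sum_le_suminf[OF sums_summable[OF s], of "{0}"] nn by auto
    then have "weight 0 * (1 - Re z) \<le> 0" using sums_unique[OF s] by simp
    moreover have "0 < weight 0" using \<kappa> x a0 by (simp add: weight_def)
    ultimately have "1 \<le> Re z" by (simp add: mult_le_0_iff)
    then have "Re z = 1" using complex_Re_le_cmod[of z] z by simp
    moreover from this have "Im z = 0"
      using z cmod_power2[of z] power_le_one[of "cmod z" 2] by simp
    ultimately show False using False by (simp add: complex_eq_iff)
  qed
qed

text \<open>
  Solving both renewal equations as identities of formal power series, where no convergence of the
  series built from \<open>L\<close> and \<open>l\<close> has to be known.
\<close>

lemma renewal_solution_fps:
  assumes L: "\<And>n. L n = h n * x ^ n + \<kappa> * x * (\<Sum>k<n. h k * x ^ k * l (n - 1 - k))"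
    and l: "\<And>n. l n = a n * x ^ n + \<kappa> * x * (\<Sum>k<n. a k * x ^ k * l (n - 1 - k))"
  shows "cfps L * (1 - fps_X) * cfps tail = cfps (\<lambda>n. h n * x ^ n)"
proof -
  let ?s = "fps_const (complex_of_real (\<kappa> * x))" and ?u = "cfps (\<lambda>n. a n * x ^ n)"
  let ?B = "1 + ?s * (fps_X * cfps l)"
  have W: "cfps weight = ?s * ?u"
    by (rule fps_ext) (simp add: weight_def mult_ac)
  have lu: "cfps l = ?u * ?B" by (rule renewal_equation_fps) (fact l)
  have "?B * (1 - fps_X * cfps weight) = ?B - ?s * fps_X * (?u * ?B)"
    by (simp add: W algebra_simps)
  also have "\<dots> = 1" unfolding lu[symmetric] by (simp add: mult.assoc)
  finally have "?B * ((1 - fps_X) * cfps tail) = 1" by (simp add: tail_fps)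
  then have "cfps (\<lambda>n. h n * x ^ n) * (?B * ((1 - fps_X) * cfps tail)) = cfps (\<lambda>n. h n * x ^ n)"
    by simp
  moreover have "cfps L = cfps (\<lambda>n. h n * x ^ n) * ?B" by (rule renewal_equation_fps) (fact L)
  ultimately show ?thesis by (simp add: mult.assoc)
qed

end

lemma eval_fps_one_real:
  assumes c: "\<And>n. 0 \<le> c n" "\<And>n. c n \<le> C * r ^ n" and r: "0 < r" "r < 1" and c0: "0 < c 0"
  shows "eval_fps (cfps c) 1 = complex_of_real (suminf c)" "0 < suminf c"
proof -
  have s: "summable c"
  proof (rule summable_comparison_test)
    show "\<exists>N. \<forall>n\<ge>N. norm (c n) \<le> C * r ^ n" using c by auto
  qed (use r in \<open>intro summable_mult summable_geometric, auto\<close>)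
  show "eval_fps (cfps c) 1 = complex_of_real (suminf c)"
    using sums_of_real[OF summable_sums[OF s], where 'a = complex]
    by (simp add: eval_fps_def sums_iff)
  have "c 0 \<le> suminf c" using sum_le_suminf[OF s, of "{0}"] c by auto
  with c0 show "0 < suminf c" by simp
qed

text \<open>
  Multiplying the \<open>n\<close>-th term by \<open>(x \<gamma> / b) ^ n\<close> gives a renewal equation whose weights sum to \<open>1\<close>,
  to which \<open>fps_quotient_asymptotics\<close> applies. Uniformity on a compact set \<open>K\<close> of parameters comes
  from compactness: the denominators have no zero on \<open>K \<times> cball 0 1\<close>, hence none on \<open>K \<times> cball 0 S\<close>
  for some \<open>S > 1\<close>, and there they are bounded away from \<open>0\<close>.
\<close>

theorem renewal_theorem_uniform:
  fixes a h L l :: "real \<Rightarrow> nat \<Rightarrow> real" and x :: "real \<Rightarrow> real"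
  assumes J: "open J" and b: "0 < b"
    and W: "\<And>\<gamma>. \<gamma> \<in> J \<Longrightarrow> renewal_weights \<kappa> (x \<gamma>) (a \<gamma>)"
    and h: "\<And>\<gamma> n. \<gamma> \<in> J \<Longrightarrow> 0 \<le> h \<gamma> n" "\<And>\<gamma> n. \<gamma> \<in> J \<Longrightarrow> h \<gamma> n \<le> 1" "\<And>\<gamma>. \<gamma> \<in> J \<Longrightarrow> 0 < h \<gamma> 0"
    and cont: "continuous_on J x" "\<And>n. continuous_on J (\<lambda>\<gamma>. a \<gamma> n)" "\<And>n. continuous_on J (\<lambda>\<gamma>. h \<gamma> n)"
    and L: "\<And>\<gamma> n. \<gamma> \<in> J \<Longrightarrow> L \<gamma> n = b ^ n * h \<gamma> n + (\<Sum>k<n. \<kappa> * b * b ^ k * h \<gamma> k * l \<gamma> (n - 1 - k))"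
    and l: "\<And>\<gamma> n. \<gamma> \<in> J \<Longrightarrow> l \<gamma> n = b ^ n * a \<gamma> n + (\<Sum>k<n. \<kappa> * b * b ^ k * a \<gamma> k * l \<gamma> (n - 1 - k))"
  shows "\<exists>A. continuous_on J A \<and> (\<forall>\<gamma>\<in>J. 0 < A \<gamma>) \<and>
    (\<forall>K. compact K \<and> K \<subseteq> J \<longrightarrow> (\<exists>M \<theta>. 0 < M \<and> 0 < \<theta> \<and> \<theta> < 1 \<and>
       (\<forall>\<gamma>\<in>K. \<forall>n. \<bar>L \<gamma> n - A \<gamma> * (b / x \<gamma>) ^ n\<bar> \<le> M * (b / x \<gamma> * \<theta>) ^ n)))"
proof -
  define V where "V \<gamma> n = h \<gamma> n * x \<gamma> ^ n" for \<gamma> n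
  define T where "T \<gamma> = renewal_weights.tail \<kappa> (x \<gamma>) (a \<gamma>)" for \<gamma>
  define A where "A \<gamma> = Re (eval_fps (cfps (V \<gamma>)) 1 / eval_fps (cfps (T \<gamma>)) 1)" for \<gamma>
  have x: "0 < x \<gamma>" "x \<gamma> < 1" if "\<gamma> \<in> J" for \<gamma>
    using W[OF that] by (auto simp: renewal_weights_def)
  have Teq: "T \<gamma> n = 1 - (\<Sum>k<n. \<kappa> * x \<gamma> ^ Suc k * a \<gamma> k)" if "\<gamma> \<in> J" for \<gamma> n
    using renewal_weights.tail_def[OF W[OF that]] renewal_weights.weight_def[OF W[OF that]]
    by (simp add: T_def)
  have normalize: "(b ^ n * g n + (\<Sum>k<n. \<kappa> * b * b ^ k * g k * l \<gamma> (n - 1 - k))) * (y / b) ^ n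
      = g n * y ^ n + \<kappa> * y * (\<Sum>k<n. g k * y ^ k * (l \<gamma> (n - 1 - k) * (y / b) ^ (n - 1 - k)))"
    for g :: "nat \<Rightarrow> real" and y \<gamma> n
  proof -
    have "\<kappa> * b * b ^ k * g k * l \<gamma> (n - 1 - k) * (y / b) ^ n
        = \<kappa> * y * (g k * y ^ k * (l \<gamma> (n - 1 - k) * (y / b) ^ (n - 1 - k)))" if "k < n" for k
    proof -
      have "(y / b) ^ n = (y / b) ^ (n - 1 - k) * (y / b) ^ Suc k"
        using that by (simp add: power_add[symmetric] del: power_Suc)
      then have "\<kappa> * b * b ^ k * g k * l \<gamma> (n - 1 - k) * (y / b) ^ n
          = \<kappa> * g k * l \<gamma> (n - 1 - k) * (y / b) ^ (n - 1 - k) * (b ^ Suc k * (y / b) ^ Suc k)"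
        by (simp only: power_Suc mult_ac)
      also have "b ^ Suc k * (y / b) ^ Suc k = y ^ Suc k"
        using b by (simp flip: power_mult_distrib)
      finally show ?thesis by (simp add: mult_ac)
    qed
    moreover have "b ^ n * g n * (y / b) ^ n = g n * y ^ n"
      using b by (simp add: power_divide)
    ultimately show ?thesis
      unfolding distrib_right sum_distrib_right sum_distrib_left
      by (intro arg_cong2[where f = "(+)"] sum.cong) auto
  qed
  have fps: "cfps (\<lambda>n. L \<gamma> n * (x \<gamma> / b) ^ n) * (1 - fps_X) * cfps (T \<gamma>) = cfps (V \<gamma>)" if \<gamma>: "\<gamma> \<in> J" for \<gamma>
    unfolding T_def V_def
  proof (rule renewal_weights.renewal_solution_fps[OF W[OF \<gamma>]])
    show "L \<gamma> n * (x \<gamma> / b) ^ n = h \<gamma> n * x \<gamma> ^ n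
        + \<kappa> * x \<gamma> * (\<Sum>k<n. h \<gamma> k * x \<gamma> ^ k * (l \<gamma> (n - 1 - k) * (x \<gamma> / b) ^ (n - 1 - k)))" for n
      by (subst L[OF \<gamma>]) (rule normalize)
    show "l \<gamma> n * (x \<gamma> / b) ^ n = a \<gamma> n * x \<gamma> ^ n
        + \<kappa> * x \<gamma> * (\<Sum>k<n. a \<gamma> k * x \<gamma> ^ k * (l \<gamma> (n - 1 - k) * (x \<gamma> / b) ^ (n - 1 - k)))" for n
      by (subst l[OF \<gamma>]) (rule normalize)
  qed
  have T_nn: "0 \<le> T \<gamma> n" if "\<gamma> \<in> J" for \<gamma> n
    unfolding T_def by (rule renewal_weights.tail_nonneg[OF W[OF that]])
  have T_le: "T \<gamma> n \<le> \<kappa> / (1 - x \<gamma>) * x \<gamma> ^ n" if "\<gamma> \<in> J" for \<gamma> n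
    unfolding T_def by (rule renewal_weights.tail_le[OF W[OF that]])
  have V_nn: "0 \<le> V \<gamma> n" and V_le: "V \<gamma> n \<le> 1 * x \<gamma> ^ n" if "\<gamma> \<in> J" for \<gamma> n
    using h(1,2)[OF that, of n] x[OF that] by (auto simp: V_def mult_left_le_one_le)
  have A_pos: "0 < A \<gamma>" if \<gamma>: "\<gamma> \<in> J" for \<gamma>
  proof -
    note v = eval_fps_one_real[OF V_nn[OF \<gamma>] V_le[OF \<gamma>] x[OF \<gamma>]]
    note t = eval_fps_one_real[OF T_nn[OF \<gamma>] T_le[OF \<gamma>] x[OF \<gamma>]]
    have "0 < V \<gamma> 0" "0 < T \<gamma> 0" using h(3)[OF \<gamma>] by (auto simp: V_def Teq[OF \<gamma>])
    then show ?thesis using v t by (simp add: A_def)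
  qed
  have key: "continuous_on K A \<and> (\<exists>M \<theta>. 0 < M \<and> 0 < \<theta> \<and> \<theta> < 1 \<and>
       (\<forall>\<gamma>\<in>K. \<forall>n. \<bar>L \<gamma> n - A \<gamma> * (b / x \<gamma>) ^ n\<bar> \<le> M * (b / x \<gamma> * \<theta>) ^ n))"
    if K: "compact K" "K \<subseteq> J" for K
  proof (cases "K = {}")
    case True
    then show ?thesis by (auto intro!: exI[of _ 1] exI[of _ "1/2"])
  next
    case False
    have contK: "continuous_on K x" "\<And>n. continuous_on K (\<lambda>\<gamma>. a \<gamma> n)" "\<And>n. continuous_on K (\<lambda>\<gamma>. h \<gamma> n)"
      using cont K(2) continuous_on_subset by blast+
    obtain \<gamma>0 where \<gamma>0: "\<gamma>0 \<in> K" "\<And>\<gamma>. \<gamma> \<in> K \<Longrightarrow> x \<gamma> \<le> x \<gamma>0"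
      using continuous_attains_sup[OF K(1) False contK(1)] by auto
    define r where "r = x \<gamma>0"
    have r: "0 < r" "r < 1" and xr: "\<And>\<gamma>. \<gamma> \<in> K \<Longrightarrow> x \<gamma> \<le> r"
      using \<gamma>0 x K by (auto simp: r_def)
    \<comment> \<open>halfway between the unit circle and the circle of convergence\<close>
    define R where "R = (1 + 1 / r) / 2"
    have R: "1 < R" "r * R < 1" using r by (auto simp: R_def field_simps)
    have \<kappa>: "0 < \<kappa>" using W[of \<gamma>0] \<gamma>0 K by (auto simp: renewal_weights_def)
    have Vb: "\<bar>V \<gamma> n\<bar> \<le> 1 * r ^ n" if "\<gamma> \<in> K" for \<gamma> n
    proof -
      have "x \<gamma> ^ n \<le> r ^ n" using xr[OF that] x(1)[THEN less_imp_le] that K by (intro power_mono) auto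
      then show ?thesis using V_nn[of \<gamma> n] V_le[of \<gamma> n] that K by force
    qed
    have Tb: "\<bar>T \<gamma> n\<bar> \<le> \<kappa> / (1 - r) * r ^ n" if "\<gamma> \<in> K" for \<gamma> n
    proof -
      have \<gamma>: "\<gamma> \<in> J" using that K by auto
      have "\<kappa> / (1 - x \<gamma>) * x \<gamma> ^ n \<le> \<kappa> / (1 - r) * r ^ n"
        using xr[OF that] x[OF \<gamma>] \<kappa> r by (intro mult_mono power_mono divide_left_mono) auto
      then show ?thesis using T_nn[OF \<gamma>, of n] T_le[OF \<gamma>, of n] by simp
    qed
    have contV: "continuous_on K (\<lambda>\<gamma>. V \<gamma> n)" for n
      unfolding V_def by (intro continuous_intros contK)
    have contT: "continuous_on K (\<lambda>\<gamma>. T \<gamma> n)" for n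
    proof -
      have "continuous_on K (\<lambda>\<gamma>. 1 - (\<Sum>k<n. \<kappa> * x \<gamma> ^ Suc k * a \<gamma> k))"
        by (intro continuous_intros contK)
      then show ?thesis by (rule continuous_on_eq) (use Teq K in auto)
    qed
    let ?V = "\<lambda>p. eval_fps (cfps (V (fst p))) (snd p)" and ?T = "\<lambda>p. eval_fps (cfps (T (fst p))) (snd p)"
    have R0: "0 \<le> R" using R by simp
    have cV: "continuous_on (K \<times> cball 0 R) ?V"
      using continuous_on_powser_family[OF contV Vb r(1) R(2) R0] by simp
    have cT: "continuous_on (K \<times> cball 0 R) ?T"
      using continuous_on_powser_family[OF contT Tb r(1) R(2) R0] \<kappa> r by simp
    have comp: "compact (K \<times> cball (0::complex) S)" for S
      by (intro compact_Times K compact_cball)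
    \<comment> \<open>The zeros over \<open>K\<close> form a compact set outside the closed unit disc, so a larger disc is
      still free of them.\<close>
    obtain S where S: "1 < S" "S \<le> R" "\<And>p. p \<in> K \<times> cball 0 S \<Longrightarrow> ?T p \<noteq> 0"
    proof -
      let ?Z = "(K \<times> cball 0 R) \<inter> ?T -` {0}"
      have "closed ?Z"
        by (intro continuous_closed_preimage cT compact_imp_closed comp) auto
      then have Z: "compact ?Z" using compact_Int_closed[OF comp] by (metis inf_left_idem)
      show ?thesis
      proof (cases "?Z = {}")
        case True
        then show ?thesis using that[of R] R by auto
      next
        case False
        have "continuous_on ?Z (\<lambda>p. cmod (snd p))" by (intro continuous_intros)
        from continuous_attains_inf[OF Z False this]
        obtain p where p: "p \<in> ?Z" "\<And>p'. p' \<in> ?Z \<Longrightarrow> cmod (snd p) \<le> cmod (snd p')" by auto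
        have "1 < cmod (snd p)"
        proof (rule ccontr)
          assume "\<not> 1 < cmod (snd p)"
          then have "?T p \<noteq> 0"
            unfolding T_def using p(1) K
            by (intro renewal_weights.tail_powser_nonzero[OF W]) auto
          with p(1) show False by auto
        qed
        then obtain S where S: "1 < S" "S < cmod (snd p)" using dense by blast
        show ?thesis
        proof (rule that[of S])
          show "S \<le> R" using S p(1) by auto
          show "?T p' \<noteq> 0" if "p' \<in> K \<times> cball 0 S" for p'
            using p(2)[of p'] that S \<open>S \<le> R\<close> by auto
        qed (use S in auto)
      qed
    qed
    have sub: "K \<times> cball 0 S \<subseteq> K \<times> cball (0::complex) R" using S by auto
    have ne: "K \<times> cball (0::complex) S \<noteq> {}" using False S by auto
    have "continuous_on (K \<times> cball 0 S) (\<lambda>p. cmod (?T p))"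
      by (intro continuous_intros continuous_on_subset[OF cT sub])
    from continuous_attains_inf[OF comp ne this]
    obtain p where p: "p \<in> K \<times> cball 0 S" "\<And>p'. p' \<in> K \<times> cball 0 S \<Longrightarrow> cmod (?T p) \<le> cmod (?T p')" by auto
    define c where "c = cmod (?T p)"
    have c: "0 < c" using S(3)[OF p(1)] by (simp add: c_def)
    have "bounded (?V ` (K \<times> cball 0 S))"
      by (intro compact_imp_bounded compact_continuous_image comp continuous_on_subset[OF cV sub])
    then obtain B where B: "0 < B" "\<And>p. p \<in> K \<times> cball 0 S \<Longrightarrow> cmod (?V p) \<le> B"
      unfolding bounded_pos by auto
    have rS: "r * S < 1" using order.strict_trans1[OF mult_left_mono[OF S(2) less_imp_le[OF r(1)]] R(2)] .
    have est: "cmod (complex_of_real (L \<gamma> n * (x \<gamma> / b) ^ n)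
        - eval_fps (cfps (V \<gamma>)) 1 / eval_fps (cfps (T \<gamma>)) 1) \<le> B / c / (S - 1) * (1 / S) ^ n"
      if \<gamma>: "\<gamma> \<in> K" for \<gamma> n
    proof (rule fps_quotient_asymptotics[OF Vb[OF \<gamma>] Tb[OF \<gamma>] r(1) rS S(1) c])
      show "c \<le> cmod (eval_fps (cfps (T \<gamma>)) z)" if "cmod z \<le> S" for z
        using p(2)[of "(\<gamma>, z)"] \<gamma> that by (simp add: c_def)
      show "cmod (eval_fps (cfps (V \<gamma>)) z) \<le> B" if "cmod z \<le> S" for z
        using B(2)[of "(\<gamma>, z)"] \<gamma> that by simp
      show "cfps (\<lambda>n. L \<gamma> n * (x \<gamma> / b) ^ n) * (1 - fps_X) * cfps (T \<gamma>) = cfps (V \<gamma>)"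
        using fps \<gamma> K by auto
    qed
    have "\<bar>L \<gamma> n - A \<gamma> * (b / x \<gamma>) ^ n\<bar> \<le> B / c / (S - 1) * (b / x \<gamma> * (1 / S)) ^ n"
      if \<gamma>: "\<gamma> \<in> K" for \<gamma> n
    proof -
      have x0: "0 < x \<gamma>" using x \<gamma> K by auto
      have "\<bar>L \<gamma> n * (x \<gamma> / b) ^ n - A \<gamma>\<bar> \<le> B / c / (S - 1) * (1 / S) ^ n"
        using order.trans[OF abs_Re_le_cmod est[OF \<gamma>, of n]] by (simp add: A_def)
      then have "\<bar>L \<gamma> n * (x \<gamma> / b) ^ n - A \<gamma>\<bar> * (b / x \<gamma>) ^ n \<le> B / c / (S - 1) * (1 / S) ^ n * (b / x \<gamma>) ^ n"
        using x0 b by (intro mult_right_mono) auto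
      also have "\<bar>L \<gamma> n * (x \<gamma> / b) ^ n - A \<gamma>\<bar> * (b / x \<gamma>) ^ n = \<bar>(L \<gamma> n * (x \<gamma> / b) ^ n - A \<gamma>) * (b / x \<gamma>) ^ n\<bar>"
        using x0 b by (simp add: abs_mult)
      also have "(L \<gamma> n * (x \<gamma> / b) ^ n - A \<gamma>) * (b / x \<gamma>) ^ n = L \<gamma> n - A \<gamma> * (b / x \<gamma>) ^ n"
        using x0 b by (simp add: left_diff_distrib mult.assoc flip: power_mult_distrib)
      also have "B / c / (S - 1) * (1 / S) ^ n * (b / x \<gamma>) ^ n = B / c / (S - 1) * (b / x \<gamma> * (1 / S)) ^ n"
        by (simp only: power_mult_distrib mult_ac)
      finally show ?thesis .
    qed
    moreover have "continuous_on K A"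
    proof -
      have pair: "continuous_on K (\<lambda>\<gamma>. (\<gamma>, 1::complex))" "(\<lambda>\<gamma>. (\<gamma>, 1::complex)) ` K \<subseteq> K \<times> cball 0 R"
        using R by (auto intro!: continuous_intros)
      have "continuous_on K (\<lambda>\<gamma>. eval_fps (cfps (V \<gamma>)) 1)" "continuous_on K (\<lambda>\<gamma>. eval_fps (cfps (T \<gamma>)) 1)"
        using continuous_on_compose2[OF cV pair] continuous_on_compose2[OF cT pair] by simp_all
      then show ?thesis
        unfolding A_def using S by (intro continuous_intros) force+
    qed
    moreover have "0 < B / c / (S - 1)" "0 < 1 / S" "1 / S < 1" using B c S by auto
    ultimately show ?thesis by blast
  qed
  show ?thesis
  proof (intro exI[of _ A] conjI)
    show "continuous_on J A"
    proof (intro continuous_at_imp_continuous_on ballI)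
      fix \<gamma> assume "\<gamma> \<in> J"
      then obtain e where e: "0 < e" "cball \<gamma> e \<subseteq> J" using J open_contains_cball by blast
      then have "continuous_on (cball \<gamma> e) A" using key[of "cball \<gamma> e"] by auto
      then show "isCont A \<gamma>" by (rule continuous_on_interior) (use e in auto)
    qed
  qed (use A_pos key in auto)
qed


section \<open>Dependence on the parameter\<close>

lemma powser_family_tendsto:
  fixes c :: "nat \<Rightarrow> real \<Rightarrow> real" and y :: real
  assumes c: "\<And>n. (c n \<longlongrightarrow> d n) F" and b: "eventually (\<lambda>\<gamma>. \<forall>n. \<bar>c n \<gamma>\<bar> \<le> 1) F" and y: "\<bar>y\<bar> < 1"
  shows "((\<lambda>\<gamma>. \<Sum>n. c n \<gamma> * y ^ n) \<longlongrightarrow> (\<Sum>n. d n * y ^ n)) F"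
proof (cases "F = bot")
  case False
  have ev: "eventually (\<lambda>(n, \<gamma>). norm (c n \<gamma> * y ^ n) \<le> \<bar>y\<bar> ^ n) (at_top \<times>\<^sub>F F)"
    unfolding eventually_prod_filter
  proof (intro exI conjI)
    show "\<forall>n \<gamma>. True \<longrightarrow> (\<forall>n. \<bar>c n \<gamma>\<bar> \<le> 1) \<longrightarrow> (case (n, \<gamma>) of (n, \<gamma>) \<Rightarrow> norm (c n \<gamma> * y ^ n) \<le> \<bar>y\<bar> ^ n)"
      by (auto simp: abs_mult power_abs mult_left_le_one_le)
  qed (use b in auto)
  have "summable (\<lambda>n. \<bar>y\<bar> ^ n)" using y by (intro summable_geometric) auto
  from tannerys_theorem[OF tendsto_mult[OF c tendsto_const] ev this False] show ?thesis by blast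
qed simp

lemma powser_family_continuous_on:
  fixes c :: "nat \<Rightarrow> real \<Rightarrow> real" and y :: real
  assumes "\<And>n. continuous_on S (c n)" "\<And>n \<gamma>. \<gamma> \<in> S \<Longrightarrow> \<bar>c n \<gamma>\<bar> \<le> 1" "\<bar>y\<bar> < 1"
  shows "continuous_on S (\<lambda>\<gamma>. \<Sum>n. c n \<gamma> * y ^ n)"
  unfolding continuous_on_def
  using assms by (intro ballI powser_family_tendsto) (auto simp: continuous_on_def eventually_at_filter)

text \<open>
  An implicit function argument that uses monotonicity in the unknown instead of derivatives.
\<close>

lemma renewal_root_continuous_on:
  fixes a :: "nat \<Rightarrow> real \<Rightarrow> real" and x :: "real \<Rightarrow> real"
  assumes cont: "\<And>n. continuous_on J (a n)"
    and a: "\<And>n \<gamma>. \<gamma> \<in> J \<Longrightarrow> 0 < a n \<gamma>" "\<And>n \<gamma>. \<gamma> \<in> J \<Longrightarrow> a n \<gamma> \<le> 1"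
    and \<kappa>: "0 < \<kappa>" and x: "\<And>\<gamma>. \<gamma> \<in> J \<Longrightarrow> 0 < x \<gamma>" "\<And>\<gamma>. \<gamma> \<in> J \<Longrightarrow> x \<gamma> < 1"
    and root: "\<And>\<gamma>. \<gamma> \<in> J \<Longrightarrow> \<kappa> * (x \<gamma> * (\<Sum>n. a n \<gamma> * x \<gamma> ^ n)) = 1"
  shows "continuous_on J x"
  unfolding continuous_on_def
proof
  fix \<gamma>0 assume \<gamma>0: "\<gamma>0 \<in> J"
  define F where "F \<gamma> y = \<kappa> * (y * (\<Sum>n. a n \<gamma> * y ^ n))" for \<gamma> y
  have less: "F \<gamma> y < F \<gamma> z" if "\<gamma> \<in> J" "0 \<le> y" "y < z" "z < 1" for \<gamma> y z
    unfolding F_def using that a \<kappa> less_imp_le[OF a(1)]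
    by (intro mult_strict_left_mono bounded_powser_less) auto
  have F_root: "F \<gamma> (x \<gamma>) = 1" if "\<gamma> \<in> J" for \<gamma>
    using root[OF that] by (simp add: F_def)
  have F_lim: "((\<lambda>\<gamma>. F \<gamma> y) \<longlongrightarrow> F \<gamma>0 y) (at \<gamma>0 within J)" if "0 < y" "y < 1" for y
  proof -
    have "continuous_on J (\<lambda>\<gamma>. \<Sum>n. a n \<gamma> * y ^ n)"
      using a less_imp_le[OF a(1)] that by (intro powser_family_continuous_on cont) (auto simp: abs_le_iff intro: order.trans[OF _ less_imp_le])
    then have "continuous_on J (\<lambda>\<gamma>. F \<gamma> y)"
      unfolding F_def by (intro continuous_intros)
    then show ?thesis using \<gamma>0 by (auto simp: continuous_on_def)
  qed
  have inJ: "eventually (\<lambda>\<gamma>. \<gamma> \<in> J) (at \<gamma>0 within J)"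
    by (simp add: eventually_at_filter)
  show "(x \<longlongrightarrow> x \<gamma>0) (at \<gamma>0 within J)"
  proof (rule order_tendstoI)
    fix y assume y: "y < x \<gamma>0"
    show "eventually (\<lambda>\<gamma>. y < x \<gamma>) (at \<gamma>0 within J)"
    proof (cases "0 < y")
      case True
      have "F \<gamma>0 y < 1" using less[OF \<gamma>0, of y "x \<gamma>0"] y x[OF \<gamma>0] True F_root[OF \<gamma>0] by simp
      then have "eventually (\<lambda>\<gamma>. F \<gamma> y < 1) (at \<gamma>0 within J)"
        using F_lim[of y] True y x[OF \<gamma>0] by (intro order_tendstoD(2)) auto
      then show ?thesis using inJ
      proof eventually_elim
        case (elim \<gamma>)
        show ?case
        proof (rule ccontr)
          assume "\<not> y < x \<gamma>"
          then have "F \<gamma> (x \<gamma>) \<le> F \<gamma> y"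
            using less[of \<gamma> "x \<gamma>" y] elim x[of \<gamma>] y x(2)[OF \<gamma>0] by (cases "x \<gamma> = y") auto
          then show False using F_root elim by simp
        qed
      qed
    next
      case False
      show ?thesis using inJ by eventually_elim (use x False in \<open>meson not_le order.strict_trans2 order_less_le_trans\<close>)
    qed
  next
    fix y' assume y': "x \<gamma>0 < y'"
    \<comment> \<open>a point below \<open>y'\<close> at which the power series still converges\<close>
    define y where "y = (x \<gamma>0 + min y' 1) / 2"
    have y: "x \<gamma>0 < y" "y < 1" "y \<le> y'" "0 < y"
      using x[OF \<gamma>0] y' by (auto simp: y_def min_def)
    have "1 < F \<gamma>0 y" using less[OF \<gamma>0, of "x \<gamma>0" y] y x[OF \<gamma>0] F_root[OF \<gamma>0] by simp
    then have "eventually (\<lambda>\<gamma>. 1 < F \<gamma> y) (at \<gamma>0 within J)"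
      using F_lim[of y] y by (intro order_tendstoD(1)) auto
    then show "eventually (\<lambda>\<gamma>. x \<gamma> < y') (at \<gamma>0 within J)" using inJ
    proof eventually_elim
      case (elim \<gamma>)
      have "x \<gamma> < y"
      proof (rule ccontr)
        assume "\<not> x \<gamma> < y"
        then have "F \<gamma> y \<le> F \<gamma> (x \<gamma>)"
          using less[of \<gamma> y "x \<gamma>"] elim x[of \<gamma>] y by (cases "x \<gamma> = y") auto
        then show False using F_root elim by simp
      qed
      then show ?case using y by simp
    qed
  qed
qed

lemma down_closed_open_eq_interval:
  fixes J :: "real set"
  assumes J: "open J" "J \<subseteq> {0<..}" "J \<noteq> {}"
    and down: "\<And>\<gamma> \<delta>. \<gamma> \<in> J \<Longrightarrow> 0 < \<delta> \<Longrightarrow> \<delta> \<le> \<gamma> \<Longrightarrow> \<delta> \<in> J"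
  shows "\<exists>\<gamma>\<^sub>1::ereal. 0 < \<gamma>\<^sub>1 \<and> J = {\<gamma>. 0 < \<gamma> \<and> ereal \<gamma> < \<gamma>\<^sub>1}"
proof (intro exI conjI)
  let ?s = "Sup (ereal ` J)"
  obtain \<gamma> where "\<gamma> \<in> J" using J by auto
  then show "0 < ?s" using J by (auto simp: less_Sup_iff intro!: bexI[of _ \<gamma>])
  show "J = {\<gamma>. 0 < \<gamma> \<and> ereal \<gamma> < ?s}"
  proof (intro equalityI subsetI CollectI conjI)
    fix \<gamma> assume \<gamma>: "\<gamma> \<in> J"
    then show "0 < \<gamma>" using J by auto
    obtain e where e: "0 < e" "cball \<gamma> e \<subseteq> J" using J(1) \<gamma> open_contains_cball by blast
    then have "\<gamma> + e \<in> J" by (auto simp: subset_iff dist_real_def)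
    then show "ereal \<gamma> < ?s" using e by (auto simp: less_Sup_iff intro!: bexI[of _ "\<gamma> + e"])
  next
    fix \<gamma> assume "\<gamma> \<in> {\<gamma>. 0 < \<gamma> \<and> ereal \<gamma> < ?s}"
    then show "\<gamma> \<in> J" by (auto simp: less_Sup_iff intro: down)
  qed
qed

text \<open>
  On the level of generating functions the two equations read \<open>E = a + c * a * E\<close> and
  \<open>G = u + c * u * E\<close>, so \<open>G = u / (1 - c * a)\<close>. Finiteness is obtained from the bound
  \<open>E\<^sub>n \<le> a + c * a * E\<^sub>n\<close> for the partial sums \<open>E\<^sub>n\<close>.
\<close>

lemma renewal_series:
  fixes a u e g :: "nat \<Rightarrow> real"
  assumes a: "\<And>n. 0 \<le> a n" "0 < a 0" "summable a" and u: "\<And>n. 0 \<le> u n" "0 < u 0" "summable u"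
    and c: "0 < c"
    and e_nonneg: "\<And>n. 0 \<le> e n"
    and e: "\<And>n. e n = a n + c * (\<Sum>k<n. a k * e (n - 1 - k))"
    and g: "\<And>n. g n = u n + c * (\<Sum>k<n. u k * e (n - 1 - k))"
  shows "summable g \<longleftrightarrow> c * suminf a < 1"
    and "c * suminf a < 1 \<Longrightarrow> suminf g = suminf u / (1 - c * suminf a)"
proof -
  have sum: "(\<lambda>n. v n + c * (\<Sum>k<n. v k * e (n - 1 - k))) sums (suminf v + c * (suminf v * suminf e))"
    if v: "\<And>n. 0 \<le> v n" "summable v" "summable e" for v :: "nat \<Rightarrow> real"
  proof -
    have "(\<lambda>n. \<Sum>k\<le>n. v k * e (n - k)) sums (suminf v * suminf e)"
      using v e_nonneg by (intro Cauchy_product_sums) simp_all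
    then have "(\<lambda>n. \<Sum>k<Suc n. v k * e (Suc n - 1 - k)) sums (suminf v * suminf e)"
      by (simp add: lessThan_Suc_atMost)
    then have "(\<lambda>n. \<Sum>k<n. v k * e (n - 1 - k)) sums (suminf v * suminf e + 0)"
      using sums_Suc[of "\<lambda>n. \<Sum>k<n. v k * e (n - 1 - k)"] by simp
    then show ?thesis
      using v by (intro sums_add sums_mult summable_sums) auto
  qed
  have a_pos: "0 < suminf a"
    using sum_le_suminf[OF a(3), of "{0}"] a by auto
  have e_eq: "suminf e = suminf a + c * (suminf a * suminf e)" if "summable e"
  proof -
    have "e = (\<lambda>n. a n + c * (\<Sum>k<n. a k * e (n - 1 - k)))" using e by (rule ext)
    then show ?thesis using sum[OF a(1,3) that] sums_unique by metis
  qed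
  have e1: "c * suminf a < 1" if "summable e"
  proof -
    have "suminf e * (1 - c * suminf a) = suminf a"
      using e_eq[OF that] by (simp add: algebra_simps)
    moreover have "0 \<le> suminf e" by (intro suminf_nonneg that e_nonneg)
    ultimately show ?thesis using a_pos by (metis diff_gt_0_iff_gt zero_less_mult_pos not_less_iff_gr_or_eq
      mult_zero_left order_le_imp_less_or_eq)
  qed
  have e2: "summable e" if lt: "c * suminf a < 1"
  proof (rule summableI_nonneg_bounded[OF e_nonneg])
    fix n
    define E where "E = (\<Sum>i<n. e i)"
    have inner: "(\<Sum>k<i. a k * e (i - 1 - k)) = (\<Sum>k<n. if k < i then a k * e (i - 1 - k) else 0)" if "i < n" for i
      using that by (intro sum.mono_neutral_cong_left) auto
    have shift: "(\<Sum>i<n. if k < i then e (i - 1 - k) else 0) \<le> E" for k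
    proof -
      have "(\<Sum>i<n. if k < i then e (i - 1 - k) else 0) = (\<Sum>i\<in>{Suc k..<n}. e (i - 1 - k))"
        by (intro sum.mono_neutral_cong_right) auto
      also have "\<dots> = (\<Sum>j<n - Suc k. e j)"
        by (rule sum.reindex_bij_witness[of _ "\<lambda>j. j + Suc k" "\<lambda>i. i - 1 - k"]) auto
      also have "\<dots> \<le> E" unfolding E_def using e_nonneg by (intro sum_mono2) auto
      finally show ?thesis .
    qed
    have "E = (\<Sum>i<n. a i + c * (\<Sum>k<n. if k < i then a k * e (i - 1 - k) else 0))"
      unfolding E_def
    proof (rule sum.cong)
      show "e i = a i + c * (\<Sum>k<n. if k < i then a k * e (i - 1 - k) else 0)" if "i \<in> {..<n}" for i
        using e[of i] inner[of i] that by simp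
    qed simp
    also have "\<dots> = (\<Sum>i<n. a i) + c * (\<Sum>i<n. \<Sum>k<n. if k < i then a k * e (i - 1 - k) else 0)"
      by (simp only: sum.distrib sum_distrib_left)
    also have "(\<Sum>i<n. \<Sum>k<n. if k < i then a k * e (i - 1 - k) else 0)
        = (\<Sum>k<n. a k * (\<Sum>i<n. if k < i then e (i - 1 - k) else 0))"
      by (subst sum.swap) (simp add: sum_distrib_left if_distrib cong: if_cong)
    also have "(\<Sum>i<n. a i) + c * \<dots> \<le> suminf a + c * (\<Sum>k<n. a k * E)"
      using a c shift by (intro add_mono mult_left_mono sum_mono sum_le_suminf) auto
    also have "(\<Sum>k<n. a k * E) \<le> suminf a * E"
      unfolding sum_distrib_right[symmetric] E_def
      using a e_nonneg by (intro mult_right_mono sum_le_suminf sum_nonneg) auto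
    then have "suminf a + c * (\<Sum>k<n. a k * E) \<le> suminf a + c * (suminf a * E)"
      using c by simp
    finally have "E * (1 - c * suminf a) \<le> suminf a" by (simp add: algebra_simps)
    then show "E \<le> suminf a / (1 - c * suminf a)"
      using lt by (simp add: pos_le_divide_eq)
  qed
  show "summable g \<longleftrightarrow> c * suminf a < 1"
  proof
    assume "summable g"
    then have "summable (\<lambda>n. g (Suc n) / (c * u 0))"
      by (intro summable_divide) (simp add: summable_Suc_iff)
    moreover have "norm (e n) \<le> g (Suc n) / (c * u 0)" for n
    proof -
      have "u 0 * e n \<le> (\<Sum>k<Suc n. u k * e (Suc n - 1 - k))"
        using u e_nonneg member_le_sum[of 0 "{..<Suc n}" "\<lambda>k. u k * e (Suc n - 1 - k)"] by simp
      then have "c * (u 0 * e n) \<le> c * (\<Sum>k<Suc n. u k * e (Suc n - 1 - k))"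
        using c by (intro mult_left_mono) auto
      also have "\<dots> \<le> g (Suc n)" using g[of "Suc n"] u(1)[of "Suc n"] by simp
      finally show ?thesis using c u e_nonneg[of n] by (simp add: pos_le_divide_eq mult_ac)
    qed
    ultimately have "summable e" by (rule summable_comparison_test'[where N = 0])
    then show "c * suminf a < 1" by (rule e1)
  next
    assume "c * suminf a < 1"
    then have "summable e" by (rule e2)
    from sums_summable[OF sum[OF u(1,3) this]] show "summable g"
      using g by (metis (no_types, lifting) ext)
  qed
  show "suminf g = suminf u / (1 - c * suminf a)" if lt: "c * suminf a < 1"
  proof -
    have s: "summable e" using lt by (rule e2)
    have "suminf e * (1 - c * suminf a) = suminf a"
      using e_eq[OF s] by (simp add: algebra_simps)
    then have E: "suminf e = suminf a / (1 - c * suminf a)" using lt by (simp add: field_simps)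
    have "g = (\<lambda>n. u n + c * (\<Sum>k<n. u k * e (n - 1 - k)))" using g by (rule ext)
    then have "suminf g = suminf u + c * (suminf u * suminf e)"
      using sums_unique[OF sum[OF u(1,3) s]] by simp
    also have "\<dots> = suminf u / (1 - c * suminf a)"
      unfolding E using lt by (simp add: field_simps)
    finally show ?thesis .
  qed
qed

lemma mono_tendsto_at_right:
  fixes m :: "real \<Rightarrow> real"
  assumes mono: "\<And>s t. \<nu> < s \<Longrightarrow> s \<le> t \<Longrightarrow> m s \<le> m t" and nonneg: "\<And>s. \<nu> < s \<Longrightarrow> 0 \<le> m s"
  shows "\<exists>l\<ge>0. (m \<longlongrightarrow> l) (at_right \<nu>)"
proof (intro exI conjI)
  let ?l = "INF s\<in>{\<nu><..}. m s"
  have bdd: "bdd_below (m ` {\<nu><..})" using nonneg by (intro bdd_belowI[of _ 0]) auto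
  show "0 \<le> ?l" using nonneg by (intro cINF_greatest) auto
  show "(m \<longlongrightarrow> ?l) (at_right \<nu>)"
  proof (rule order_tendstoI)
    fix y assume y: "y < ?l"
    show "eventually (\<lambda>s. y < m s) (at_right \<nu>)"
      unfolding eventually_at_filter
      by (intro always_eventually) (use y cINF_lower[OF bdd] in \<open>auto intro: order.strict_trans2\<close>)
  next
    fix y assume "?l < y"
    then obtain t where t: "\<nu> < t" "m t < y" by (auto simp: cINF_less_iff[OF _ bdd])
    have "eventually (\<lambda>s. s \<in> {\<nu><..<t}) (at_right \<nu>)" using t(1) by (rule eventually_at_right_real)
    then show "eventually (\<lambda>s. m s < y) (at_right \<nu>)"
      by eventually_elim (use mono t in \<open>auto intro: order.strict_trans1[OF _ t(2)]\<close>)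
  qed
qed

text \<open>
  By convexity the slope of the chord from \<open>\<nu>\<close> to \<open>\<gamma>\<close> increases with \<open>\<gamma>\<close>. It is negative, so its
  negated reciprocal is monotone and nonnegative.
\<close>

lemma convex_crossing_slope:
  fixes \<phi> :: "real \<Rightarrow> real"
  assumes conv: "convex_on {0..} \<phi>" and \<nu>: "0 \<le> \<nu>" "\<phi> \<nu> = 1"
    and lt: "\<And>\<gamma>. \<nu> < \<gamma> \<Longrightarrow> \<phi> \<gamma> < 1"
  shows "\<exists>l\<ge>0. ((\<lambda>\<gamma>. (\<gamma> - \<nu>) / (1 - \<phi> \<gamma>)) \<longlongrightarrow> l) (at_right \<nu>)"
proof (rule mono_tendsto_at_right)
  fix s t assume st: "\<nu> < s" "s \<le> t"
  define r where "r = (s - \<nu>) / (t - \<nu>)"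
  have r: "0 \<le> r" "r \<le> 1" "r * (t - \<nu>) = s - \<nu>" using st by (auto simp: r_def field_simps)
  have "\<phi> ((1 - r) *\<^sub>R \<nu> + r *\<^sub>R t) \<le> (1 - r) * \<phi> \<nu> + r * \<phi> t"
    using st \<nu> r by (intro convex_onD[OF conv]) auto
  moreover have "(1 - r) *\<^sub>R \<nu> + r *\<^sub>R t = s" using r(3) by (simp add: algebra_simps)
  ultimately have "r * (1 - \<phi> t) \<le> 1 - \<phi> s" using \<nu> by (simp add: algebra_simps)
  then have "(t - \<nu>) * (r * (1 - \<phi> t)) \<le> (t - \<nu>) * (1 - \<phi> s)"
    using st by (intro mult_left_mono) auto
  also have "(t - \<nu>) * (r * (1 - \<phi> t)) = (s - \<nu>) * (1 - \<phi> t)" using r(3) by (simp add: mult_ac)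
  finally show "(s - \<nu>) / (1 - \<phi> s) \<le> (t - \<nu>) / (1 - \<phi> t)"
    using lt[of s] lt[of t] st by (simp add: divide_simps mult.commute)
qed (use lt in \<open>auto simp: less_imp_le\<close>)


section \<open>Multiplicative ergodicity\<close>

lemma prob_with_Lp_density_imp_prob:
  assumes "prob_with_Lp_density p \<pi> \<mu>" "sets \<pi> = sets borel"
  shows "prob_space \<mu>" "sets \<mu> = sets borel"
  using assms by (auto simp: prob_with_Lp_density_def)

context stationary_mixture
begin

text \<open>
  Partial sums are used because the series may diverge.
\<close>

definition "supercritical = {\<gamma>. 0 < \<gamma> \<and> (\<exists>N. 1 < \<alpha> / (1 - \<alpha>) * (\<Sum>n<N. A \<gamma> n))}"

lemma A_continuous_on: "continuous_on {0..} (\<lambda>\<gamma>. A \<gamma> n)"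
  by (rule laplace_Y_continuous_on[OF prob_pi sets_pi U \<xi> \<xi>_nonneg])

lemma A_antimono: "0 \<le> \<gamma> \<Longrightarrow> \<gamma> \<le> \<delta> \<Longrightarrow> A \<delta> n \<le> A \<gamma> n"
  by (rule laplace_Y_antimono[OF prob_pi sets_pi U \<xi> \<xi>_nonneg])

lemma A_0: "A 0 n = 1"
  by (rule laplace_Y_0[OF prob_pi sets_pi U \<xi> \<xi>_nonneg])

lemma supercritical_interval: "\<exists>\<gamma>\<^sub>1::ereal. 0 < \<gamma>\<^sub>1 \<and> supercritical = {\<gamma>. 0 < \<gamma> \<and> ereal \<gamma> < \<gamma>\<^sub>1}"
  and supercritical_open: "open supercritical"
proof -
  let ?f = "\<lambda>N \<gamma>. \<alpha> / (1 - \<alpha>) * (\<Sum>n<N. A \<gamma> n)"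
  have cont: "continuous_on {0..} (?f N)" for N
    by (intro continuous_intros A_continuous_on)
  have "open ({0<..} \<inter> ?f N -` {1<..})" for N
    by (intro continuous_open_preimage continuous_on_subset[OF cont]) auto
  then have "open (\<Union>N. {0<..} \<inter> ?f N -` {1<..})" by blast
  moreover have "(\<Union>N. {0<..} \<inter> ?f N -` {1<..}) = supercritical" by (auto simp: supercritical_def)
  ultimately show op: "open supercritical" by simp
  obtain N :: nat where N: "1 / (\<alpha> / (1 - \<alpha>)) < real N" using reals_Archimedean2 by blast
  then have N: "1 < ?f N 0" using alpha by (simp add: A_0 field_simps)
  have "(?f N \<longlongrightarrow> ?f N 0) (at 0 within {0..})" using cont by (auto simp: continuous_on_def)
  then have "eventually (\<lambda>\<gamma>. 1 < ?f N \<gamma>) (at 0 within {0..})" using N by (rule order_tendstoD)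
  then have "eventually (\<lambda>\<gamma>. 1 < ?f N \<gamma>) (at_right 0)"
    by (rule eventually_at_filter[THEN iffD1, THEN eventually_mono, THEN eventually_at_filter[THEN iffD2]]) auto
  moreover have "eventually (\<lambda>\<gamma>::real. 0 < \<gamma>) (at_right 0)" by (rule eventually_at_right_less)
  ultimately have "eventually (\<lambda>\<gamma>. 0 < \<gamma> \<and> 1 < ?f N \<gamma>) (at_right 0)" by eventually_elim simp
  then have "\<exists>\<gamma>. 0 < \<gamma> \<and> 1 < ?f N \<gamma>" by (rule eventually_happens'[rotated]) simp
  then have ne: "supercritical \<noteq> {}" by (auto simp: supercritical_def)
  show "\<exists>\<gamma>\<^sub>1::ereal. 0 < \<gamma>\<^sub>1 \<and> supercritical = {\<gamma>. 0 < \<gamma> \<and> ereal \<gamma> < \<gamma>\<^sub>1}"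
  proof (rule down_closed_open_eq_interval[OF op _ ne])
    fix \<gamma> \<delta> assume \<gamma>: "\<gamma> \<in> supercritical" and \<delta>: "0 < \<delta>" "\<delta> \<le> \<gamma>"
    then obtain N where "1 < ?f N \<gamma>" by (auto simp: supercritical_def)
    also have "?f N \<gamma> \<le> ?f N \<delta>"
      using alpha \<delta> by (intro mult_left_mono sum_mono A_antimono) auto
    finally show "\<delta> \<in> supercritical" using \<delta> by (auto simp: supercritical_def)
  qed (auto simp: supercritical_def)
qed

lemma multiplicatively_ergodic_supercritical:
  assumes \<mu>: "prob_space \<mu>" "sets \<mu> = sets borel"
  shows "multiplicatively_ergodic (laplace_Y \<mu> P \<xi>) supercritical"
proof -
  define b where "b = 1 - \<alpha>"
  define \<kappa> where "\<kappa> = \<alpha> / b"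
  have b: "0 < b" and \<kappa>: "0 < \<kappa>" "\<kappa> * b = \<alpha>" using alpha by (auto simp: b_def \<kappa>_def)
  let ?J = supercritical
  have "\<exists>x. 0 < x \<and> x < 1 \<and> \<kappa> * (x * (\<Sum>n. A \<gamma> n * x ^ n)) = 1" if "\<gamma> \<in> ?J" for \<gamma>
  proof -
    have \<gamma>: "0 \<le> \<gamma>" using that by (auto simp: supercritical_def)
    from that obtain N where "1 < \<kappa> * (\<Sum>n<N. A \<gamma> n)" by (auto simp: \<kappa>_def b_def supercritical_def)
    from renewal_root_exists[OF less_imp_le[OF A_bounds(1)[OF \<gamma>]] A_bounds(2)[OF \<gamma>] A_bounds(1)[OF \<gamma>] \<kappa>(1) this]
    show ?thesis .
  qed
  then obtain x where x: "\<And>\<gamma>. \<gamma> \<in> ?J \<Longrightarrow> 0 < x \<gamma>" "\<And>\<gamma>. \<gamma> \<in> ?J \<Longrightarrow> x \<gamma> < 1"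
      "\<And>\<gamma>. \<gamma> \<in> ?J \<Longrightarrow> \<kappa> * (x \<gamma> * (\<Sum>n. A \<gamma> n * x \<gamma> ^ n)) = 1"
    by metis
  have sub: "?J \<subseteq> {0..}" by (auto simp: supercritical_def)
  have bounds: "0 < A \<gamma> n" "A \<gamma> n \<le> 1" if "\<gamma> \<in> ?J" for \<gamma> n using A_bounds that sub by auto
  have cA: "continuous_on ?J (\<lambda>\<gamma>. A \<gamma> n)" for n
    by (rule continuous_on_subset[OF A_continuous_on sub])
  have cx: "continuous_on ?J x"
    by (rule renewal_root_continuous_on[OF cA _ _ \<kappa>(1) x]) (use bounds in auto)
  have W: "renewal_weights \<kappa> (x \<gamma>) (A \<gamma>)" if "\<gamma> \<in> ?J" for \<gamma>
    by (rule renewal_weights.intro) (use \<kappa> x bounds less_imp_le[OF bounds(1)] that in auto)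
  have h: "0 < laplace_Y \<mu> U \<xi> n \<gamma>" "laplace_Y \<mu> U \<xi> n \<gamma> \<le> 1" if "\<gamma> \<in> ?J" for \<gamma> n
    using laplace_Y_pos[OF \<mu> U \<xi> \<xi>_nonneg] laplace_Y_le_1[OF \<mu> U \<xi> \<xi>_nonneg] that sub by auto
  have ch: "continuous_on ?J (\<lambda>\<gamma>. laplace_Y \<mu> U \<xi> n \<gamma>)" for n
    by (rule continuous_on_subset[OF laplace_Y_continuous_on[OF \<mu> U \<xi> \<xi>_nonneg] sub])
  have ren: "laplace_Y \<nu> P \<xi> n \<gamma> = b ^ n * laplace_Y \<nu> U \<xi> n \<gamma> +
     (\<Sum>k<n. \<kappa> * b * b ^ k * laplace_Y \<nu> U \<xi> k \<gamma> * laplace_Y \<pi> P \<xi> (n - 1 - k) \<gamma>)"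
    if "\<gamma> \<in> ?J" "prob_space \<nu>" "sets \<nu> = sets borel" for \<nu> n \<gamma>
    using laplace_Y_renewal[OF that(2,3) \<xi> \<xi>_nonneg, of \<gamma> n] that(1) sub
    unfolding \<kappa>(2) by (auto simp: b_def)
  have "\<exists>B. continuous_on ?J B \<and> (\<forall>\<gamma>\<in>?J. 0 < B \<gamma>) \<and>
    (\<forall>K. compact K \<and> K \<subseteq> ?J \<longrightarrow> (\<exists>M \<theta>. 0 < M \<and> 0 < \<theta> \<and> \<theta> < 1 \<and>
       (\<forall>\<gamma>\<in>K. \<forall>n. \<bar>laplace_Y \<mu> P \<xi> n \<gamma> - B \<gamma> * (b / x \<gamma>) ^ n\<bar> \<le> M * (b / x \<gamma> * \<theta>) ^ n)))"
    by (rule renewal_theorem_uniform[where J = ?J and b = b and \<kappa> = \<kappa> and x = x and a = A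
          and h = "\<lambda>\<gamma> n. laplace_Y \<mu> U \<xi> n \<gamma>" and L = "\<lambda>\<gamma> n. laplace_Y \<mu> P \<xi> n \<gamma>"
          and l = "\<lambda>\<gamma> n. laplace_Y \<pi> P \<xi> n \<gamma>",
          OF supercritical_open b W less_imp_le[OF h(1)] h(2) h(1) cx cA ch ren[OF _ \<mu>] ren[OF _ prob_pi sets_pi]])
  then obtain B where B: "continuous_on ?J B" "\<forall>\<gamma>\<in>?J. 0 < B \<gamma>"
    "\<forall>K. compact K \<and> K \<subseteq> ?J \<longrightarrow> (\<exists>M \<theta>. 0 < M \<and> 0 < \<theta> \<and> \<theta> < 1 \<and>
       (\<forall>\<gamma>\<in>K. \<forall>n. \<bar>laplace_Y \<mu> P \<xi> n \<gamma> - B \<gamma> * (b / x \<gamma>) ^ n\<bar> \<le> M * (b / x \<gamma> * \<theta>) ^ n))"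
    by (elim exE conjE) (rule that)
  obtain \<gamma>\<^sub>1 :: ereal where \<gamma>1: "0 < \<gamma>\<^sub>1" "?J = {\<gamma>. 0 < \<gamma> \<and> ereal \<gamma> < \<gamma>\<^sub>1}"
    using supercritical_interval by blast
  have "continuous_on ?J (\<lambda>\<gamma>. b / x \<gamma>)"
    using x(1) by (intro continuous_intros cx) force
  moreover have "\<forall>\<gamma>\<in>?J. 0 < B \<gamma> \<and> 0 < b / x \<gamma>" using x(1) B(2) b by simp
  moreover have "\<forall>K. compact K \<and> K \<subseteq> {\<gamma>. 0 < \<gamma> \<and> ereal \<gamma> < \<gamma>\<^sub>1} \<longrightarrow>
      (\<exists>M \<theta>. 0 < M \<and> 0 < \<theta> \<and> \<theta> < 1 \<and>
        (\<forall>\<gamma>\<in>K. \<forall>n\<ge>1. \<bar>laplace_Y \<mu> P \<xi> n \<gamma> - B \<gamma> * (b / x \<gamma>) ^ n\<bar> \<le> M * (b / x \<gamma> * \<theta>) ^ n))"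
  proof (intro allI impI)
    fix K assume "compact K \<and> K \<subseteq> {\<gamma>. 0 < \<gamma> \<and> ereal \<gamma> < \<gamma>\<^sub>1}"
    then have "compact K \<and> K \<subseteq> ?J" unfolding \<gamma>1(2) .
    from B(3)[rule_format, OF this] obtain M \<theta> where "0 < M" "0 < \<theta>" "\<theta> < 1"
      "\<forall>\<gamma>\<in>K. \<forall>n. \<bar>laplace_Y \<mu> P \<xi> n \<gamma> - B \<gamma> * (b / x \<gamma>) ^ n\<bar> \<le> M * (b / x \<gamma> * \<theta>) ^ n"
      by (elim exE conjE) (rule that)
    then show "\<exists>M \<theta>. 0 < M \<and> 0 < \<theta> \<and> \<theta> < 1 \<and>
        (\<forall>\<gamma>\<in>K. \<forall>n\<ge>1. \<bar>laplace_Y \<mu> P \<xi> n \<gamma> - B \<gamma> * (b / x \<gamma>) ^ n\<bar> \<le> M * (b / x \<gamma> * \<theta>) ^ n)"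
      by (intro exI[of _ M] exI[of _ \<theta>]) simp
  qed
  ultimately show ?thesis
    unfolding multiplicatively_ergodic_def using \<gamma>1 B(1)
    by (intro exI[of _ \<gamma>\<^sub>1] conjI disjI2)
       (assumption | rule exI[of _ B, OF exI[of _ "\<lambda>\<gamma>. b / x \<gamma>"]] | rule conjI)+
qed

end


section \<open>The generating function at 2\<close>

locale half_mixture = stationary_mixture +
  assumes half: "1 / 2 < \<alpha>"
begin

definition \<beta> :: real where "\<beta> = 2 * (1 - \<alpha>)"

text \<open>
  The generating function of the regeneration times, weighted by \<open>exp (- \<gamma> * S)\<close>, at the point \<open>2\<close>.
\<close>

definition \<phi> :: "real \<Rightarrow> real" where
  "\<phi> \<gamma> = 2 * \<alpha> * (\<Sum>n. A \<gamma> n * \<beta> ^ n)"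

lemma \<beta>: "0 < \<beta>" "\<beta> < 1" "\<bar>\<beta>\<bar> < 1"
  using half alpha by (auto simp: \<beta>_def)

lemma laplace_powser_summable:
  assumes "prob_space \<mu>" "sets \<mu> = sets borel" "0 \<le> \<gamma>"
  shows "summable (\<lambda>n. laplace_Y \<mu> U \<xi> n \<gamma> * \<beta> ^ n)"
  using laplace_Y_pos[OF assms(1,2) U \<xi> \<xi>_nonneg assms(3)] laplace_Y_le_1[OF assms(1,2) U \<xi> \<xi>_nonneg assms(3)]
  by (intro bounded_powser_summable \<beta>) (auto simp: less_imp_le)

lemma laplace_powser_continuous_on:
  assumes \<mu>: "prob_space \<mu>" "sets \<mu> = sets borel"
  shows "continuous_on {0..} (\<lambda>\<gamma>. \<Sum>n. laplace_Y \<mu> U \<xi> n \<gamma> * \<beta> ^ n)"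
proof (rule powser_family_continuous_on[OF laplace_Y_continuous_on[OF \<mu> U \<xi> \<xi>_nonneg] _ \<beta>(3)])
  show "\<bar>laplace_Y \<mu> U \<xi> n \<gamma>\<bar> \<le> 1" if "\<gamma> \<in> {0..}" for n \<gamma>
    using laplace_Y_pos[OF \<mu> U \<xi> \<xi>_nonneg, of \<gamma> n] laplace_Y_le_1[OF \<mu> U \<xi> \<xi>_nonneg, of \<gamma> n] that by simp
qed

lemma \<phi>_continuous_on: "continuous_on {0..} \<phi>"
  unfolding \<phi>_def by (intro continuous_intros laplace_powser_continuous_on prob_pi sets_pi)

lemma \<phi>_antimono: "0 \<le> \<gamma> \<Longrightarrow> \<gamma> \<le> \<delta> \<Longrightarrow> \<phi> \<delta> \<le> \<phi> \<gamma>"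
  unfolding \<phi>_def using alpha \<beta>
  by (intro mult_left_mono suminf_le mult_right_mono A_antimono laplace_powser_summable prob_pi sets_pi) auto

lemma \<phi>_convex_on: "convex_on {0..} \<phi>"
proof (rule convex_onI)
  fix t x y :: real assume t: "0 < t" "t < 1" and xy: "x \<in> {0..}" "y \<in> {0..}"
  let ?z = "(1 - t) *\<^sub>R x + t *\<^sub>R y"
  have z: "0 \<le> ?z" using t xy by simp
  note s = laplace_powser_summable[OF prob_pi sets_pi]
  have "(\<Sum>n. A ?z n * \<beta> ^ n) \<le> (\<Sum>n. (1 - t) * (A x n * \<beta> ^ n) + t * (A y n * \<beta> ^ n))"
  proof (intro suminf_le s z summable_add summable_mult)
    fix n
    have "A ?z n \<le> (1 - t) * A x n + t * A y n"
      using convex_onD[OF laplace_Y_convex_on[OF prob_pi sets_pi U \<xi> \<xi>_nonneg], of t x y n] t xy by simp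
    then have "A ?z n * \<beta> ^ n \<le> ((1 - t) * A x n + t * A y n) * \<beta> ^ n"
      using \<beta> by (intro mult_right_mono) auto
    then show "A ?z n * \<beta> ^ n \<le> (1 - t) * (A x n * \<beta> ^ n) + t * (A y n * \<beta> ^ n)"
      by (simp add: algebra_simps)
  qed (use xy in auto)
  also have "\<dots> = (1 - t) * (\<Sum>n. A x n * \<beta> ^ n) + t * (\<Sum>n. A y n * \<beta> ^ n)"
    using xy by (intro sums_unique[symmetric] sums_add sums_mult summable_sums s) auto
  finally have "2 * \<alpha> * (\<Sum>n. A ?z n * \<beta> ^ n)
      \<le> 2 * \<alpha> * ((1 - t) * (\<Sum>n. A x n * \<beta> ^ n) + t * (\<Sum>n. A y n * \<beta> ^ n))"
    using alpha by (intro mult_left_mono) auto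
  then show "\<phi> ?z \<le> (1 - t) * \<phi> x + t * \<phi> y"
    by (simp add: \<phi>_def algebra_simps)
qed simp

lemma \<phi>_0: "1 < \<phi> 0"
proof -
  have "(\<Sum>n. A 0 n * \<beta> ^ n) = 1 / (1 - \<beta>)"
    using \<beta> suminf_geometric[of \<beta>] by (simp add: A_0)
  then have "\<phi> 0 = 2 * \<alpha> / (2 * \<alpha> - 1)" by (simp add: \<phi>_def \<beta>_def)
  then show ?thesis using half alpha by (simp add: less_divide_eq)
qed

lemma \<phi>_tendsto_at_top:
  "(\<phi> \<longlongrightarrow> 2 * \<alpha> * (\<Sum>n. (2 * (1 - \<alpha>)) ^ n * measure (chain_law \<pi> U)
       {\<omega> \<in> space (chain_law \<pi> U). additive_functional \<xi> n \<omega> = 0})) at_top"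
proof -
  have "eventually (\<lambda>\<gamma>::real. 0 \<le> \<gamma>) at_top" by (rule eventually_ge_at_top)
  then have ev: "eventually (\<lambda>\<gamma>. \<forall>n. \<bar>A \<gamma> n\<bar> \<le> 1) at_top"
  proof eventually_elim
    case (elim \<gamma>)
    then show ?case using less_imp_le[OF A_bounds(1)] A_bounds(2) by auto
  qed
  show ?thesis
    unfolding \<phi>_def[abs_def] \<beta>_def[symmetric]
    using powser_family_tendsto[OF laplace_Y_tendsto_at_top[OF prob_pi sets_pi U \<xi> \<xi>_nonneg] ev \<beta>(3)]
    by (intro tendsto_intros) (simp add: mult.commute)
qed

text \<open>
  The factor \<open>2 * \<alpha>\<close> is \<open>z * \<alpha>\<close> at \<open>z = 2\<close>, and \<open>\<beta> = z * (1 - \<alpha>)\<close>; finiteness is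
  decided by \<open>\<phi>\<close>, which belongs to the chain started from \<open>\<pi>\<close>, since the first restart forgets \<open>\<mu>\<close>.
\<close>

lemma gen_Y_at_2:
  assumes \<mu>: "prob_space \<mu>" "sets \<mu> = sets borel" and \<gamma>: "0 \<le> \<gamma>"
  shows "gen_Y \<mu> P \<xi> \<gamma> 2 < \<infinity> \<longleftrightarrow> \<phi> \<gamma> < 1"
    and "\<phi> \<gamma> < 1 \<Longrightarrow> gen_Y \<mu> P \<xi> \<gamma> 2 = ennreal ((\<Sum>n. laplace_Y \<mu> U \<xi> n \<gamma> * \<beta> ^ n) / (1 - \<phi> \<gamma>))"
proof -
  define g where "g n = 2 ^ n * laplace_Y \<mu> P \<xi> n \<gamma>" for n
  define e where "e n = 2 ^ n * laplace_Y \<pi> P \<xi> n \<gamma>" for n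
  have g_nonneg: "0 \<le> g n" for n
    using laplace_Y_pos[OF \<mu> P \<xi> \<xi>_nonneg \<gamma>, of n] by (simp add: g_def)
  have ren: "2 ^ n * laplace_Y \<nu> P \<xi> n \<gamma> = laplace_Y \<nu> U \<xi> n \<gamma> * \<beta> ^ n
      + 2 * \<alpha> * (\<Sum>k<n. laplace_Y \<nu> U \<xi> k \<gamma> * \<beta> ^ k * e (n - 1 - k))"
    if \<nu>: "prob_space \<nu>" "sets \<nu> = sets borel" for \<nu> n
  proof -
    have "2 ^ n * (\<alpha> * (1 - \<alpha>) ^ k * laplace_Y \<nu> U \<xi> k \<gamma> * laplace_Y \<pi> P \<xi> (n - 1 - k) \<gamma>)
        = 2 * \<alpha> * (laplace_Y \<nu> U \<xi> k \<gamma> * \<beta> ^ k * e (n - 1 - k))" if "k < n" for k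
    proof -
      have "(2::real) ^ n = 2 ^ (n - 1 - k) * 2 ^ Suc k"
        using that by (simp add: power_add[symmetric] del: power_Suc)
      moreover have "\<beta> ^ k = 2 ^ k * (1 - \<alpha>) ^ k" unfolding \<beta>_def by (rule power_mult_distrib)
      ultimately show ?thesis by (simp add: e_def mult_ac)
    qed
    moreover have "\<beta> ^ n = 2 ^ n * (1 - \<alpha>) ^ n" unfolding \<beta>_def by (rule power_mult_distrib)
    then have "2 ^ n * ((1 - \<alpha>) ^ n * laplace_Y \<nu> U \<xi> n \<gamma>) = laplace_Y \<nu> U \<xi> n \<gamma> * \<beta> ^ n"
      by (simp add: mult_ac)
    ultimately show ?thesis
      unfolding laplace_Y_renewal[OF \<nu> \<xi> \<xi>_nonneg \<gamma>] distrib_left sum_distrib_left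
      by (intro arg_cong2[where f = "(+)"] sum.cong) auto
  qed
  note pos = laplace_Y_pos[OF _ _ U \<xi> \<xi>_nonneg \<gamma>]
  have nn: "0 \<le> laplace_Y \<nu> U \<xi> n \<gamma> * \<beta> ^ n" if "prob_space \<nu>" "sets \<nu> = sets borel" for \<nu> n
    using pos[OF that] \<beta> by (simp add: less_imp_le)
  have e_nonneg: "0 \<le> e n" for n
    using laplace_Y_pos[OF prob_pi sets_pi P \<xi> \<xi>_nonneg \<gamma>, of n] by (simp add: e_def)
  have e_eq: "e n = A \<gamma> n * \<beta> ^ n + 2 * \<alpha> * (\<Sum>k<n. A \<gamma> k * \<beta> ^ k * e (n - 1 - k))" for n
    unfolding e_def[of n] by (rule ren[OF prob_pi sets_pi])
  have g_eq: "g n = laplace_Y \<mu> U \<xi> n \<gamma> * \<beta> ^ n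
      + 2 * \<alpha> * (\<Sum>k<n. laplace_Y \<mu> U \<xi> k \<gamma> * \<beta> ^ k * e (n - 1 - k))" for n
    unfolding g_def by (rule ren[OF \<mu>])
  have c: "0 < 2 * \<alpha>" using alpha by simp
  have A0: "0 < A \<gamma> 0 * \<beta> ^ 0" "0 < laplace_Y \<mu> U \<xi> 0 \<gamma> * \<beta> ^ 0"
    using pos[OF prob_pi sets_pi] pos[OF \<mu>] by auto
  note series = renewal_series[OF nn[OF prob_pi sets_pi] A0(1) laplace_powser_summable[OF prob_pi sets_pi \<gamma>]
      nn[OF \<mu>] A0(2) laplace_powser_summable[OF \<mu> \<gamma>] c e_nonneg e_eq g_eq, folded \<phi>_def]
  have gen: "gen_Y \<mu> P \<xi> \<gamma> 2 = (\<Sum>n. ennreal (g n))" by (simp add: gen_Y_def g_def)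
  show "gen_Y \<mu> P \<xi> \<gamma> 2 < \<infinity> \<longleftrightarrow> \<phi> \<gamma> < 1"
    unfolding series(1)[symmetric] gen
    using summable_suminf_not_top[OF g_nonneg] ennreal_suminf_neq_top[OF _ g_nonneg] by (auto simp: less_top)
  show "gen_Y \<mu> P \<xi> \<gamma> 2 = ennreal ((\<Sum>n. laplace_Y \<mu> U \<xi> n \<gamma> * \<beta> ^ n) / (1 - \<phi> \<gamma>))" if "\<phi> \<gamma> < 1"
    unfolding gen series(2)[OF that, symmetric]
    using that g_nonneg by (intro suminf_ennreal2) (simp_all add: series(1))
qed

lemma nu_Y_eq:
  assumes \<mu>: "prob_space \<mu>" "sets \<mu> = sets borel"
  shows "nu_Y \<mu> P \<xi> = Inf (ereal ` {\<gamma>. 0 < \<gamma> \<and> \<phi> \<gamma> < 1})"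
proof -
  have "{\<gamma>. 0 < \<gamma> \<and> gen_Y \<mu> P \<xi> \<gamma> 2 < \<infinity>} = {\<gamma>. 0 < \<gamma> \<and> \<phi> \<gamma> < 1}"
    using gen_Y_at_2(1)[OF \<mu> less_imp_le] by blast
  then show ?thesis by (simp add: nu_Y_def)
qed

end

locale subcritical_half_mixture = half_mixture +
  assumes crit: "2 * \<alpha> * (\<Sum>n. (2 * (1 - \<alpha>)) ^ n * measure (chain_law \<pi> U)
       {\<omega> \<in> space (chain_law \<pi> U). additive_functional \<xi> n \<omega> = 0}) < 1"
begin

lemma \<phi>_subcritical_exists: "\<exists>\<gamma>>0. \<phi> \<gamma> < 1"
proof -
  have "eventually (\<lambda>\<gamma>. \<phi> \<gamma> < 1 \<and> 0 < \<gamma>) at_top"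
    by (intro eventually_conj order_tendstoD(2)[OF \<phi>_tendsto_at_top crit] eventually_gt_at_top)
  then have "\<exists>\<gamma>. \<phi> \<gamma> < 1 \<and> 0 < \<gamma>" by (rule eventually_happens'[rotated]) simp
  then show ?thesis by blast
qed

definition \<nu> :: real where "\<nu> = Inf {\<gamma>. 0 < \<gamma> \<and> \<phi> \<gamma> < 1}"

lemma bdd: "bdd_below {\<gamma>. 0 < \<gamma> \<and> \<phi> \<gamma> < 1}"
  by (intro bdd_belowI[of _ 0]) auto

lemma nu_Y_eq_\<nu>:
  assumes \<mu>: "prob_space \<mu>" "sets \<mu> = sets borel"
  shows "nu_Y \<mu> P \<xi> = ereal \<nu>"
  unfolding nu_Y_eq[OF \<mu>] \<nu>_def
  using \<phi>_subcritical_exists by (intro ereal_Inf'[OF bdd, symmetric]) auto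

lemma \<phi>_less_1: "\<nu> < \<gamma> \<Longrightarrow> \<phi> \<gamma> < 1"
proof -
  assume "\<nu> < \<gamma>"
  then obtain s where "0 < s" "\<phi> s < 1" "s < \<gamma>"
    unfolding \<nu>_def using \<phi>_subcritical_exists by (subst (asm) cInf_less_iff[OF _ bdd]) auto
  then show ?thesis using \<phi>_antimono[of s \<gamma>] by simp
qed

lemma \<phi>_ge_1: "0 < \<gamma> \<Longrightarrow> \<gamma> < \<nu> \<Longrightarrow> 1 \<le> \<phi> \<gamma>"
  using cInf_lower[OF _ bdd, of \<gamma>] unfolding \<nu>_def by fastforce

lemma \<nu>_pos: "0 < \<nu>"
proof -
  have "(\<phi> \<longlongrightarrow> \<phi> 0) (at 0 within {0..})"
    using \<phi>_continuous_on unfolding continuous_on_def by (rule bspec) simp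
  from order_tendstoD(1)[OF this \<phi>_0]
  have "eventually (\<lambda>\<gamma>. 1 < \<phi> \<gamma>) (at 0 within {0..})" .
  then obtain d where d': "0 < d" "\<forall>\<gamma>\<in>{0..}. \<gamma> \<noteq> 0 \<and> dist \<gamma> 0 < d \<longrightarrow> 1 < \<phi> \<gamma>"
    unfolding eventually_at by (elim exE conjE) (rule that)
  have d: "1 < \<phi> \<gamma>" if "0 < \<gamma>" "\<gamma> < d" for \<gamma>
    using d'(2)[rule_format, of \<gamma>] that by (simp add: dist_real_def)
  have "d \<le> \<nu>"
    unfolding \<nu>_def
  proof (rule cInf_greatest)
    show "d \<le> \<gamma>" if "\<gamma> \<in> {\<gamma>. 0 < \<gamma> \<and> \<phi> \<gamma> < 1}" for \<gamma>
      using d[of \<gamma>] that by force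
  qed (use \<phi>_subcritical_exists in auto)
  then show ?thesis using d'(1) by simp
qed

lemma \<phi>_\<nu>: "\<phi> \<nu> = 1"
proof -
  have c: "(\<phi> \<longlongrightarrow> \<phi> \<nu>) (at \<nu>)"
    unfolding isCont_def[symmetric]
    by (rule continuous_on_interior[OF \<phi>_continuous_on]) (use \<nu>_pos in simp)
  have lim: "(\<phi> \<longlongrightarrow> \<phi> \<nu>) (at_right \<nu>)" "(\<phi> \<longlongrightarrow> \<phi> \<nu>) (at_left \<nu>)"
    by (rule tendsto_mono[OF at_le[OF subset_UNIV] c])+
  have "\<phi> \<nu> \<le> 1"
    by (rule tendsto_upperbound[OF lim(1)])
       (use \<phi>_less_1 in \<open>auto simp: eventually_at_filter less_imp_le\<close>)
  moreover have "1 \<le> \<phi> \<nu>"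
  proof (rule tendsto_lowerbound[OF lim(2)])
    have "eventually (\<lambda>\<gamma>. \<gamma> \<in> {0<..<\<nu>}) (at_left \<nu>)" using \<nu>_pos by (rule eventually_at_left_real)
    then show "eventually (\<lambda>\<gamma>. 1 \<le> \<phi> \<gamma>) (at_left \<nu>)"
      by eventually_elim (use \<phi>_ge_1 in auto)
  qed simp
  ultimately show ?thesis by simp
qed

text \<open>
  By \<open>gen_Y_at_2\<close> the singularity at \<open>\<nu>\<close> is that of \<open>1 / (1 - \<phi> \<gamma>)\<close>, which \<open>convex_crossing_slope\<close>
  controls; the numerator is continuous there.
\<close>

lemma gen_Y_pole:
  assumes \<mu>: "prob_space \<mu>" "sets \<mu> = sets borel"
  shows "\<exists>C::ennreal. C < \<infinity> \<and>
    ((\<lambda>\<gamma>. ennreal ((\<gamma> - \<nu>) / \<gamma>) * gen_Y \<mu> P \<xi> \<gamma> 2) \<longlongrightarrow> C) (at_right \<nu>)"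
proof -
  let ?H = "\<lambda>\<gamma>. \<Sum>n. laplace_Y \<mu> U \<xi> n \<gamma> * \<beta> ^ n"
  have "\<exists>l\<ge>0. ((\<lambda>\<gamma>. (\<gamma> - \<nu>) / (1 - \<phi> \<gamma>)) \<longlongrightarrow> l) (at_right \<nu>)"
    by (rule convex_crossing_slope[OF \<phi>_convex_on less_imp_le[OF \<nu>_pos] \<phi>_\<nu> \<phi>_less_1])
  then obtain l where l: "0 \<le> l" "((\<lambda>\<gamma>. (\<gamma> - \<nu>) / (1 - \<phi> \<gamma>)) \<longlongrightarrow> l) (at_right \<nu>)"
    by blast
  have "isCont ?H \<nu>"
    by (rule continuous_on_interior[OF laplace_powser_continuous_on[OF \<mu>]]) (use \<nu>_pos in simp)
  then have H: "(?H \<longlongrightarrow> ?H \<nu>) (at_right \<nu>)"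
    unfolding isCont_def by (rule tendsto_mono[OF at_le[OF subset_UNIV]])
  have "((\<lambda>\<gamma>. ennreal (?H \<gamma> / \<gamma> * ((\<gamma> - \<nu>) / (1 - \<phi> \<gamma>)))) \<longlongrightarrow> ennreal (?H \<nu> / \<nu> * l)) (at_right \<nu>)"
    by (rule tendsto_ennrealI[OF tendsto_mult[OF tendsto_divide[OF H tendsto_ident_at] l(2)]])
       (use \<nu>_pos in simp)
  moreover have "eventually (\<lambda>\<gamma>. ennreal (?H \<gamma> / \<gamma> * ((\<gamma> - \<nu>) / (1 - \<phi> \<gamma>)))
      = ennreal ((\<gamma> - \<nu>) / \<gamma>) * gen_Y \<mu> P \<xi> \<gamma> 2) (at_right \<nu>)"
    using eventually_at_right_less[of \<nu>]
  proof eventually_elim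
    case (elim \<gamma>)
    have \<gamma>: "0 \<le> \<gamma>" using elim \<nu>_pos by simp
    have "0 \<le> ?H \<gamma>"
      using laplace_Y_pos[OF \<mu> U \<xi> \<xi>_nonneg \<gamma>] \<beta>
      by (intro suminf_nonneg laplace_powser_summable \<mu> \<gamma>) (simp add: less_imp_le)
    then show ?case
      unfolding gen_Y_at_2(2)[OF \<mu> \<gamma> \<phi>_less_1[OF elim]]
      using elim \<gamma> \<phi>_less_1[OF elim] \<nu>_pos by (subst ennreal_mult[symmetric]) (simp_all add: mult_ac)
  qed
  ultimately have "((\<lambda>\<gamma>. ennreal ((\<gamma> - \<nu>) / \<gamma>) * gen_Y \<mu> P \<xi> \<gamma> 2) \<longlongrightarrow> ennreal (?H \<nu> / \<nu> * l)) (at_right \<nu>)"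
    by (rule Lim_transform_eventually)
  then show ?thesis by (intro exI[of _ "ennreal (?H \<nu> / \<nu> * l)"]) simp
qed

end


section \<open>Conclusion for chains on \<open>\<real>\<^sup>d\<close>\<close>

theorem theorem2p5:
  fixes \<pi> :: "(real ^ 'd) measure"
    and U P :: "real ^ 'd \<Rightarrow> (real ^ 'd) measure"
    and \<alpha> :: real
    and \<xi> :: "real ^ 'd \<Rightarrow> real"
  assumes "prob_space \<pi>" and "sets \<pi> = sets borel"
    and "0 < \<alpha>" and "\<alpha> < 1"
    and "U \<in> borel \<rightarrow>\<^sub>M prob_algebra borel" and "\<pi> \<bind> U = \<pi>"
    and "P = mixture_kernel \<alpha> \<pi> U"
    and "\<xi> \<in> borel_measurable borel" and "\<forall>x. 0 \<le> \<xi> x"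
    and "\<not> (\<forall>n. AE \<omega> in chain_law \<pi> P. \<xi> (\<omega> n) = 0)"
  shows
    "(\<forall>p \<mu> a. 1 < p \<and> prob_with_Lp_density p \<pi> \<mu> \<and> p / (p - 1) < a \<longrightarrow>
        multiplicatively_ergodic (laplace_Y \<mu> P \<xi>)
          {\<gamma>. 0 < \<gamma> \<and> ennreal (1 - \<alpha>) < Lp_spectral_radius a \<pi> (laplace_operator P \<xi> \<gamma>)})
     \<and>
     (1 / 2 < \<alpha> \<and>
      2 * \<alpha> * (\<Sum>n. (2 * (1 - \<alpha>)) ^ n *
        measure (chain_law \<pi> U)
          {\<omega> \<in> space (chain_law \<pi> U). additive_functional \<xi> n \<omega> = 0}) < 1 \<longrightarrow>
        nu_Y \<pi> P \<xi> < \<infinity> \<and>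
        (\<forall>p \<mu>. 1 < p \<and> prob_with_Lp_density p \<pi> \<mu> \<longrightarrow> nu_Y \<mu> P \<xi> < \<infinity>))
     \<and>
     (1 / 2 < \<alpha> \<and> measure \<pi> {x. \<xi> x = 0} = 0 \<longrightarrow>
      2 * \<alpha> * (\<Sum>n. (2 * (1 - \<alpha>)) ^ n *
        measure (chain_law \<pi> U)
          {\<omega> \<in> space (chain_law \<pi> U). additive_functional \<xi> n \<omega> = 0}) < 1)
     \<and>
     (\<forall>\<tau>. 1 / 2 < \<alpha> \<and>
      2 * \<alpha> * (\<Sum>n. (2 * (1 - \<alpha>)) ^ n *
        measure (chain_law \<pi> U)
          {\<omega> \<in> space (chain_law \<pi> U). additive_functional \<xi> n \<omega> = 0}) < 1 \<and>
      1 < \<tau> \<and> (\<integral>\<^sup>+x. ennreal (\<xi> x powr \<tau>) \<partial>\<pi>) < \<infinity> \<longrightarrow>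
        (\<forall>\<mu>. \<mu> = \<pi> \<or> (\<exists>p. \<tau> / (\<tau> - 1) < p \<and> prob_with_Lp_density p \<pi> \<mu>) \<longrightarrow>
          (\<exists>C::ennreal. C < \<infinity> \<and>
             ((\<lambda>\<gamma>. ennreal ((\<gamma> - real_of_ereal (nu_Y \<mu> P \<xi>)) / \<gamma>) * gen_Y \<mu> P \<xi> \<gamma> 2) \<longlongrightarrow> C)
               (at_right (real_of_ereal (nu_Y \<mu> P \<xi>))))))"
proof -
  let ?crit = "2 * \<alpha> * (\<Sum>n. (2 * (1 - \<alpha>)) ^ n *
        measure (chain_law \<pi> U)
          {\<omega> \<in> space (chain_law \<pi> U). additive_functional \<xi> n \<omega> = 0}) < 1"
  have SM: "stationary_mixture \<pi> U \<alpha> \<xi>"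
  proof (intro stationary_mixture.intro mixture_chain.intro stationary_mixture_axioms.intro)
    show "0 \<le> \<xi> x" for x using assms(9) by (rule spec)
  qed (fact assms)+
  have sub: "subcritical_half_mixture \<pi> U \<alpha> \<xi>" if "1 / 2 < \<alpha>" ?crit
    using that
    by (intro subcritical_half_mixture.intro half_mixture.intro SM half_mixture_axioms.intro
        subcritical_half_mixture_axioms.intro)
  have prob: "prob_space \<mu>" "sets \<mu> = sets borel"
    if "\<mu> = \<pi> \<or> (\<exists>p. prob_with_Lp_density p \<pi> \<mu>)" for \<mu>
  proof -
    have "prob_space \<mu> \<and> sets \<mu> = sets borel"
      using that
    proof (elim disjE exE)
      assume "\<mu> = \<pi>"
      then show ?thesis by (simp only: assms(1,2) simp_thms)
    next
      fix p assume "prob_with_Lp_density p \<pi> \<mu>"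
      from prob_with_Lp_density_imp_prob[OF this assms(2)] show ?thesis by (rule conjI)
    qed
    then show "prob_space \<mu>" "sets \<mu> = sets borel" by (rule conjunct1, rule conjunct2)
  qed
  have nu: "nu_Y \<mu> P \<xi> = ereal (subcritical_half_mixture.\<nu> \<pi> U \<alpha> \<xi>)"
    if "1 / 2 < \<alpha>" ?crit "\<mu> = \<pi> \<or> (\<exists>p. prob_with_Lp_density p \<pi> \<mu>)" for \<mu>
    unfolding assms(7)
    by (rule subcritical_half_mixture.nu_Y_eq_\<nu>[OF sub[OF that(1,2)] prob[OF that(3)]])
  have ergodic: "multiplicatively_ergodic (laplace_Y \<mu> P \<xi>)
      {\<gamma>. 0 < \<gamma> \<and> ennreal (1 - \<alpha>) < Lp_spectral_radius a \<pi> (laplace_operator P \<xi> \<gamma>)}"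
    if "1 < p" "prob_with_Lp_density p \<pi> \<mu>" "p / (p - 1) < a" for p \<mu> a
  proof -
    have "1 < p / (p - 1)" using that(1) by (simp add: less_divide_eq)
    with that(3) have a: "1 < a" by simp
    have "{\<gamma>. 0 < \<gamma> \<and> ennreal (1 - \<alpha>) < Lp_spectral_radius a \<pi> (laplace_operator P \<xi> \<gamma>)}
        = stationary_mixture.supercritical \<pi> U \<alpha> \<xi>"
      unfolding stationary_mixture.supercritical_def[OF SM] assms(7)
    proof (intro Collect_cong conj_cong refl)
      fix \<gamma> :: real assume "0 < \<gamma>"
      from stationary_mixture.spectral_radius_gt_iff[OF SM a less_imp_le[OF this]]
      show "ennreal (1 - \<alpha>) < Lp_spectral_radius a \<pi> (laplace_operator (mixture_kernel \<alpha> \<pi> U) \<xi> \<gamma>)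
          \<longleftrightarrow> (\<exists>N. 1 < \<alpha> / (1 - \<alpha>) * (\<Sum>n<N. laplace_Y \<pi> U \<xi> n \<gamma>))" .
    qed
    moreover have "multiplicatively_ergodic (laplace_Y \<mu> P \<xi>) (stationary_mixture.supercritical \<pi> U \<alpha> \<xi>)"
      unfolding assms(7)
      by (rule stationary_mixture.multiplicatively_ergodic_supercritical[OF SM prob])
         (rule disjI2, rule exI, rule that(2))+
    ultimately show ?thesis by (simp only:)
  qed
  have zero: ?crit if "measure \<pi> {x. \<xi> x = 0} = 0"
  proof -
    have "measure (chain_law \<pi> U) {\<omega> \<in> space (chain_law \<pi> U). additive_functional \<xi> n \<omega> = 0} = 0" for n
      using assms(9) by (intro measure_additive_functional_eq_0[OF assms(1,2,5,8) _ that]) auto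
    then show ?thesis by simp
  qed
  have pole: "\<exists>C::ennreal. C < \<infinity> \<and>
      ((\<lambda>\<gamma>. ennreal ((\<gamma> - real_of_ereal (nu_Y \<mu> P \<xi>)) / \<gamma>) * gen_Y \<mu> P \<xi> \<gamma> 2) \<longlongrightarrow> C)
        (at_right (real_of_ereal (nu_Y \<mu> P \<xi>)))"
    if "1 / 2 < \<alpha>" ?crit "\<mu> = \<pi> \<or> (\<exists>p. prob_with_Lp_density p \<pi> \<mu>)" for \<mu>
    unfolding nu[OF that] unfolding real_of_ereal.simps assms(7)
    by (rule subcritical_half_mixture.gen_Y_pole[OF sub[OF that(1,2)] prob[OF that(3)]])
  show ?thesis
  proof (intro conjI allI impI)
    fix \<tau> \<mu>
    assume "1 / 2 < \<alpha> \<and> ?crit \<and> 1 < \<tau> \<and> (\<integral>\<^sup>+x. ennreal (\<xi> x powr \<tau>) \<partial>\<pi>) < \<infinity>"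
      and "\<mu> = \<pi> \<or> (\<exists>p. \<tau> / (\<tau> - 1) < p \<and> prob_with_Lp_density p \<pi> \<mu>)"
    then show "\<exists>C::ennreal. C < \<infinity> \<and>
      ((\<lambda>\<gamma>. ennreal ((\<gamma> - real_of_ereal (nu_Y \<mu> P \<xi>)) / \<gamma>) * gen_Y \<mu> P \<xi> \<gamma> 2) \<longlongrightarrow> C)
        (at_right (real_of_ereal (nu_Y \<mu> P \<xi>)))"
      by (elim conjE) (rule pole, assumption, assumption, blast)
  next
    assume "1 / 2 < \<alpha> \<and> ?crit"
    then show "nu_Y \<pi> P \<xi> < \<infinity>" using nu[of \<pi>] by simp
  next
    fix p \<mu>
    assume "1 / 2 < \<alpha> \<and> ?crit" "1 < p \<and> prob_with_Lp_density p \<pi> \<mu>"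
    then have "nu_Y \<mu> P \<xi> = ereal (subcritical_half_mixture.\<nu> \<pi> U \<alpha> \<xi>)"
      by (elim conjE) (rule nu, assumption, assumption, blast)
    then show "nu_Y \<mu> P \<xi> < \<infinity>" by simp
  next
    fix p \<mu> a
    assume "1 < p \<and> prob_with_Lp_density p \<pi> \<mu> \<and> p / (p - 1) < a"
    then show "multiplicatively_ergodic (laplace_Y \<mu> P \<xi>)
        {\<gamma>. 0 < \<gamma> \<and> ennreal (1 - \<alpha>) < Lp_spectral_radius a \<pi> (laplace_operator P \<xi> \<gamma>)}"
      by (elim conjE) (rule ergodic[of p \<mu> a])
  next
    assume "1 / 2 < \<alpha> \<and> measure \<pi> {x. \<xi> x = 0} = 0"
    then show ?crit by (elim conjE) (rule zero)
  qed
qed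

end
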